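(* Let $X=IG_\omega(m,\mathbb{C}^N)$ be a Grassmannian of Lie type $B$, $C$, or $D$, and let $T\preceq P$ be Schubert symbols in $\Omega(X)$. Then $Z_{P,T}$ is a complete intersection in $\mathbb{P}^{N-1}$ cut out by the following polynomials: (a) $f_d-f_c$, for each pair $c<d$ of consecutive elements of $\mathcal Q_{P,T}$ with $d-c\ge 2$; and (b) $x_c$, for each $c\in\mathcal L_{P,T}$.
   Context: Setting. Let $N\ge 2$, and let $\omega$ be a nondegenerate bilinear form on $\mathbb{C}^N$, symmetric or skew-symmetric, with a fixed basis $\mathbf e_1,\dots,\mathbf e_N$ such that $\omega(\mathbf e_i,\mathbf e_j)=\delta_{i+j,N+1}$ for $i\le j$. For a positive integer $m\le N/2$, $X=IG_\omega(m,\mathbb{C}^N)$ is the projective variety of isotropic $m$-dimensional subspaces of $\mathbb{C}^N$. Type $C$: $\omega$ skew-symmetric, $N=2n$. Type $B$: $\omega$ symmetric, $N=2n+1$. Type $D$: $\omega$ symmetric, $N=2n+2$. $[a,b]$ denotes an integer interval. Schubert symbols. A Schubert symbol is a subset $P=\{p_1<\dots<p_m\}\subset[1,N]$ of cardinality $m$ with $c+d\ne N+1$ for all $c,d\in P$ (including $c=d$). $\Omega(X)$ is the set of all of them. Convention: $p_0=0$, $p_{m+1}=N+1$ (not elements of $P$). Put $\bar P=\{c: N+1-c\in P\}$, $[P]=P\cup\bar P$. $X_P$ is the closure in $X$ of $\{\Sigma\in X:\ \{c:\Sigma\cap\langle\mathbf e_1,\dots,\mathbf e_c\rangle\supsetneq\Sigma\cap\langle\mathbf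 e_1,\dots,\mathbf e_{c-1}\rangle\}=P\}$. $T\preceq P$ means $X_T\subset X_P$; $T\le P$ means $t_i\le p_i$ for all $i$ (and $T\preceq P$ implies $T\le P$). In type $D$, $\mathfrak t(P)\in\{0,1,2\}$: if $n+1\in[P]$, $\mathfrak t(P)\in\{0,1\}$ is the parity of $\#([1,n+1]\setminus P)$; otherwise $\mathfrak t(P)=2$. Cuts. Let $T\le P$. A visible cut is $c\in[0,N]$ with $p_i\le c<t_{i+1}$ for some $i\in[0,m]$. An apparent cut is $c\in[0,N]$ such that $c$ or $N-c$ is a visible cut. In types $B,C$ the cuts are the apparent cuts. In type $D$ the cuts are the apparent cuts together with the exceptional cuts: (1) $n+1$ is a cut if for some $i\in[1,m]$ either $p_i=n+2\le t_{i+1}$ or $t_i=n+1\ge p_{i-1}$; (2) if $\mathfrak t(T)\ne\mathfrak t(P)$, then for each $c\in[1,n]$ with $[c+1,n+1]\subset[P]\cap[T]$ and $\#(T\cap[1,c])=\#(P\cap[1,c])+1$, both $c$ and $N-c$ are cuts. $\mathcal C_{P,T}$ is the set of cuts. Equations. $c$ is a zero column if $p_j<c<t_{j+1}$ for some $j\in[0,m]$. Column $c$ contains a lone star if ($c\in T$ and $c\in\mathcal C_{P,T}$) or ($c\in P$ and $c-1\in\mathcal C_{P,T}$). $\mathcal L_{P,T}$ is the set of $c\in[1,N]$ such that $c$ is a zero column or column $N+1-c$ contains a lone star. $\mathcal Q_{P,T}=[0,n]\cap\mathcal C_{P,T}$ in type $C$, and $\mathcal Q_{P,T}=([0,n]\cap\mathcal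 C_{P,T})\cup\{n+1\}$ in types $B,D$. Let $x_1,\dots,x_N$ be the coordinates dual to $\mathbf e_1,\dots,\mathbf e_N$; $f_0=0$, $f_c=\sum_{i=1}^c x_ix_{N+1-i}$ for $1\le c\le n$; in type $B$, $f_{n+1}=\sum_{i=1}^n x_ix_{N+1-i}+\frac12x_{n+1}^2$; in type $D$, $f_{n+1}=\sum_{i=1}^{n+1}x_ix_{N+1-i}$. $Z_{P,T}\subset\mathbb{P}^{N-1}$ is the subvariety defined by $\{f_c: c\in\mathcal Q_{P,T}\}\cup\{x_c: c\in\mathcal L_{P,T}\}$. "Complete intersection cut out by $g_1,\dots,g_s$" means that the homogeneous ideal of $Z_{P,T}$ is generated by $g_1,\dots,g_s$ and $Z_{P,T}$ has codimension $s$. *)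

theory Defs
  imports "HOL-Analysis.Analysis" "HOL-Library.Poly_Mapping"
begin

section \<open>Polynomials over the complex numbers\<close>

type_synonym 'i cpoly = "('i \<Rightarrow>\<^sub>0 nat) \<Rightarrow>\<^sub>0 complex"

definition cpoly_const :: "complex \<Rightarrow> 'i cpoly" where
  "cpoly_const a = Poly_Mapping.single 0 a"

definition cpoly_var :: "'i \<Rightarrow> 'i cpoly" where
  "cpoly_var i = Poly_Mapping.single (Poly_Mapping.single i 1) 1"

definition cpoly_eval :: "'i cpoly \<Rightarrow> ('i \<Rightarrow> complex) \<Rightarrow> complex" where
  "cpoly_eval F a =
     (\<Sum>\<mu>\<in>Poly_Mapping.keys F. Poly_Mapping.lookup F \<mu> *
        (\<Prod>i\<in>Poly_Mapping.keys \<mu>. a i ^ Poly_Mapping.lookup \<mu> i))"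

definition cpoly_ring :: "'i set \<Rightarrow> 'i cpoly set" where
  "cpoly_ring V = {F. \<forall>\<mu>\<in>Poly_Mapping.keys F. Poly_Mapping.keys \<mu> \<subseteq> V}"

definition homogeneous :: "nat \<Rightarrow> 'i cpoly \<Rightarrow> bool" where
  "homogeneous k F \<longleftrightarrow>
     (\<forall>\<mu>\<in>Poly_Mapping.keys F. (\<Sum>i\<in>Poly_Mapping.keys \<mu>. Poly_Mapping.lookup \<mu> i) = k)"

text \<open>The ideal of \<open>cpoly_ring V\<close> generated by a set \<open>G\<close> of elements of that ring.\<close>

definition cpoly_ideal :: "'i set \<Rightarrow> 'i cpoly set \<Rightarrow> 'i cpoly set" where
  "cpoly_ideal V G =
     {F. \<exists>S h. finite S \<and> S \<subseteq> G \<and> (\<forall>g\<in>S. h g \<in> cpoly_ring V) \<and> F = (\<Sum>g\<in>S. h g * g)}"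

section \<open>Dimension of topological spaces\<close>

definition irreducible_closed :: "'a topology \<Rightarrow> 'a set \<Rightarrow> bool" where
  "irreducible_closed X W \<longleftrightarrow> closedin X W \<and> W \<noteq> {} \<and>
     (\<forall>A B. closedin X A \<and> closedin X B \<and> W = A \<union> B \<longrightarrow> W = A \<or> W = B)"

definition has_irreducible_chain :: "'a topology \<Rightarrow> nat \<Rightarrow> bool" where
  "has_irreducible_chain X k \<longleftrightarrow>
     (\<exists>W :: nat \<Rightarrow> 'a set. (\<forall>i\<le>k. irreducible_closed X (W i)) \<and> (\<forall>i<k. W i \<subset> W (Suc i)))"

text \<open>
  A relation rather than a function, so that the empty space (which has no chain at all) and
  spaces of infinite dimension have no dimension.
\<close>

definition has_krull_dim :: "'a topology \<Rightarrow> nat \<Rightarrow> bool" where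
  "has_krull_dim X k \<longleftrightarrow>
     has_irreducible_chain X k \<and> (\<forall>l. has_irreducible_chain X l \<longrightarrow> l \<le> k)"

section \<open>Projective space and Grassmannians\<close>

text \<open>
  The vector space is \<open>complex ^ 'n\<close>, with \<open>N = CARD('n)\<close>. Its distinguished basis is the family
  \<open>e 1, \<dots>, e N\<close>; the values of \<open>e\<close> outside \<open>{1..N}\<close> are irrelevant.
\<close>

definition is_basis :: "(nat \<Rightarrow> complex ^ 'n) \<Rightarrow> bool" where
  "is_basis e \<longleftrightarrow> inj_on e {1..CARD('n)} \<and> vec.independent (e ` {1..CARD('n)})
     \<and> vec.span (e ` {1..CARD('n)}) = UNIV"

text \<open>\<open>coord e v c\<close> is the value \<open>x\<^sub>c(v)\<close> of the coordinate dual to \<open>e c\<close>.\<close>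

definition coord :: "(nat \<Rightarrow> complex ^ 'n) \<Rightarrow> complex ^ 'n \<Rightarrow> nat \<Rightarrow> complex" where
  "coord e v c = vec.representation (e ` {1..CARD('n)}) v (e c)"

definition grassmannian :: "nat \<Rightarrow> (complex ^ 'n) set set" where
  "grassmannian m = {\<Sigma>. vec.subspace \<Sigma> \<and> vec.dim \<Sigma> = m}"

abbreviation projective_space :: "(complex ^ 'n) set set" where
  "projective_space \<equiv> grassmannian 1"

text \<open>
  A homogeneous polynomial in \<open>x\<^sub>1, \<dots>, x\<^sub>N\<close> vanishes at a point of projective space, i.e.\ at a line
  through the origin, iff it vanishes at all vectors of that line.
\<close>

definition vanishes_at :: "(nat \<Rightarrow> complex ^ 'n) \<Rightarrow> nat cpoly \<Rightarrow> (complex ^ 'n) set \<Rightarrow> bool" where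
  "vanishes_at e F L \<longleftrightarrow> (\<forall>v\<in>L. cpoly_eval F (coord e v) = 0)"

definition proj_zeros :: "(nat \<Rightarrow> complex ^ 'n) \<Rightarrow> nat cpoly set \<Rightarrow> (complex ^ 'n) set set" where
  "proj_zeros e G = {L \<in> projective_space. \<forall>F\<in>G. vanishes_at e F L}"

text \<open>
  The Zariski topology has the complements of hypersurfaces as a basis of open sets.
\<close>

definition proj_zariski :: "(nat \<Rightarrow> complex ^ 'n) \<Rightarrow> (complex ^ 'n) set topology" where
  "proj_zariski e = topology_generated_by
     {projective_space - proj_zeros e {F} | F k. F \<in> cpoly_ring {1..CARD('n)} \<and> homogeneous k F}"

definition homogeneous_ideal ::
  "(nat \<Rightarrow> complex ^ 'n) \<Rightarrow> (complex ^ 'n) set set \<Rightarrow> nat cpoly set" where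
  "homogeneous_ideal e Z = cpoly_ideal {1..CARD('n)}
     {F \<in> cpoly_ring {1..CARD('n)}. (\<exists>k. homogeneous k F) \<and> (\<forall>L\<in>Z. vanishes_at e F L)}"

definition complete_intersection_cut_out_by ::
  "(nat \<Rightarrow> complex ^ 'n) \<Rightarrow> (complex ^ 'n) set set \<Rightarrow> nat cpoly set \<Rightarrow> bool" where
  "complete_intersection_cut_out_by e Z G \<longleftrightarrow>
     finite G \<and> G \<subseteq> cpoly_ring {1..CARD('n)} \<and>
     homogeneous_ideal e Z = cpoly_ideal {1..CARD('n)} G \<and>
     (\<exists>k. has_krull_dim (subtopology (proj_zariski e) Z) k \<and> k + card G = CARD('n) - 1)"

text \<open>
  Increasing enumeration \<open>p\<^sub>1 < \<dots> < p\<^sub>m\<close> of a finite set \<open>P\<close> of numbers, with the conventions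
  \<open>p\<^sub>0 = 0\<close> and \<open>p\<^sub>i = N + 1\<close> for \<open>i > m\<close>.
\<close>

definition entry :: "nat \<Rightarrow> nat set \<Rightarrow> nat \<Rightarrow> nat" where
  "entry N P i = (if i = 0 then 0
     else if i \<le> card P then sorted_list_of_set P ! (i - 1) else N + 1)"

definition is_frame :: "nat \<Rightarrow> (nat \<Rightarrow> complex ^ 'n) \<Rightarrow> (complex ^ 'n) set \<Rightarrow> bool" where
  "is_frame m b \<Sigma> \<longleftrightarrow> inj_on b {1..m} \<and> vec.independent (b ` {1..m}) \<and> vec.span (b ` {1..m}) = \<Sigma>"

text \<open>
  The Pluecker coordinate of index \<open>I \<subseteq> {1..N}\<close>, \<open>card I = m\<close>: the minor with rows \<open>I\<close> of the
  \<open>N \<times> m\<close> matrix whose columns are the coordinates of \<open>b 1, \<dots>, b m\<close>.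
\<close>

definition pluecker ::
  "(nat \<Rightarrow> complex ^ 'n) \<Rightarrow> nat \<Rightarrow> (nat \<Rightarrow> complex ^ 'n) \<Rightarrow> nat set \<Rightarrow> complex" where
  "pluecker e m b I = (\<Sum>\<pi> | \<pi> permutes {1..m}.
     of_int (sign \<pi>) * (\<Prod>j = 1..m. coord e (b (\<pi> j)) (entry (CARD('n)) I j)))"

text \<open>
  The Zariski topology induced by the Pluecker embedding. Another frame of the same subspace
  multiplies all Pluecker coordinates by the same nonzero factor, so that the nonvanishing of a
  homogeneous polynomial does not depend on the frame.
\<close>

definition grassmannian_zariski ::
  "(nat \<Rightarrow> complex ^ 'n) \<Rightarrow> nat \<Rightarrow> (complex ^ 'n) set topology" where
  "grassmannian_zariski e m = topology_generated_by
     {{\<Sigma> \<in> grassmannian m. \<exists>b. is_frame m b \<Sigma> \<and> cpoly_eval F (pluecker e m b) \<noteq> 0} | F k.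
        F \<in> cpoly_ring {I. I \<subseteq> {1..CARD('n)} \<and> card I = m} \<and> homogeneous k F}"

section \<open>Isotropic Grassmannians and their Schubert varieties\<close>

datatype lie_type = Type_B | Type_C | Type_D

definition bilinear_form :: "(complex ^ 'n \<Rightarrow> complex ^ 'n \<Rightarrow> complex) \<Rightarrow> bool" where
  "bilinear_form \<omega> \<longleftrightarrow> (\<forall>u. Vector_Spaces.linear (*s) (*) (\<lambda>v. \<omega> u v))
     \<and> (\<forall>v. Vector_Spaces.linear (*s) (*) (\<lambda>u. \<omega> u v))"

definition nondegenerate :: "(complex ^ 'n \<Rightarrow> complex ^ 'n \<Rightarrow> complex) \<Rightarrow> bool" where
  "nondegenerate \<omega> \<longleftrightarrow> (\<forall>u. (\<forall>v. \<omega> u v = 0) \<longrightarrow> u = 0) \<and> (\<forall>v. (\<forall>u. \<omega> u v = 0) \<longrightarrow> v = 0)"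

definition symmetric_form :: "(complex ^ 'n \<Rightarrow> complex ^ 'n \<Rightarrow> complex) \<Rightarrow> bool" where
  "symmetric_form \<omega> \<longleftrightarrow> (\<forall>u v. \<omega> v u = \<omega> u v)"

definition skew_form :: "(complex ^ 'n \<Rightarrow> complex ^ 'n \<Rightarrow> complex) \<Rightarrow> bool" where
  "skew_form \<omega> \<longleftrightarrow> (\<forall>u v. \<omega> v u = - \<omega> u v)"

definition has_lie_type ::
  "(complex ^ 'n \<Rightarrow> complex ^ 'n \<Rightarrow> complex) \<Rightarrow> lie_type \<Rightarrow> nat \<Rightarrow> bool" where
  "has_lie_type \<omega> \<tau> n \<longleftrightarrow> (case \<tau> of
       Type_B \<Rightarrow> symmetric_form \<omega> \<and> CARD('n) = 2 * n + 1
     | Type_C \<Rightarrow> skew_form \<omega> \<and> CARD('n) = 2 * n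
     | Type_D \<Rightarrow> symmetric_form \<omega> \<and> CARD('n) = 2 * n + 2)"

definition IG :: "(complex ^ 'n \<Rightarrow> complex ^ 'n \<Rightarrow> complex) \<Rightarrow> nat \<Rightarrow> (complex ^ 'n) set set" where
  "IG \<omega> m = {\<Sigma> \<in> grassmannian m. \<forall>u\<in>\<Sigma>. \<forall>v\<in>\<Sigma>. \<omega> u v = 0}"

definition schubert_symbols :: "nat \<Rightarrow> nat \<Rightarrow> nat set set" where
  "schubert_symbols N m = {P. P \<subseteq> {1..N} \<and> card P = m \<and> (\<forall>c\<in>P. \<forall>d\<in>P. c + d \<noteq> N + 1)}"

definition schubert_cell ::
  "(complex ^ 'n \<Rightarrow> complex ^ 'n \<Rightarrow> complex) \<Rightarrow> (nat \<Rightarrow> complex ^ 'n) \<Rightarrow> nat \<Rightarrow> nat set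
     \<Rightarrow> (complex ^ 'n) set set" where
  "schubert_cell \<omega> e m P = {\<Sigma> \<in> IG \<omega> m.
     {c \<in> {1..CARD('n)}. \<Sigma> \<inter> vec.span (e ` {1..c - 1}) \<subset> \<Sigma> \<inter> vec.span (e ` {1..c})} = P}"

definition schubert_variety ::
  "(complex ^ 'n \<Rightarrow> complex ^ 'n \<Rightarrow> complex) \<Rightarrow> (nat \<Rightarrow> complex ^ 'n) \<Rightarrow> nat \<Rightarrow> nat set
     \<Rightarrow> (complex ^ 'n) set set" where
  "schubert_variety \<omega> e m P =
     subtopology (grassmannian_zariski e m) (IG \<omega> m) closure_of schubert_cell \<omega> e m P"

definition schubert_le ::
  "(complex ^ 'n \<Rightarrow> complex ^ 'n \<Rightarrow> complex) \<Rightarrow> (nat \<Rightarrow> complex ^ 'n) \<Rightarrow> nat \<Rightarrow> nat set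
     \<Rightarrow> nat set \<Rightarrow> bool" where
  "schubert_le \<omega> e m T P \<longleftrightarrow> schubert_variety \<omega> e m T \<subseteq> schubert_variety \<omega> e m P"

section \<open>Cuts and the variety \<open>Z\<^bsub>P,T\<^esub>\<close>\<close>

definition sym_closure :: "nat \<Rightarrow> nat set \<Rightarrow> nat set" where
  "sym_closure N P = P \<union> {c \<in> {1..N}. N + 1 - c \<in> P}"

definition type_parity :: "nat \<Rightarrow> nat \<Rightarrow> nat set \<Rightarrow> nat" where
  "type_parity N n P =
     (if n + 1 \<in> sym_closure N P then card ({1..n + 1} - P) mod 2 else 2)"

definition visible_cuts :: "nat \<Rightarrow> nat set \<Rightarrow> nat set \<Rightarrow> nat set" where
  "visible_cuts N P T =
     {c \<in> {0..N}. \<exists>i\<in>{0..card P}. entry N P i \<le> c \<and> c < entry N T (i + 1)}"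

definition apparent_cuts :: "nat \<Rightarrow> nat set \<Rightarrow> nat set \<Rightarrow> nat set" where
  "apparent_cuts N P T =
     {c \<in> {0..N}. c \<in> visible_cuts N P T \<or> N - c \<in> visible_cuts N P T}"

definition middle_exceptional_cuts :: "nat \<Rightarrow> nat \<Rightarrow> nat set \<Rightarrow> nat set \<Rightarrow> nat set" where
  "middle_exceptional_cuts N n P T =
     {c. c = n + 1 \<and> (\<exists>i\<in>{1..card P}.
        (entry N P i = n + 2 \<and> n + 2 \<le> entry N T (i + 1)) \<or>
        (entry N T i = n + 1 \<and> entry N P (i - 1) \<le> n + 1))}"

definition parity_exceptional_cuts :: "nat \<Rightarrow> nat \<Rightarrow> nat set \<Rightarrow> nat set \<Rightarrow> nat set" where
  "parity_exceptional_cuts N n P T = (\<Union>c \<in> {c \<in> {1..n}.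
        type_parity N n T \<noteq> type_parity N n P \<and>
        {c + 1..n + 1} \<subseteq> sym_closure N P \<inter> sym_closure N T \<and>
        card (T \<inter> {1..c}) = card (P \<inter> {1..c}) + 1}. {c, N - c})"

definition cuts :: "lie_type \<Rightarrow> nat \<Rightarrow> nat \<Rightarrow> nat set \<Rightarrow> nat set \<Rightarrow> nat set" where
  "cuts \<tau> N n P T = apparent_cuts N P T \<union>
     (if \<tau> = Type_D then middle_exceptional_cuts N n P T \<union> parity_exceptional_cuts N n P T else {})"

definition zero_column :: "nat \<Rightarrow> nat set \<Rightarrow> nat set \<Rightarrow> nat \<Rightarrow> bool" where
  "zero_column N P T c \<longleftrightarrow> (\<exists>j\<in>{0..card P}. entry N P j < c \<and> c < entry N T (j + 1))"

definition lone_star :: "lie_type \<Rightarrow> nat \<Rightarrow> nat \<Rightarrow> nat set \<Rightarrow> nat set \<Rightarrow> nat \<Rightarrow> bool" where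
  "lone_star \<tau> N n P T c \<longleftrightarrow>
     (c \<in> T \<and> c \<in> cuts \<tau> N n P T) \<or> (c \<in> P \<and> c - 1 \<in> cuts \<tau> N n P T)"

definition L_set :: "lie_type \<Rightarrow> nat \<Rightarrow> nat \<Rightarrow> nat set \<Rightarrow> nat set \<Rightarrow> nat set" where
  "L_set \<tau> N n P T =
     {c \<in> {1..N}. zero_column N P T c \<or> lone_star \<tau> N n P T (N + 1 - c)}"

definition Q_set :: "lie_type \<Rightarrow> nat \<Rightarrow> nat \<Rightarrow> nat set \<Rightarrow> nat set \<Rightarrow> nat set" where
  "Q_set \<tau> N n P T =
     ({0..n} \<inter> cuts \<tau> N n P T) \<union> (if \<tau> = Type_C then {} else {n + 1})"

text \<open>
  \<open>quadric \<tau> N n c\<close> is the polynomial \<open>f\<^sub>c\<close>, meaningful for \<open>c \<le> n\<close>, and for \<open>c = n + 1\<close> in types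
  B and D.
\<close>

definition quadric :: "lie_type \<Rightarrow> nat \<Rightarrow> nat \<Rightarrow> nat \<Rightarrow> nat cpoly" where
  "quadric \<tau> N n c =
     (if \<tau> = Type_B \<and> c = n + 1
      then (\<Sum>i = 1..n. cpoly_var i * cpoly_var (N + 1 - i))
             + cpoly_const (1 / 2) * cpoly_var (n + 1) ^ 2
      else (\<Sum>i = 1..c. cpoly_var i * cpoly_var (N + 1 - i)))"

definition Z_variety ::
  "(nat \<Rightarrow> complex ^ 'n) \<Rightarrow> lie_type \<Rightarrow> nat \<Rightarrow> nat set \<Rightarrow> nat set \<Rightarrow> (complex ^ 'n) set set" where
  "Z_variety e \<tau> n P T = proj_zeros e
     (quadric \<tau> (CARD('n)) n ` Q_set \<tau> (CARD('n)) n P T \<union>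
      cpoly_var ` L_set \<tau> (CARD('n)) n P T)"

definition consecutive_in :: "nat set \<Rightarrow> nat \<Rightarrow> nat \<Rightarrow> bool" where
  "consecutive_in Q c d \<longleftrightarrow> c \<in> Q \<and> d \<in> Q \<and> c < d \<and> (\<forall>q\<in>Q. \<not> (c < q \<and> q < d))"

end

theory Submission
  imports Defs
begin

text \<open>
  Counting functions turn the combinatorics of cuts into arithmetic: if \<open>c - 1\<close> and \<open>c\<close> both lie in
  \<open>\<Q>\<close>, one of \<open>x\<^sub>c\<close>, \<open>x\<^sub>N\<^sub>+\<^sub>1\<^sub>-\<^sub>c\<close> is among the linear equations, and no variable of \<open>f\<^sub>d - f\<^sub>c\<close> is among
  them when \<open>c < d\<close> are consecutive with \<open>d - c \<ge> 2\<close>. So \<open>Z\<close> is cut out by linear coordinates and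
  by quadrics \<open>y\<^sub>j z\<^sub>j + r\<^sub>j\<close> in pairwise disjoint sets of variables, with \<open>r\<^sub>j \<noteq> 0\<close>.

  Modulo these equations every polynomial has a normal form without monomials divisible by \<open>y\<^sub>j z\<^sub>j\<close>.
  A normal form vanishing on the cone over \<open>Z\<close> is zero: the torus \<open>(y\<^sub>j, z\<^sub>j) \<mapsto> (s y\<^sub>j, s\<^sup>-\<^sup>1 z\<^sub>j)\<close> separates
  the exponents of \<open>y\<^sub>j\<close> and \<open>z\<^sub>j\<close>, and the other variables are unconstrained. Hence the ideal. The
  number of normal monomials bounds the Hilbert function and with it the length of chains of
  irreducible closed subsets; restricting a polynomial parametrization of \<open>Z\<close> to coordinate
  subspaces gives a chain of the maximal length.

  That \<open>T \<preceq> P\<close> implies \<open>T \<le> P\<close> is read off from the Pluecker coordinate of index \<open>T\<close>. In type D one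
  needs slightly more for \<open>Z\<close> to be nonempty: the two families of maximal isotropic subspaces are
  told apart by the vanishing of skew-symmetric determinants of odd size.
\<close>

text \<open>The bound \<open>d - c \<ge> 2\<close> is what makes \<open>r\<^sub>j\<close> nonzero:
  after splitting off \<open>x\<^sub>c\<^sub>+\<^sub>1 x\<^sub>N\<^sub>-\<^sub>c\<close>, the
  difference \<open>f\<^sub>d - f\<^sub>c\<close> still contains another product, or the square of
  the middle variable in type B. A step of length 1 would give a product of two variables, or a
  square, and one of these variables is already a linear equation. Both estimates of the dimension
  count the variables outside \<open>L\<close> other than the \<open>z\<^sub>j\<close>. An
  irreducible chain of length \<open>l\<close> forces the Hilbert function to grow at least like the
  \<open>l\<close>-th power of the degree, and normal monomials bound this growth from above; the
  same variables, taken one after the other, index the explicit chain. The obstacle is the empty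
  set, which has no dimension: not all variables may be linear equations. The inequality
  \<open>T \<le> P\<close> does not ensure this. For \<open>N = 2\<close>, \<open>m = 1\<close> in
  type D the symbols \<open>T = {1}\<close>, \<open>P = {2}\<close> satisfy
  \<open>T \<le> P\<close>, but both variables are equations. Here \<open>X\<close> consists of two
  points and \<open>T \<preceq> P\<close> fails; in general the two families of isotropic subspaces
  play the role of these points.\<close>

abbreviation lookup :: "('i \<Rightarrow>\<^sub>0 'b :: zero) \<Rightarrow> 'i \<Rightarrow> 'b" where
  "lookup \<equiv> Poly_Mapping.lookup"

abbreviation keys :: "('i \<Rightarrow>\<^sub>0 'b :: zero) \<Rightarrow> 'i set" where
  "keys \<equiv> Poly_Mapping.keys"

abbreviation single :: "'i \<Rightarrow> 'b \<Rightarrow> 'i \<Rightarrow>\<^sub>0 'b :: zero" where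
  "single \<equiv> Poly_Mapping.single"

section \<open>Evaluation of polynomials\<close>

definition monomial_value :: "('i \<Rightarrow>\<^sub>0 nat) \<Rightarrow> ('i \<Rightarrow> complex) \<Rightarrow> complex" where
  "monomial_value \<mu> a = (\<Prod>i\<in>keys \<mu>. a i ^ lookup \<mu> i)"

definition monomial_degree :: "('i \<Rightarrow>\<^sub>0 nat) \<Rightarrow> nat" where
  "monomial_degree \<mu> = (\<Sum>i\<in>keys \<mu>. lookup \<mu> i)"

lemma monomial_value_superset:
  assumes "finite I" "keys \<mu> \<subseteq> I"
  shows "monomial_value \<mu> a = (\<Prod>i\<in>I. a i ^ lookup \<mu> i)"
  unfolding monomial_value_def
  by (rule prod.mono_neutral_left) (use assms in \<open>auto simp: in_keys_iff\<close>)

lemma monomial_degree_superset: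
  assumes "finite I" "keys \<mu> \<subseteq> I"
  shows "monomial_degree \<mu> = (\<Sum>i\<in>I. lookup \<mu> i)"
  unfolding monomial_degree_def
  by (rule sum.mono_neutral_left) (use assms in \<open>auto simp: in_keys_iff\<close>)

lemma keys_add_nat:
  fixes \<mu> \<nu> :: "'i \<Rightarrow>\<^sub>0 nat"
  shows "keys (\<mu> + \<nu>) = keys \<mu> \<union> keys \<nu>"
  by (auto simp: in_keys_iff lookup_add)

lemma monomial_value_0 [simp]: "monomial_value 0 a = 1"
  by (simp add: monomial_value_def)

lemma monomial_degree_0 [simp]: "monomial_degree 0 = 0"
  by (simp add: monomial_degree_def)

lemma monomial_value_single [simp]: "monomial_value (single i k) a = a i ^ k"
  by (simp add: monomial_value_def)

lemma monomial_degree_single [simp]: "monomial_degree (single i k) = k"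
  by (simp add: monomial_degree_def)

lemma monomial_value_add: "monomial_value (\<mu> + \<nu>) a = monomial_value \<mu> a * monomial_value \<nu> a"
proof -
  let ?I = "keys \<mu> \<union> keys \<nu>"
  show ?thesis
    by (simp add: monomial_value_superset[of ?I] keys_add_nat lookup_add power_add prod.distrib)
qed

lemma monomial_degree_add: "monomial_degree (\<mu> + \<nu>) = monomial_degree \<mu> + monomial_degree \<nu>"
proof -
  let ?I = "keys \<mu> \<union> keys \<nu>"
  show ?thesis
    by (simp add: monomial_degree_superset[of ?I] keys_add_nat lookup_add sum.distrib)
qed

lemma cpoly_eval_superset:
  assumes "finite K" "keys F \<subseteq> K"
  shows "cpoly_eval F a = (\<Sum>\<mu>\<in>K. lookup F \<mu> * monomial_value \<mu> a)"
  unfolding cpoly_eval_def monomial_value_def[symmetric]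
  by (rule sum.mono_neutral_left) (use assms in \<open>auto simp: in_keys_iff\<close>)

lemma cpoly_eval_0 [simp]: "cpoly_eval 0 a = 0"
  by (simp add: cpoly_eval_def)

lemma cpoly_eval_single [simp]: "cpoly_eval (single \<mu> c) a = c * monomial_value \<mu> a"
  by (simp add: cpoly_eval_superset[of "{\<mu>}"])

lemma cpoly_eval_add [simp]: "cpoly_eval (F + G) a = cpoly_eval F a + cpoly_eval G a"
proof -
  let ?K = "keys F \<union> keys G"
  show ?thesis
    by (simp add: cpoly_eval_superset[of ?K] keys_add lookup_add sum.distrib distrib_right)
qed

lemma cpoly_eval_uminus [simp]: "cpoly_eval (- F) a = - cpoly_eval F a"
  using cpoly_eval_add[of F "- F" a] by (simp add: add_eq_0_iff)

lemma cpoly_eval_diff [simp]: "cpoly_eval (F - G) a = cpoly_eval F a - cpoly_eval G a"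
  using cpoly_eval_add[of F "- G" a] by simp

lemma cpoly_eval_sum [simp]: "cpoly_eval (sum F A) a = (\<Sum>x\<in>A. cpoly_eval (F x) a)"
  by (induction A rule: infinite_finite_induct) auto

lemma cpoly_expand:
  fixes F :: "'i cpoly"
  shows "F = (\<Sum>\<mu>\<in>keys F. single \<mu> (lookup F \<mu>))"
proof (rule poly_mapping_eqI)
  fix \<nu>
  have "(\<Sum>\<mu>\<in>keys F. lookup (single \<mu> (lookup F \<mu>)) \<nu>)
      = (\<Sum>\<mu>\<in>keys F. if \<mu> = \<nu> then lookup F \<nu> else 0)"
    by (rule sum.cong) (auto simp: lookup_single when_def)
  then show "lookup F \<nu> = lookup (\<Sum>\<mu>\<in>keys F.
      single \<mu> (lookup F \<mu>)) \<nu>"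
    by (simp add: lookup_sum in_keys_iff)
qed

lemma cpoly_eval_mult [simp]: "cpoly_eval (F * G) a = cpoly_eval F a * cpoly_eval G a"
proof -
  have "F * G = (\<Sum>\<mu>\<in>keys F. \<Sum>\<nu>\<in>keys G.
      single (\<mu> + \<nu>) (lookup F \<mu> * lookup G \<nu>))"
    by (subst cpoly_expand[of F], subst cpoly_expand[of G])
       (simp add: sum_product mult_single)
  then show ?thesis
    by (simp add: cpoly_eval_superset[OF finite_keys order_refl, of F]
        cpoly_eval_superset[OF finite_keys order_refl, of G] sum_product monomial_value_add
        mult_ac)
qed

lemma cpoly_eval_1 [simp]: "cpoly_eval 1 a = 1"
  by (metis cpoly_eval_single monomial_value_0 mult_1 single_one)

lemma cpoly_eval_power [simp]: "cpoly_eval (F ^ k) a = cpoly_eval F a ^ k"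
  by (induction k) auto

lemma cpoly_eval_prod [simp]: "cpoly_eval (prod F A) a = (\<Prod>x\<in>A. cpoly_eval (F x) a)"
  by (induction A rule: infinite_finite_induct) auto

lemma cpoly_eval_const [simp]: "cpoly_eval (cpoly_const c) a = c"
  by (simp add: cpoly_const_def)

lemma cpoly_eval_var [simp]: "cpoly_eval (cpoly_var i) a = a i"
  by (simp add: cpoly_var_def)

lemma cpoly_eval_cong:
  assumes "F \<in> cpoly_ring V" "\<And>i. i \<in> V \<Longrightarrow> a i = b i"
  shows "cpoly_eval F a = cpoly_eval F b"
  unfolding cpoly_eval_def
  by (intro sum.cong refl arg_cong2[where f = "(*)"] prod.cong)
     (use assms in \<open>force simp: cpoly_ring_def\<close>)

lemma cpoly_eval_homogeneous:
  assumes "homogeneous k F"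
  shows "cpoly_eval F (\<lambda>i. s * a i) = s ^ k * cpoly_eval F a"
proof -
  have "monomial_value \<mu> (\<lambda>i. s * a i) = s ^ monomial_degree \<mu> * monomial_value \<mu> a" for \<mu>
    by (simp add: monomial_value_def monomial_degree_def power_mult_distrib prod.distrib power_sum)
  then show ?thesis
    unfolding cpoly_eval_def monomial_value_def[symmetric] sum_distrib_left
    by (intro sum.cong) (use assms in \<open>auto simp: homogeneous_def monomial_degree_def\<close>)
qed

text \<open>Arguments about irreducibility are reduced by this to univariate polynomials: a
  polynomial that is nonzero at one point of a polynomial curve vanishes at only finitely many
  parameters.\<close>

lemma cpoly_eval_curve_polynomial:
  assumes "\<And>i. \<exists>p. \<forall>t. \<gamma> t i = poly p t"
  shows "\<exists>p. \<forall>t. cpoly_eval F (\<gamma> t) = poly p t"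
proof -
  obtain q where q: "\<And>i t. \<gamma> t i = poly (q i) t"
    using assms by metis
  have "cpoly_eval F (\<gamma> t) = poly (\<Sum>\<mu>\<in>keys F. smult (lookup F \<mu>)
      (\<Prod>i\<in>keys \<mu>. q i ^ lookup \<mu> i)) t" for t
    by (simp add: cpoly_eval_def q poly_sum poly_prod)
  then show ?thesis by blast
qed

lemma homogeneous_iff: "homogeneous k F \<longleftrightarrow> (\<forall>\<mu>\<in>keys F. monomial_degree \<mu> = k)"
  by (simp add: homogeneous_def monomial_degree_def)

lemma homogeneous_0 [simp]: "homogeneous k 0"
  by (simp add: homogeneous_def)

lemma homogeneous_single [simp]: "monomial_degree \<mu> = k \<Longrightarrow> homogeneous k (single \<mu> c)"
  by (auto simp: homogeneous_iff split: if_splits)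

lemma homogeneous_add: "homogeneous k F \<Longrightarrow> homogeneous k G \<Longrightarrow> homogeneous k (F + G)"
  using keys_add[of F G] by (auto simp: homogeneous_iff)

lemma keys_cpoly_uminus [simp]: "keys (- F :: 'i cpoly) = keys F"
  by (auto simp: in_keys_iff)

lemma homogeneous_sum: "(\<And>x. x \<in> A \<Longrightarrow> homogeneous k (F x)) \<Longrightarrow> homogeneous k (sum F A)"
  by (induction A rule: infinite_finite_induct) (auto intro: homogeneous_add)

lemma homogeneous_mult: "homogeneous k F \<Longrightarrow> homogeneous l G \<Longrightarrow> homogeneous (k + l) (F * G)"
  using keys_mult[of F G] by (fastforce simp: homogeneous_iff monomial_degree_add)

lemma homogeneous_1: "homogeneous 0 1"
  by (simp add: homogeneous_def)

lemma homogeneous_power: "homogeneous k F \<Longrightarrow> homogeneous (k * l) (F ^ l)"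
  by (induction l) (auto simp: homogeneous_1 homogeneous_mult)

lemma homogeneous_var: "homogeneous 1 (cpoly_var i)"
  by (simp add: cpoly_var_def)

lemma homogeneous_const: "homogeneous 0 (cpoly_const c)"
  by (simp add: cpoly_const_def)

lemma cpoly_ring_0 [simp]: "0 \<in> cpoly_ring V"
  by (simp add: cpoly_ring_def)

lemma cpoly_ring_1 [simp]: "1 \<in> cpoly_ring V"
  by (simp add: cpoly_ring_def)

lemma cpoly_ring_single [simp]: "keys \<mu> \<subseteq> V \<Longrightarrow> single \<mu> c \<in> cpoly_ring V"
  by (auto simp: cpoly_ring_def split: if_splits)

lemma cpoly_ring_const [simp]: "cpoly_const c \<in> cpoly_ring V"
  by (simp add: cpoly_const_def)

lemma cpoly_ring_var [simp]: "i \<in> V \<Longrightarrow> cpoly_var i \<in> cpoly_ring V"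
  by (simp add: cpoly_var_def)

lemma cpoly_ring_add: "F \<in> cpoly_ring V \<Longrightarrow> G \<in> cpoly_ring V \<Longrightarrow> F + G \<in> cpoly_ring V"
  using keys_add[of F G] by (auto simp: cpoly_ring_def)

lemma cpoly_ring_uminus: "F \<in> cpoly_ring V \<Longrightarrow> - F \<in> cpoly_ring V"
  by (auto simp: cpoly_ring_def)

lemma cpoly_ring_mult: "F \<in> cpoly_ring V \<Longrightarrow> G \<in> cpoly_ring V \<Longrightarrow> F * G \<in> cpoly_ring V"
  using keys_mult[of F G] by (fastforce simp: cpoly_ring_def keys_add_nat)

lemma cpoly_ring_sum: "(\<And>x. x \<in> A \<Longrightarrow> F x \<in> cpoly_ring V) \<Longrightarrow> sum F A \<in> cpoly_ring V"
  by (induction A rule: infinite_finite_induct) (auto intro: cpoly_ring_add)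

lemma cpoly_ring_power: "F \<in> cpoly_ring V \<Longrightarrow> F ^ k \<in> cpoly_ring V"
  by (induction k) (auto intro: cpoly_ring_mult)

lemma cpoly_ring_mono: "V \<subseteq> V' \<Longrightarrow> F \<in> cpoly_ring V \<Longrightarrow> F \<in> cpoly_ring V'"
  by (auto simp: cpoly_ring_def)

text \<open>
  If \<open>\<sigma>\<close> acts on each \<open>g \<mu>\<close> by the scalar \<open>\<theta> \<mu>\<close>, evaluating a vanishing combination at all
  \<open>\<sigma>\<^sup>k x\<close> and taking the linear combination given by a Lagrange polynomial isolates an eigenspace.
\<close>

lemma isolate_eigenspace:
  fixes g :: "'m \<Rightarrow> 'x \<Rightarrow> complex" and \<theta> c :: "'m \<Rightarrow> complex"
  assumes "finite M"
    and act: "\<And>\<mu> x. \<mu> \<in> M \<Longrightarrow> x \<in> X \<Longrightarrow> g \<mu> (\<sigma> x) = \<theta> \<mu> * g \<mu> x"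
    and stable: "\<And>x. x \<in> X \<Longrightarrow> \<sigma> x \<in> X"
    and vanish: "\<And>x. x \<in> X \<Longrightarrow> (\<Sum>\<mu>\<in>M. c \<mu> * g \<mu> x) = 0"
    and "x \<in> X"
  shows "(\<Sum>\<mu>\<in>{\<mu>\<in>M. \<theta> \<mu> = \<kappa>}. c \<mu> * g \<mu> x) = 0"
proof -
  have iter: "(\<sigma> ^^ k) x \<in> X \<and> (\<forall>\<mu>\<in>M. g \<mu> ((\<sigma> ^^ k) x) = \<theta> \<mu> ^ k * g \<mu> x)" for k
    by (induction k) (auto simp: \<open>x \<in> X\<close> stable act)
  have pw: "(\<Sum>\<mu>\<in>M. \<theta> \<mu> ^ k * (c \<mu> * g \<mu> x)) = 0" for k
  proof -
    have "(\<Sum>\<mu>\<in>M. \<theta> \<mu> ^ k * (c \<mu> * g \<mu> x)) = (\<Sum>\<mu>\<in>M. c \<mu> * g \<mu> ((\<sigma> ^^ k) x))"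
      by (rule sum.cong) (use iter[of k] in \<open>auto\<close>)
    also have "\<dots> = 0"
      using vanish iter by blast
    finally show ?thesis .
  qed
  have poly0: "(\<Sum>\<mu>\<in>M. poly p (\<theta> \<mu>) * (c \<mu> * g \<mu> x)) = 0" for p
  proof -
    have "(\<Sum>\<mu>\<in>M. poly p (\<theta> \<mu>) * (c \<mu> * g \<mu> x)) =
        (\<Sum>i\<le>degree p. coeff p i * (\<Sum>\<mu>\<in>M. \<theta> \<mu> ^ i * (c \<mu> * g \<mu> x)))"
      by (simp only: poly_altdef sum_distrib_right sum_distrib_left)
         (subst sum.swap, simp add: mult_ac)
    then show ?thesis by (simp add: pw)
  qed
  define p where "p = (\<Prod>l\<in>\<theta> ` M - {\<kappa>}. [:- l, 1:])"
  have p0: "poly p (\<theta> \<mu>) = 0" if "\<mu> \<in> M" "\<theta> \<mu> \<noteq> \<kappa>" for \<mu>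
    unfolding p_def poly_prod by (rule prod_zero) (use that \<open>finite M\<close> in auto)
  have p1: "poly p \<kappa> \<noteq> 0"
    using \<open>finite M\<close> by (auto simp: p_def poly_prod)
  have "(\<Sum>\<mu>\<in>M. poly p (\<theta> \<mu>) * (c \<mu> * g \<mu> x)) =
      (\<Sum>\<mu>\<in>{\<mu>\<in>M. \<theta> \<mu> = \<kappa>}. poly p (\<theta> \<mu>) * (c \<mu> * g \<mu> x))"
    by (rule sum.mono_neutral_right) (use \<open>finite M\<close> p0 in auto)
  also have "\<dots> = poly p \<kappa> * (\<Sum>\<mu>\<in>{\<mu>\<in>M. \<theta> \<mu> = \<kappa>}. c \<mu> * g \<mu> x)"
    by (simp add: sum_distrib_left)
  finally show ?thesis using poly0 p1 by simp
qed

text \<open>Doubling the coordinate \<open>i\<close> multiplies a monomial by 2 to the power of its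
  exponent at \<open>i\<close>. Isolating eigenspaces for one coordinate after the other leaves only
  the monomial \<open>\<nu>\<close>.\<close>

lemma cpoly_coeffs_zero:
  fixes c :: "('i \<Rightarrow>\<^sub>0 nat) \<Rightarrow> complex"
  assumes "finite M" and "\<And>a. (\<Sum>\<mu>\<in>M. c \<mu> * monomial_value \<mu> a) = 0" and "\<nu> \<in> M"
  shows "c \<nu> = 0"
proof -
  have "finite (\<Union>(keys ` M))" (is "finite ?I")
    using assms by auto
  have isolate: "(\<Sum>\<mu>\<in>{\<mu>\<in>M. \<forall>i\<in>I. lookup \<mu> i = lookup \<nu> i}.
      c \<mu> * monomial_value \<mu> a) = 0" (is "sum _ (?M I) = 0") if "finite I" for I a
    using that
  proof (induction I arbitrary: a rule: finite_induct)
    case empty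
    then show ?case using assms by simp
  next
    case (insert i I)
    define \<sigma> :: "('i \<Rightarrow> complex) \<Rightarrow> 'i \<Rightarrow> complex" where "\<sigma> a = a(i := 2 * a i)" for a
    have act: "monomial_value \<mu> (\<sigma> a) = 2 ^ lookup \<mu> i * monomial_value \<mu> a" for \<mu> a
    proof -
      have "monomial_value \<mu> (\<sigma> a) = (\<Prod>j\<in>keys \<mu> \<union> {i}. \<sigma> a j ^ lookup \<mu> j)"
        by (rule monomial_value_superset) auto
      also have "\<dots> = (\<Prod>j\<in>keys \<mu> \<union> {i}. (if j = i then 2 ^ lookup \<mu> i else 1) *
          a j ^ lookup \<mu> j)"
        by (rule prod.cong) (auto simp: \<sigma>_def power_mult_distrib)
      also have "\<dots> = 2 ^ lookup \<mu> i *
          (\<Prod>j\<in>keys \<mu> \<union> {i}. a j ^ lookup \<mu> j)"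
        by (simp only: prod.distrib) simp
      also have "(\<Prod>j\<in>keys \<mu> \<union> {i}. a j ^ lookup \<mu> j) = monomial_value \<mu> a"
        by (rule monomial_value_superset[symmetric]) auto
      finally show ?thesis .
    qed
    have "(\<Sum>\<mu>\<in>{\<mu>\<in>?M I. (2 :: complex) ^ lookup \<mu> i = 2 ^ lookup \<nu> i}.
        c \<mu> * monomial_value \<mu> a) = 0"
      by (rule isolate_eigenspace[where X = UNIV and \<sigma> = \<sigma>]) (use \<open>finite M\<close> insert.IH act in auto)
    moreover have "(2 :: complex) ^ k = 2 ^ l \<longleftrightarrow> k = l" for k l :: nat
      by (metis numeral_power_eq_of_nat_cancel_iff of_nat_eq_iff of_nat_numeral of_nat_power one_less_numeral_iff power_inject_exp semiring_norm(76))
    ultimately show ?case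
      by (simp add: conj_ac conj_assoc cong: conj_cong)
  qed
  have "\<mu> = \<nu>" if "\<mu> \<in> ?M ?I" for \<mu>
  proof (rule poly_mapping_eqI)
    fix i
    show "lookup \<mu> i = lookup \<nu> i"
      using that \<open>\<nu> \<in> M\<close> by (cases "i \<in> ?I") (auto simp: in_keys_iff)
  qed
  then have "?M ?I = {\<nu>}" using \<open>\<nu> \<in> M\<close> by auto
  then have "c \<nu> * monomial_value \<nu> (\<lambda>_. 1) = 0"
    using isolate[OF \<open>finite ?I\<close>, of "\<lambda>_. 1"] by simp
  then show ?thesis by (simp add: monomial_value_def)
qed

section \<open>Ideals\<close>

lemma cpoly_ideal_0: "0 \<in> cpoly_ideal V G"
  unfolding cpoly_ideal_def by (auto intro!: exI[of _ "{}"])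

lemma cpoly_ideal_add:
  assumes "F \<in> cpoly_ideal V G" "F' \<in> cpoly_ideal V G"
  shows "F + F' \<in> cpoly_ideal V G"
proof -
  obtain S h where S: "finite S" "S \<subseteq> G" "\<forall>g\<in>S. h g \<in> cpoly_ring V" "F = (\<Sum>g\<in>S. h g * g)"
    using assms(1) unfolding cpoly_ideal_def by blast
  obtain S' h' where S': "finite S'" "S' \<subseteq> G" "\<forall>g\<in>S'. h' g \<in> cpoly_ring V" "F' = (\<Sum>g\<in>S'. h' g * g)"
    using assms(2) unfolding cpoly_ideal_def by blast
  define k where "k g = (if g \<in> S then h g else 0) + (if g \<in> S' then h' g else 0)" for g
  have "(\<Sum>g\<in>S \<union> S'. k g * g) = (\<Sum>g\<in>S \<union> S'. (if g \<in> S then h g * g else 0)) +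
      (\<Sum>g\<in>S \<union> S'. (if g \<in> S' then h' g * g else 0))"
    unfolding sum.distrib[symmetric] by (rule sum.cong) (auto simp: k_def distrib_right)
  also have "(\<Sum>g\<in>S \<union> S'. (if g \<in> S then h g * g else 0)) = F"
    unfolding S(4) using S S' by (intro sum.mono_neutral_cong_right) auto
  also have "(\<Sum>g\<in>S \<union> S'. (if g \<in> S' then h' g * g else 0)) = F'"
    unfolding S'(4) using S S' by (intro sum.mono_neutral_cong_right) auto
  finally have "F + F' = (\<Sum>g\<in>S \<union> S'. k g * g)" by simp
  moreover have "\<forall>g\<in>S \<union> S'. k g \<in> cpoly_ring V"
    using S S' by (auto simp: k_def intro!: cpoly_ring_add)
  ultimately show ?thesis
    unfolding cpoly_ideal_def using S S' by (auto intro!: exI[of _ "S \<union> S'"] exI[of _ k])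
qed

lemma cpoly_ideal_mult:
  assumes "F \<in> cpoly_ideal V G" "H \<in> cpoly_ring V"
  shows "H * F \<in> cpoly_ideal V G"
proof -
  obtain S h where S: "finite S" "S \<subseteq> G" "\<forall>g\<in>S. h g \<in> cpoly_ring V" "F = (\<Sum>g\<in>S. h g * g)"
    using assms(1) unfolding cpoly_ideal_def by blast
  have "H * F = (\<Sum>g\<in>S. (H * h g) * g)"
    by (simp add: S(4) sum_distrib_left mult.assoc)
  then show ?thesis
    unfolding cpoly_ideal_def using S assms(2)
    by (auto intro!: exI[of _ S] exI[of _ "\<lambda>g. H * h g"] cpoly_ring_mult)
qed

lemma cpoly_ideal_gen: "g \<in> G \<Longrightarrow> g \<in> cpoly_ideal V G"
  unfolding cpoly_ideal_def by (auto intro!: exI[of _ "{g}"] exI[of _ "\<lambda>_. 1"])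

lemma cpoly_ideal_uminus: "F \<in> cpoly_ideal V G \<Longrightarrow> - F \<in> cpoly_ideal V G"
  using cpoly_ideal_mult[of F V G "- 1"] by (simp add: cpoly_ring_uminus)

lemma cpoly_ideal_sum:
  "(\<And>x. x \<in> A \<Longrightarrow> F x \<in> cpoly_ideal V G) \<Longrightarrow> sum F A \<in> cpoly_ideal V G"
  by (induction A rule: infinite_finite_induct) (auto intro: cpoly_ideal_add cpoly_ideal_0)

lemma cpoly_ideal_subset:
  assumes "G \<subseteq> cpoly_ideal V G'"
  shows "cpoly_ideal V G \<subseteq> cpoly_ideal V G'"
proof
  fix F assume "F \<in> cpoly_ideal V G"
  then obtain S h where "S \<subseteq> G" "\<forall>g\<in>S. h g \<in> cpoly_ring V" "F = (\<Sum>g\<in>S. h g * g)"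
    unfolding cpoly_ideal_def by blast
  then show "F \<in> cpoly_ideal V G'"
    using assms by (auto intro!: cpoly_ideal_sum cpoly_ideal_mult)
qed

lemma cpoly_ideal_eval_0:
  assumes "F \<in> cpoly_ideal V G" "\<And>g. g \<in> G \<Longrightarrow> cpoly_eval g a = 0"
  shows "cpoly_eval F a = 0"
proof -
  obtain S h where "S \<subseteq> G" "F = (\<Sum>g\<in>S. h g * g)"
    using assms(1) unfolding cpoly_ideal_def by blast
  then show ?thesis using assms(2) by (auto intro!: sum.neutral)
qed

section \<open>Systems of split quadrics\<close>

lemma common_nonroot:
  fixes p q :: "complex poly"
  assumes "poly p s \<noteq> 0" "poly q t \<noteq> 0"
  shows "\<exists>x. poly p x \<noteq> 0 \<and> poly q x \<noteq> 0"
proof -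
  have "p * q \<noteq> 0" using assms by auto
  then have "finite {x. poly (p * q) x = 0}" by (rule poly_roots_finite)
  then obtain x where "poly (p * q) x \<noteq> 0"
    using infinite_UNIV_char_0[where 'a = complex] by (metis (mono_tags, lifting) UNIV_eq_I mem_Collect_eq)
  then show ?thesis by auto
qed

lemma affine_line_polynomial: "\<exists>p. \<forall>t. (a :: complex) + t * b = poly p t"
  by (rule exI[of _ "[:a, b:]"]) simp

text \<open>Affine space is irreducible: on the line through \<open>a\<close> and \<open>b\<close>
  both polynomials restrict to nonzero univariate ones.\<close>

lemma common_nonzero_on_line:
  assumes "cpoly_eval F a \<noteq> 0" "cpoly_eval G b \<noteq> 0"
  shows "\<exists>c. cpoly_eval F c \<noteq> 0 \<and> cpoly_eval G c \<noteq> 0"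
proof -
  define \<gamma> where "\<gamma> t i = a i + t * (b i - a i)" for t i
  have \<gamma>: "\<exists>p. \<forall>t. \<gamma> t i = poly p t" for i
    unfolding \<gamma>_def by (rule affine_line_polynomial)
  obtain p where p: "\<And>t. cpoly_eval F (\<gamma> t) = poly p t"
    using cpoly_eval_curve_polynomial[of \<gamma> F] \<gamma> by blast
  obtain q where q: "\<And>t. cpoly_eval G (\<gamma> t) = poly q t"
    using cpoly_eval_curve_polynomial[of \<gamma> G] \<gamma> by blast
  have "\<gamma> 0 = a" "\<gamma> 1 = b" by (auto simp: \<gamma>_def)
  then show ?thesis
    using common_nonroot[of p 0 q 1] assms p q by metis
qed

text \<open>A homogeneous linear system with more unknowns than equations. The induction eliminates
  the equation \<open>\<mu>\<close> with a pivot \<open>b0\<close> at which its coefficient is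
  nonzero.\<close>

lemma exists_linear_dependence:
  fixes a :: "'b \<Rightarrow> 'm \<Rightarrow> complex"
  assumes "finite M" "finite B" "card M < card B"
  shows "\<exists>c. (\<exists>b\<in>B. c b \<noteq> 0) \<and> (\<forall>\<mu>\<in>M. (\<Sum>b\<in>B. c b * a b \<mu>) = 0)"
  using assms
proof (induction M arbitrary: B a rule: finite_induct)
  case empty
  then have "B \<noteq> {}" by auto
  then show ?case by (auto intro!: exI[of _ "\<lambda>_. 1"])
next
  case (insert \<mu> M)
  show ?case
  proof (cases "\<forall>b\<in>B. a b \<mu> = 0")
    case True
    have "card M < card B" using insert by simp
    then show ?thesis using insert.IH[of B a] insert.prems True by auto
  next
    case False
    then obtain b0 where b0: "b0 \<in> B" "a b0 \<mu> \<noteq> 0" by auto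
    have "card M < card (B - {b0})" using insert b0 by simp
    then obtain c where c: "\<exists>b\<in>B - {b0}. c b \<noteq> 0"
        "\<And>\<nu>. \<nu> \<in> M \<Longrightarrow> (\<Sum>b\<in>B - {b0}. c b * (a b \<nu> - a b \<mu> / a b0 \<mu> * a b0 \<nu>)) = 0"
      using insert.IH[of "B - {b0}" "\<lambda>b \<nu>. a b \<nu> - a b \<mu> / a b0 \<mu> * a b0 \<nu>"] insert.prems by auto
    \<comment> \<open>The coefficient \<open>- s\<close> of the pivot is the one that solves the
      eliminated equation \<open>\<mu>\<close>.\<close>
    define s where "s = (\<Sum>b\<in>B - {b0}. c b * a b \<mu>) / a b0 \<mu>"
    have eq: "(\<Sum>b\<in>B. (c(b0 := - s)) b * a b \<nu>) = (\<Sum>b\<in>B - {b0}. c b * a b \<nu>) - s * a b0 \<nu>" for \<nu>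
      using b0 \<open>finite B\<close> by (simp add: sum.remove[of B b0])
    have "(\<Sum>b\<in>B. (c(b0 := - s)) b * a b \<nu>) = 0" if "\<nu> \<in> insert \<mu> M" for \<nu>
    proof (cases "\<nu> = \<mu>")
      case True
      then show ?thesis using b0 unfolding eq by (simp add: s_def)
    next
      case False
      then have "(\<Sum>b\<in>B - {b0}. c b * a b \<nu>) - s * a b0 \<nu> = 0"
        using c(2)[of \<nu>] that
        by (simp add: s_def right_diff_distrib sum_subtractf sum_divide_distrib sum_distrib_right sum_distrib_left mult_ac)
      then show ?thesis unfolding eq .
    qed
    then show ?thesis using c(1) by (intro exI[of _ "c(b0 := - s)"]) auto
  qed
qed

text \<open>\<open>J\<close> indexes the quadrics, \<open>R j\<close> holds the variables of the
  remainder \<open>r j\<close>, and \<open>L\<close> the variables that are equations themselves.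
  The disjointness conditions let each quadric be treated independently of the others.\<close>

locale split_quadrics =
  fixes V L :: "'i set" and J :: "'j set" and y z :: "'j \<Rightarrow> 'i"
    and R :: "'j \<Rightarrow> 'i set" and r :: "'j \<Rightarrow> 'i cpoly"
  assumes finite_V: "finite V" and L_subset: "L \<subseteq> V" and finite_J: "finite J"
    and y_in: "y ` J \<subseteq> V - L" and z_in: "z ` J \<subseteq> V - L"
    and inj_y: "inj_on y J" and inj_z: "inj_on z J" and y_z_disjoint: "y ` J \<inter> z ` J = {}"
    and R_in: "j \<in> J \<Longrightarrow> R j \<subseteq> V - L - y ` J - z ` J"
    and R_disjoint: "j \<in> J \<Longrightarrow> k \<in> J \<Longrightarrow> j \<noteq> k \<Longrightarrow> R j \<inter> R k = {}"
    and r_ring: "j \<in> J \<Longrightarrow> r j \<in> cpoly_ring (R j)"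
    and r_homogeneous: "j \<in> J \<Longrightarrow> homogeneous 2 (r j)"
    and r_nonzero: "j \<in> J \<Longrightarrow> \<exists>a. cpoly_eval (r j) a \<noteq> 0"
begin

definition q :: "'j \<Rightarrow> 'i cpoly" where
  "q j = cpoly_var (y j) * cpoly_var (z j) + r j"

definition gens :: "'i cpoly set" where
  "gens = q ` J \<union> cpoly_var ` L"

definition cone :: "('i \<Rightarrow> complex) set" where
  "cone = {a. \<forall>g\<in>gens. cpoly_eval g a = 0}"

text \<open>The standard monomials for the initial ideal generated by the pairwise coprime products
  of \<open>y j\<close> and \<open>z j\<close> and by the variables in \<open>L\<close>.\<close>

definition normal :: "('i \<Rightarrow>\<^sub>0 nat) \<Rightarrow> bool" where
  "normal \<mu> \<longleftrightarrow> keys \<mu> \<subseteq> V - L \<and>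
     (\<forall>j\<in>J. lookup \<mu> (y j) = 0 \<or> lookup \<mu> (z j) = 0)"

lemma cone_iff: "a \<in> cone \<longleftrightarrow>
    (\<forall>j\<in>J. a (y j) * a (z j) + cpoly_eval (r j) a = 0) \<and> (\<forall>c\<in>L. a c = 0)"
  by (simp add: cone_def gens_def q_def ball_Un)

lemma gens_ring: "gens \<subseteq> cpoly_ring V"
proof -
  have "q j \<in> cpoly_ring V" if "j \<in> J" for j
    unfolding q_def using that y_in z_in R_in[OF that] r_ring[OF that]
    by (intro cpoly_ring_add cpoly_ring_mult cpoly_ring_var) (auto intro: cpoly_ring_mono)
  then show ?thesis using L_subset by (auto simp: gens_def)
qed

lemma gens_homogeneous:
  assumes "g \<in> gens"
  shows "\<exists>k. homogeneous k g"
proof -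
  have "homogeneous 2 (q j)" if "j \<in> J" for j
    unfolding q_def
    using homogeneous_mult[OF homogeneous_var[of "y j"] homogeneous_var[of "z j"]] r_homogeneous[OF that]
    by (simp add: numeral_2_eq_2 homogeneous_add)
  then show ?thesis
    using assms by (auto simp: gens_def intro: homogeneous_var)
qed

lemma finite_gens: "finite gens"
  using finite_J finite_V L_subset by (auto simp: gens_def intro: finite_subset)

lemma r_eval_cong:
  "j \<in> J \<Longrightarrow> (\<And>i. i \<in> R j \<Longrightarrow> a i = b i) \<Longrightarrow> cpoly_eval (r j) a = cpoly_eval (r j) b"
  using r_ring by (rule cpoly_eval_cong)

subsection \<open>Normal forms\<close>

text \<open>The normal form has to be homogeneous of the prescribed degree \<open>D\<close>, because
  normal monomials are counted degree by degree. Nothing is asked of \<open>F\<close> itself;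
  elements of the ideal have normal form 0 for every \<open>D\<close>.\<close>

definition reducible :: "nat \<Rightarrow> 'i cpoly set" where
  "reducible D = {F. \<exists>F'. F' \<in> cpoly_ring V \<and> homogeneous D F' \<and>
     (\<forall>\<nu>\<in>keys F'. normal \<nu>) \<and> F - F' \<in> cpoly_ideal V gens}"

lemma reducible_ideal: "F \<in> cpoly_ideal V gens \<Longrightarrow> F \<in> reducible D"
  by (auto simp: reducible_def intro!: exI[of _ 0])

lemma reducible_add:
  assumes "F \<in> reducible D" "G \<in> reducible D"
  shows "F + G \<in> reducible D"
proof -
  obtain F' where F': "F' \<in> cpoly_ring V" "homogeneous D F'"
      "\<forall>\<nu>\<in>keys F'. normal \<nu>" "F - F' \<in> cpoly_ideal V gens"
    using assms(1) unfolding reducible_def by blast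
  obtain G' where G': "G' \<in> cpoly_ring V" "homogeneous D G'"
      "\<forall>\<nu>\<in>keys G'. normal \<nu>" "G - G' \<in> cpoly_ideal V gens"
    using assms(2) unfolding reducible_def by blast
  have "F + G - (F' + G') \<in> cpoly_ideal V gens"
    using cpoly_ideal_add[OF F'(4) G'(4)] by (simp add: algebra_simps)
  then show ?thesis
    unfolding reducible_def using F' G' keys_add[of F' G']
    by (auto intro!: exI[of _ "F' + G'"] cpoly_ring_add homogeneous_add)
qed

lemma reducible_const_mult:
  assumes "F \<in> reducible D"
  shows "cpoly_const s * F \<in> reducible D"
proof -
  obtain F' where F': "F' \<in> cpoly_ring V" "homogeneous D F'"
      "\<forall>\<nu>\<in>keys F'. normal \<nu>" "F - F' \<in> cpoly_ideal V gens"
    using assms(1) unfolding reducible_def by blast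
  have "cpoly_const s * F - cpoly_const s * F' \<in> cpoly_ideal V gens"
    using cpoly_ideal_mult[OF F'(4), of "cpoly_const s"] by (simp add: algebra_simps)
  moreover have "keys (cpoly_const s * F') \<subseteq> keys F'"
    using keys_mult[of "cpoly_const s" F'] by (auto simp: cpoly_const_def split: if_splits)
  ultimately show ?thesis
    unfolding reducible_def using F' homogeneous_mult[OF homogeneous_const F'(2)]
    by (auto intro!: exI[of _ "cpoly_const s * F'"] cpoly_ring_mult)
qed

lemma reducible_sum: "(\<And>x. x \<in> A \<Longrightarrow> F x \<in> reducible D) \<Longrightarrow> sum F A \<in> reducible D"
  by (induction A rule: infinite_finite_induct) (auto intro: reducible_add reducible_ideal cpoly_ideal_0)

text \<open>Each rewriting step \<open>y\<^sub>j z\<^sub>j \<rightarrow> - r\<^sub>j\<close> lowers the total degree in the variables \<open>y\<^sub>j\<close>, \<open>z\<^sub>j\<close>.\<close>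

lemma monomial_reducible:
  assumes "keys \<mu> \<subseteq> V"
  shows "single \<mu> 1 \<in> reducible (monomial_degree \<mu>)"
  using assms
proof (induction "\<Sum>i\<in>y ` J \<union> z ` J. lookup \<mu> i" arbitrary: \<mu> rule: less_induct)
  case less
  define wt where "wt \<mu> = (\<Sum>i\<in>y ` J \<union> z ` J. lookup \<mu> i)" for \<mu> :: "'i \<Rightarrow>\<^sub>0 nat"
  have wt_add: "wt (\<mu> + \<nu>) = wt \<mu> + wt \<nu>" for \<mu> \<nu>
    by (simp add: wt_def lookup_add sum.distrib)
  have split: "\<exists>\<nu>. \<mu> = single i 1 + \<nu>" if "lookup \<mu> i \<noteq> 0" for i and \<mu> :: "'i \<Rightarrow>\<^sub>0 nat"
    by (rule exI[of _ "\<mu> - single i 1"], rule poly_mapping_eqI)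
       (use that in \<open>auto simp: lookup_add lookup_minus lookup_single when_def\<close>)
  consider (normal) "normal \<mu>" | (linear) c where "c \<in> L" "lookup \<mu> c \<noteq> 0"
    | (quadratic) j where "j \<in> J" "lookup \<mu> (y j) \<noteq> 0" "lookup \<mu> (z j) \<noteq> 0"
    using less.prems by (force simp: normal_def in_keys_iff)
  then show ?case
  proof cases
    case normal
    then show ?thesis
      using less.prems by (auto simp: reducible_def cpoly_ideal_0 intro!: exI[of _ "single \<mu> 1"])
  next
    case linear
    obtain \<nu> where \<nu>: "\<mu> = single c 1 + \<nu>"
      using split linear by blast
    have "single \<mu> 1 = single \<nu> 1 * cpoly_var c"
      by (simp add: \<nu> cpoly_var_def mult_single add.commute)
    moreover have "single \<nu> 1 \<in> cpoly_ring V"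
      using less.prems by (auto simp: \<nu> keys_add_nat)
    ultimately show ?thesis
      using linear by (simp add: gens_def reducible_ideal cpoly_ideal_mult cpoly_ideal_gen)
  next
    case quadratic
    obtain \<nu>' where \<nu>': "\<mu> = single (y j) 1 + \<nu>'"
      using split quadratic by blast
    have "y j \<noteq> z j" using quadratic y_z_disjoint by auto
    then have "lookup \<nu>' (z j) \<noteq> 0"
      using quadratic by (simp add: \<nu>' lookup_add lookup_single)
    then obtain \<nu> where "\<nu>' = single (z j) 1 + \<nu>"
      using split by blast
    then have \<nu>: "\<mu> = single (y j) 1 + single (z j) 1 + \<nu>"
      by (simp add: \<nu>' add.assoc)
    have \<nu>V: "keys \<nu> \<subseteq> V"
      using less.prems by (auto simp: \<nu> keys_add_nat)
    have "(single \<mu> 1 :: 'i cpoly) = single \<nu> 1 * (cpoly_var (y j) * cpoly_var (z j))"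
      by (simp add: \<nu> cpoly_var_def mult_single add_ac)
    also have "\<dots> = single \<nu> 1 * q j + cpoly_const (- 1) * (single \<nu> 1 * r j)"
      by (simp add: q_def algebra_simps cpoly_const_def single_uminus)
    finally have eq: "(single \<mu> 1 :: 'i cpoly) = \<dots>" .
    have "single \<nu> 1 * r j =
        (\<Sum>\<rho>\<in>keys (r j). cpoly_const (lookup (r j) \<rho>) * single (\<nu> + \<rho>) 1)"
      by (subst cpoly_expand[of "r j"]) (simp add: sum_distrib_left cpoly_const_def mult_single)
    also have "\<dots> \<in> reducible (monomial_degree \<mu>)"
    proof (intro reducible_sum reducible_const_mult)
      fix \<rho> assume \<rho>: "\<rho> \<in> keys (r j)"
      then have deg: "monomial_degree \<rho> = 2"
        using r_homogeneous[OF quadratic(1)] by (simp add: homogeneous_iff)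
      have "keys \<rho> \<subseteq> R j"
        using \<rho> r_ring[OF quadratic(1)] by (simp add: cpoly_ring_def)
      then have keys: "keys \<rho> \<subseteq> V - L - y ` J - z ` J"
        using R_in[OF quadratic(1)] by blast
      then have "wt \<rho> = 0"
        unfolding wt_def
        by (intro sum.neutral ballI) (auto simp: in_keys_iff subset_iff)
      moreover have "wt (single (y j) 1) \<noteq> 0"
        using quadratic finite_J by (force simp: wt_def lookup_single when_def)
      ultimately have "wt (\<nu> + \<rho>) < wt \<mu>"
        by (simp add: \<nu> wt_add)
      moreover have "keys (\<nu> + \<rho>) \<subseteq> V"
        using \<nu>V keys by (auto simp: keys_add_nat)
      ultimately have "single (\<nu> + \<rho>) 1 \<in> reducible (monomial_degree (\<nu> + \<rho>))"
        using less.hyps[of "\<nu> + \<rho>"] by (simp add: wt_def)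
      then show "single (\<nu> + \<rho>) 1 \<in> reducible (monomial_degree \<mu>)"
        by (simp add: \<nu> monomial_degree_add deg)
    qed
    finally have "single \<nu> 1 * r j \<in> reducible (monomial_degree \<mu>)" .
    moreover have "single \<nu> 1 * q j \<in> cpoly_ideal V gens"
      using quadratic \<nu>V by (intro cpoly_ideal_mult cpoly_ideal_gen) (auto simp: gens_def)
    ultimately show ?thesis
      unfolding eq by (blast intro: reducible_add reducible_const_mult reducible_ideal)
  qed
qed

lemma homogeneous_reducible:
  assumes "F \<in> cpoly_ring V" "homogeneous D F"
  shows "F \<in> reducible D"
proof -
  have "F = (\<Sum>\<mu>\<in>keys F. cpoly_const (lookup F \<mu>) * single \<mu> 1)"
    by (subst cpoly_expand) (simp add: cpoly_const_def mult_single)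
  also have "\<dots> \<in> reducible D"
    by (intro reducible_sum reducible_const_mult)
       (use assms monomial_reducible in \<open>auto simp: cpoly_ring_def homogeneous_iff\<close>)
  finally show ?thesis .
qed

subsection \<open>Polynomials vanishing on the cone\<close>

text \<open>The torus eigenvalue \<open>\<theta> j\<close> only sees the difference of the exponents
  of \<open>y j\<close> and \<open>z j\<close>. In a normal monomial one of the two exponents is 0,
  so the difference determines both.\<close>

lemma normal_isolate:
  assumes normal: "\<And>\<mu>. \<mu> \<in> keys F \<Longrightarrow> normal \<mu>"
    and vanish: "\<And>a. a \<in> cone \<Longrightarrow> cpoly_eval F a = 0"
    and "\<nu> \<in> keys F" and "a \<in> cone"
  shows "(\<Sum>\<mu>\<in>{\<mu>\<in>keys F. \<forall>j\<in>J. lookup \<mu> (y j) = lookup \<nu> (y j) \<and>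
      lookup \<mu> (z j) = lookup \<nu> (z j)}.
    lookup F \<mu> * monomial_value \<mu> a) = 0"
proof -
  define \<theta> :: "'j \<Rightarrow> ('i \<Rightarrow>\<^sub>0 nat) \<Rightarrow> complex" where
    "\<theta> j \<mu> = 2 ^ lookup \<mu> (y j) / 2 ^ lookup \<mu> (z j)" for j \<mu>
  have "(\<Sum>\<mu>\<in>{\<mu>\<in>keys F. \<forall>j\<in>K. \<theta> j \<mu> = \<theta> j \<nu>}.
    lookup F \<mu> * monomial_value \<mu> a) = 0" if "finite K" "K \<subseteq> J" "a \<in> cone" for K a
    using that
  proof (induction K arbitrary: a rule: finite_induct)
    case empty
    then show ?case
      using vanish by (simp add: cpoly_eval_superset[OF finite_keys order_refl])
  next
    case (insert j K)
    have j: "j \<in> J" using insert by auto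
    then have yz: "y j \<noteq> z j" using y_z_disjoint by auto
    define \<sigma> :: "('i \<Rightarrow> complex) \<Rightarrow> 'i \<Rightarrow> complex" where
      "\<sigma> a = a(y j := 2 * a (y j), z j := a (z j) / 2)" for a
    have act: "monomial_value \<mu> (\<sigma> a) = \<theta> j \<mu> * monomial_value \<mu> a" for \<mu> a
    proof -
      let ?I = "keys \<mu> \<union> {y j, z j}"
      have "monomial_value \<mu> (\<sigma> a) = (\<Prod>i\<in>?I. \<sigma> a i ^ lookup \<mu> i)"
        by (rule monomial_value_superset) auto
      also have "\<dots> = (\<Prod>i\<in>?I. (if i = y j then 2 ^ lookup \<mu> (y j) else 1) *
          (if i = z j then inverse (2 ^ lookup \<mu> (z j)) else 1) * a i ^ lookup \<mu> i)"
      proof (rule prod.cong[OF refl])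
        fix i
        have "\<sigma> a (y j) ^ k = 2 ^ k * a (y j) ^ k" for k
          using yz by (simp add: \<sigma>_def power_mult_distrib)
        moreover have "\<sigma> a (z j) ^ k = inverse (2 ^ k) * a (z j) ^ k" for k
          by (simp only: \<sigma>_def power_divide divide_inverse fun_upd_same power_mult_distrib power_inverse mult.commute)
        moreover have "i \<noteq> y j \<Longrightarrow> i \<noteq> z j \<Longrightarrow> \<sigma> a i = a i"
          by (simp add: \<sigma>_def)
        ultimately show "\<sigma> a i ^ lookup \<mu> i =
            (if i = y j then 2 ^ lookup \<mu> (y j) else 1) *
            (if i = z j then inverse (2 ^ lookup \<mu> (z j)) else 1) * a i ^ lookup \<mu> i"
          using yz by (cases "i = y j"; cases "i = z j") simp_all
      qed
      also have "\<dots> = \<theta> j \<mu> * (\<Prod>i\<in>?I. a i ^ lookup \<mu> i)"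
        by (simp only: prod.distrib) (simp add: \<theta>_def divide_inverse)
      also have "(\<Prod>i\<in>?I. a i ^ lookup \<mu> i) = monomial_value \<mu> a"
        by (rule monomial_value_superset[symmetric]) auto
      finally show ?thesis .
    qed
    have stable: "\<sigma> a \<in> cone" if "a \<in> cone" for a
    proof -
      have "\<sigma> a (y k) * \<sigma> a (z k) = a (y k) * a (z k)" if "k \<in> J" for k
      proof (cases "k = j")
        case True
        then show ?thesis using yz by (simp add: \<sigma>_def)
      next
        case False
        then have "y k \<noteq> y j" "z k \<noteq> z j"
          using that j inj_y inj_z by (meson inj_onD)+
        moreover have "y k \<noteq> z j" "z k \<noteq> y j"
          using that j y_z_disjoint by blast+
        ultimately show ?thesis by (simp add: \<sigma>_def)
      qed
      moreover have "cpoly_eval (r k) (\<sigma> a) = cpoly_eval (r k) a" if "k \<in> J" for k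
        using R_in[OF that] j by (intro r_eval_cong[OF that]) (auto simp: \<sigma>_def)
      moreover have "\<sigma> a c = a c" if "c \<in> L" for c
        using that j y_in z_in by (auto simp: \<sigma>_def)
      ultimately show ?thesis using \<open>a \<in> cone\<close> by (simp add: cone_iff)
    qed
    have "(\<Sum>\<mu>\<in>{\<mu>\<in>{\<mu>\<in>keys F. \<forall>j\<in>K. \<theta> j \<mu> = \<theta> j \<nu>}. \<theta> j \<mu> = \<theta> j \<nu>}.
        lookup F \<mu> * monomial_value \<mu> a) = 0"
      by (rule isolate_eigenspace[where X = cone and \<sigma> = \<sigma>])
         (use insert act stable in auto)
    then show ?case by (simp add: conj_ac conj_assoc cong: conj_cong)
  qed
  from this[OF finite_J order_refl \<open>a \<in> cone\<close>]
  have "(\<Sum>\<mu>\<in>{\<mu>\<in>keys F. \<forall>j\<in>J. \<theta> j \<mu> = \<theta> j \<nu>}.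
    lookup F \<mu> * monomial_value \<mu> a) = 0" .
  moreover have "\<theta> j \<mu> = \<theta> j \<nu> \<longleftrightarrow> lookup \<mu> (y j) = lookup \<nu> (y j) \<and>
      lookup \<mu> (z j) = lookup \<nu> (z j)"
    if "\<mu> \<in> keys F" "j \<in> J" for \<mu> j
  proof
    assume eq: "\<theta> j \<mu> = \<theta> j \<nu>"
    have pow: "(2 :: complex) ^ k = 2 ^ l \<longleftrightarrow> k = l" for k l :: nat
      by (metis numeral_power_eq_of_nat_cancel_iff of_nat_eq_iff of_nat_numeral of_nat_power
          one_less_numeral_iff power_inject_exp semiring_norm(76))
    have "(2 :: complex) ^ (lookup \<mu> (y j) + lookup \<nu> (z j)) =
        2 ^ (lookup \<nu> (y j) + lookup \<mu> (z j))"
      using eq by (simp add: \<theta>_def frac_eq_eq power_add)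
    then have "lookup \<mu> (y j) + lookup \<nu> (z j) =
        lookup \<nu> (y j) + lookup \<mu> (z j)"
      by (simp only: pow)
    moreover have "lookup \<mu> (y j) = 0 \<or> lookup \<mu> (z j) = 0"
        "lookup \<nu> (y j) = 0 \<or> lookup \<nu> (z j) = 0"
      using normal[OF that(1)] normal[OF assms(3)] that(2) by (simp_all add: normal_def)
    ultimately show "lookup \<mu> (y j) = lookup \<nu> (y j) \<and>
      lookup \<mu> (z j) = lookup \<nu> (z j)"
      by auto
  qed (simp add: \<theta>_def)
  ultimately show ?thesis
    by (simp cong: conj_cong)
qed

text \<open>After isolation, all monomials of \<open>G\<close> have the same exponents at every
  \<open>y j\<close> and \<open>z j\<close>, so \<open>G\<close> is a fixed monomial in these times
  a polynomial in the remaining variables \<open>W\<close>. On the cone the values at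
  \<open>W\<close> can be prescribed, and the fixed monomial is nonzero as long as no
  \<open>r j\<close> vanishes.\<close>

lemma normal_vanishing_zero:
  assumes normal: "\<And>\<mu>. \<mu> \<in> keys F \<Longrightarrow> normal \<mu>"
    and vanish: "\<And>a. a \<in> cone \<Longrightarrow> cpoly_eval F a = 0"
  shows "F = 0"
proof (rule ccontr)
  assume "F \<noteq> 0"
  then obtain \<nu> where \<nu>: "\<nu> \<in> keys F"
    by (metis ex_in_conv keys_eq_empty)
  define M where "M = {\<mu>\<in>keys F. \<forall>j\<in>J. lookup \<mu> (y j) = lookup \<nu> (y j) \<and>
      lookup \<mu> (z j) = lookup \<nu> (z j)}"
  define G where "G = (\<Sum>\<mu>\<in>M. single \<mu> (lookup F \<mu>))"
  have G: "cpoly_eval G a = (\<Sum>\<mu>\<in>M. lookup F \<mu> * monomial_value \<mu> a)" for a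
    by (simp add: G_def)
  have G_cone: "cpoly_eval G a = 0" if "a \<in> cone" for a
    unfolding G M_def using normal_isolate[OF assms \<nu> that] .
  define W where "W = V - L - y ` J - z ` J"
  have decomp: "V - L = W \<union> y ` J \<union> z ` J" and disj: "W \<inter> y ` J = {}" "(W \<union> y ` J) \<inter> z ` J = {}"
    using y_in z_in y_z_disjoint by (auto simp: W_def)
  have factor: "monomial_value \<mu> a = (\<Prod>i\<in>W. a i ^ lookup \<mu> i) *
      (\<Prod>j\<in>J. a (y j) ^ lookup \<nu> (y j)) * (\<Prod>j\<in>J. a (z j) ^ lookup \<nu> (z j))"
    if "\<mu> \<in> M" for \<mu> a
  proof -
    have "monomial_value \<mu> a = (\<Prod>i\<in>V - L. a i ^ lookup \<mu> i)"
      by (rule monomial_value_superset) (use that normal finite_V in \<open>auto simp: M_def normal_def\<close>)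
    also have "\<dots> = (\<Prod>i\<in>W. a i ^ lookup \<mu> i) *
      (\<Prod>j\<in>J. a (y j) ^ lookup \<mu> (y j)) * (\<Prod>j\<in>J. a (z j) ^ lookup \<mu> (z j))"
      unfolding decomp using finite_V finite_J inj_y inj_z disj
      by (simp add: prod.union_disjoint prod.reindex W_def)
    also have "(\<Prod>j\<in>J. a (y j) ^ lookup \<mu> (y j)) = (\<Prod>j\<in>J. a (y j) ^ lookup \<nu> (y j))"
      by (rule prod.cong) (use that in \<open>auto simp: M_def\<close>)
    also have "(\<Prod>j\<in>J. a (z j) ^ lookup \<mu> (z j)) = (\<Prod>j\<in>J. a (z j) ^ lookup \<nu> (z j))"
      by (rule prod.cong) (use that in \<open>auto simp: M_def\<close>)
    finally show ?thesis .
  qed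
  have generic: "cpoly_eval G u = 0" if u: "cpoly_eval (\<Prod>j\<in>J. r j) u \<noteq> 0" for u
  proof -
    \<comment> \<open>Setting every \<open>y j\<close> to 1 forces \<open>z j\<close> to be
      \<open>- r j\<close>, while the variables in \<open>W\<close> stay arbitrary; so there is a
      point of the cone over every \<open>u\<close>.\<close>
    define v where "v i = (if i \<in> W then u i else if i \<in> y ` J then 1
      else if i \<in> z ` J then - cpoly_eval (r (the_inv_into J z i)) u else 0)" for i
    have vy: "v (y j) = 1" and vz: "v (z j) = - cpoly_eval (r j) u" if "j \<in> J" for j
      using that disj the_inv_into_f_f[OF inj_z that] y_z_disjoint by (auto simp: v_def)
    have vW: "v i = u i" if "i \<in> W" for i
      using that by (simp add: v_def)
    have "cpoly_eval (r j) v = cpoly_eval (r j) u" if "j \<in> J" for j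
      using R_in[OF that] by (intro r_eval_cong[OF that]) (auto simp: v_def W_def)
    moreover have "v c = 0" if "c \<in> L" for c
      using that y_in z_in by (auto simp: v_def W_def)
    ultimately have "v \<in> cone" by (simp add: cone_iff vy vz)
    then have "cpoly_eval G v = 0" by (rule G_cone)
    moreover have "cpoly_eval G v = (\<Sum>\<mu>\<in>M. lookup F \<mu> * (\<Prod>i\<in>W. u i ^ lookup \<mu> i)) *
        (\<Prod>j\<in>J. (- cpoly_eval (r j) u) ^ lookup \<nu> (z j))"
      unfolding G sum_distrib_right
      by (rule sum.cong) (simp_all add: factor vy vz vW)
    moreover have "(\<Prod>j\<in>J. (- cpoly_eval (r j) u) ^ lookup \<nu> (z j)) \<noteq> 0"
      using u finite_J by (simp add: prod_zero_iff)
    ultimately have "(\<Sum>\<mu>\<in>M. lookup F \<mu> * (\<Prod>i\<in>W. u i ^ lookup \<mu> i)) = 0"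
      by simp
    moreover have "cpoly_eval G u = (\<Sum>\<mu>\<in>M. lookup F \<mu> * (\<Prod>i\<in>W. u i ^ lookup \<mu> i)) *
        ((\<Prod>j\<in>J. u (y j) ^ lookup \<nu> (y j)) * (\<Prod>j\<in>J. u (z j) ^ lookup \<nu> (z j)))"
      unfolding G sum_distrib_right by (rule sum.cong) (simp_all add: factor)
    ultimately show ?thesis by simp
  qed
  \<comment> \<open>The sets \<open>R j\<close> are disjoint, so that points at which the individual
    \<open>r j\<close> are nonzero can be pasted together.\<close>
  obtain u where u: "cpoly_eval (\<Prod>j\<in>J. r j) u \<noteq> 0"
  proof -
    obtain a where a: "\<And>j. j \<in> J \<Longrightarrow> cpoly_eval (r j) (a j) \<noteq> 0"
      using r_nonzero by metis
    define u where "u i = a (THE j. j \<in> J \<and> i \<in> R j) i" for i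
    have "u i = a j i" if "j \<in> J" "i \<in> R j" for i j
    proof -
      have "(THE j. j \<in> J \<and> i \<in> R j) = j"
        using that R_disjoint by (intro the_equality) auto
      then show ?thesis by (simp add: u_def)
    qed
    then have "cpoly_eval (r j) u = cpoly_eval (r j) (a j)" if "j \<in> J" for j
      using that by (intro r_eval_cong) auto
    then show ?thesis
      using a finite_J by (intro that[of u]) (simp add: prod_zero_iff)
  qed
  \<comment> \<open>\<open>G\<close> vanishes wherever the product of the \<open>r j\<close> does
    not, hence everywhere because affine space is irreducible.\<close>
  have "cpoly_eval G a = 0" for a
    using common_nonzero_on_line[of "\<Prod>j\<in>J. r j" u G a] u generic by auto
  then have "lookup F \<nu> = 0"
    using cpoly_coeffs_zero[of M "lookup F" \<nu>] \<nu> G by (simp add: M_def)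
  then show False using \<nu> by (simp add: in_keys_iff)
qed

lemma vanishing_in_ideal:
  assumes "F \<in> cpoly_ring V" "homogeneous D F" and vanish: "\<And>a. a \<in> cone \<Longrightarrow> cpoly_eval F a = 0"
  shows "F \<in> cpoly_ideal V gens"
proof -
  obtain F' where F': "\<forall>\<nu>\<in>keys F'. normal \<nu>" "F - F' \<in> cpoly_ideal V gens"
    using homogeneous_reducible[OF assms(1,2)] by (auto simp: reducible_def)
  have "cpoly_eval F' a = 0" if "a \<in> cone" for a
    using cpoly_ideal_eval_0[OF F'(2), of a] vanish[OF that] that by (simp add: cone_def)
  then have "F' = 0" using normal_vanishing_zero F'(1) by blast
  then show ?thesis using F'(2) by simp
qed

subsection \<open>The number of independent polynomials\<close>

lemma card_normal:
  shows "finite {\<mu>. normal \<mu> \<and> monomial_degree \<mu> = D}"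
    and "V - L \<noteq> {} \<Longrightarrow>
      card {\<mu>. normal \<mu> \<and> monomial_degree \<mu> = D} \<le> 2 ^ card J * (D + 1) ^ (card (V - L - z ` J) - 1)"
proof -
  let ?N = "{\<mu>. normal \<mu> \<and> monomial_degree \<mu> = D}"
  define S where "S = V - L - z ` J"
  have finS: "finite S" using finite_V by (simp add: S_def)
  define \<kappa> where "\<kappa> \<mu> i = lookup \<mu> i +
      (if i \<in> y ` J then lookup \<mu> (z (the_inv_into J y i)) else 0)"
    for \<mu> :: "'i \<Rightarrow>\<^sub>0 nat" and i
  have \<kappa>y: "\<kappa> \<mu> (y j) = lookup \<mu> (y j) + lookup \<mu> (z j)" if "j \<in> J" for \<mu> j
    using that the_inv_into_f_f[OF inj_y that] by (auto simp: \<kappa>_def)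
  have yS: "y ` J \<subseteq> S" using y_in y_z_disjoint by (auto simp: S_def)
  have \<kappa>sum: "sum (\<kappa> \<mu>) S = D" if "\<mu> \<in> ?N" for \<mu>
  proof -
    have "sum (\<kappa> \<mu>) S = sum (lookup \<mu>) S +
        (\<Sum>i\<in>S. if i \<in> y ` J then lookup \<mu> (z (the_inv_into J y i)) else 0)"
      by (simp add: \<kappa>_def sum.distrib)
    also have "(\<Sum>i\<in>S. if i \<in> y ` J then lookup \<mu> (z (the_inv_into J y i)) else 0) =
        (\<Sum>i\<in>y ` J. lookup \<mu> (z (the_inv_into J y i)))"
      using finS yS by (intro sum.mono_neutral_cong_right) auto
    also have "\<dots> = (\<Sum>j\<in>J. lookup \<mu> (z j))"
      using the_inv_into_f_f[OF inj_y] by (subst sum.reindex[OF inj_y]) (auto intro!: sum.cong)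
    also have "\<dots> = sum (lookup \<mu>) (z ` J)"
      by (simp add: sum.reindex[OF inj_z])
    also have "sum (lookup \<mu>) S + sum (lookup \<mu>) (z ` J) =
        sum (lookup \<mu>) (V - L)"
      using z_in finite_V finite_J by (subst sum.union_disjoint[symmetric]) (auto simp: S_def intro!: sum.cong)
    also have "\<dots> = monomial_degree \<mu>"
      by (rule monomial_degree_superset[symmetric]) (use that finite_V in \<open>auto simp: normal_def\<close>)
    finally show ?thesis using that by simp
  qed
  have inj: "\<mu> = \<mu>'" if N: "\<mu> \<in> ?N" "\<mu>' \<in> ?N"
      and zero: "{j\<in>J. lookup \<mu> (y j) = 0} = {j\<in>J. lookup \<mu>' (y j) = 0}"
      and \<kappa>: "\<And>i. i \<in> S \<Longrightarrow> \<kappa> \<mu> i = \<kappa> \<mu>' i" for \<mu> \<mu>'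
  proof (rule poly_mapping_eqI)
    fix i
    consider "i \<notin> V - L" | j where "j \<in> J" "i = y j" | j where "j \<in> J" "i = z j" | "i \<in> S" "i \<notin> y ` J"
      by (auto simp: S_def)
    then show "lookup \<mu> i = lookup \<mu>' i"
    proof cases
      case 1
      then have "i \<notin> keys \<mu>" "i \<notin> keys \<mu>'"
        using N by (auto simp: normal_def)
      then show ?thesis by (simp add: in_keys_iff)
    next
      case 2
      have "lookup \<mu> (y j) = 0 \<longleftrightarrow> lookup \<mu>' (y j) = 0"
        using zero \<open>j \<in> J\<close> by blast
      moreover have "lookup \<mu> (y j) + lookup \<mu> (z j) =
          lookup \<mu>' (y j) + lookup \<mu>' (z j)"
        using \<kappa>[of "y j"] yS \<kappa>y \<open>j \<in> J\<close> by auto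
      moreover have "lookup \<mu> (y j) = 0 \<or> lookup \<mu> (z j) = 0"
          "lookup \<mu>' (y j) = 0 \<or> lookup \<mu>' (z j) = 0"
        using N \<open>j \<in> J\<close> by (simp_all add: normal_def)
      ultimately show ?thesis using \<open>i = y j\<close> by auto
    next
      case 3
      have "lookup \<mu> (y j) = 0 \<longleftrightarrow> lookup \<mu>' (y j) = 0"
        using zero \<open>j \<in> J\<close> by blast
      moreover have "lookup \<mu> (y j) + lookup \<mu> (z j) =
          lookup \<mu>' (y j) + lookup \<mu>' (z j)"
        using \<kappa>[of "y j"] yS \<kappa>y \<open>j \<in> J\<close> by auto
      moreover have "lookup \<mu> (y j) = 0 \<or> lookup \<mu> (z j) = 0"
          "lookup \<mu>' (y j) = 0 \<or> lookup \<mu>' (z j) = 0"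
        using N \<open>j \<in> J\<close> by (simp_all add: normal_def)
      ultimately show ?thesis using \<open>i = z j\<close> by auto
    next
      case 4
      then show ?thesis using \<kappa>[of i] by (simp add: \<kappa>_def)
    qed
  qed
  define enc where "enc I \<mu> = ({j\<in>J. lookup \<mu> (y j) = 0}, restrict (\<kappa> \<mu>) I)" for I \<mu>
  have enc_in: "enc I ` ?N \<subseteq> Pow J \<times> (I \<rightarrow>\<^sub>E {..D})" if "I \<subseteq> S" for I
  proof -
    have "\<kappa> \<mu> i \<le> D" if "\<mu> \<in> ?N" "i \<in> I" for \<mu> i
      using member_le_sum[of i S "\<kappa> \<mu>"] \<kappa>sum[OF that(1)] finS that \<open>I \<subseteq> S\<close> by auto
    then show ?thesis by (auto simp: enc_def)
  qed
  have fin_enc: "finite (Pow J \<times> (I \<rightarrow>\<^sub>E {..D}))" if "I \<subseteq> S" for I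
    using finite_J finS that by (auto intro!: finite_PiE intro: finite_subset)
  have inj_S: "inj_on (enc S) ?N"
  proof (rule inj_onI)
    fix \<mu> \<mu>' assume N: "\<mu> \<in> ?N" "\<mu>' \<in> ?N" and eq: "enc S \<mu> = enc S \<mu>'"
    show "\<mu> = \<mu>'"
    proof (rule inj[OF N])
      show "{j\<in>J. lookup \<mu> (y j) = 0} = {j\<in>J. lookup \<mu>' (y j) = 0}"
        using eq by (simp add: enc_def)
      have "restrict (\<kappa> \<mu>) S i = restrict (\<kappa> \<mu>') S i" for i
        using eq by (simp add: enc_def)
      then show "\<kappa> \<mu> i = \<kappa> \<mu>' i" if "i \<in> S" for i
        using that by (metis restrict_apply')
    qed
  qed
  show "finite ?N"
    by (rule finite_imageD[OF finite_subset[OF enc_in[OF order_refl] fin_enc[OF order_refl]] inj_S])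
  assume "V - L \<noteq> {}"
  then obtain i0 where i0: "i0 \<in> S"
    using yS z_in by (cases "J = {}") (auto simp: S_def)
  let ?I = "S - {i0}"
  have "inj_on (enc ?I) ?N"
  proof (rule inj_onI)
    fix \<mu> \<mu>' assume N: "\<mu> \<in> ?N" "\<mu>' \<in> ?N" and eq: "enc ?I \<mu> = enc ?I \<mu>'"
    have "restrict (\<kappa> \<mu>) ?I i = restrict (\<kappa> \<mu>') ?I i" for i
      using eq by (simp add: enc_def)
    then have eq': "\<kappa> \<mu> i = \<kappa> \<mu>' i" if "i \<in> ?I" for i
      using that by (metis restrict_apply')
    show "\<mu> = \<mu>'"
    proof (rule inj[OF N])
      show "{j\<in>J. lookup \<mu> (y j) = 0} = {j\<in>J. lookup \<mu>' (y j) = 0}"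
        using eq by (simp add: enc_def)
      have "\<kappa> \<mu> i0 + sum (\<kappa> \<mu>) ?I = \<kappa> \<mu>' i0 + sum (\<kappa> \<mu>') ?I"
        using \<kappa>sum[OF N(1)] \<kappa>sum[OF N(2)] sum.remove[OF finS i0, of "\<kappa> \<mu>"]
          sum.remove[OF finS i0, of "\<kappa> \<mu>'"] by simp
      moreover have "sum (\<kappa> \<mu>) ?I = sum (\<kappa> \<mu>') ?I"
        by (intro sum.cong refl eq')
      ultimately show "\<kappa> \<mu> i = \<kappa> \<mu>' i" if "i \<in> S" for i
        using eq'[of i] that by (cases "i = i0") auto
    qed
  qed
  then have "card ?N \<le> card (Pow J \<times> (?I \<rightarrow>\<^sub>E {..D}))"
    using enc_in[of ?I] fin_enc[of ?I] by (auto intro: card_inj_on_le)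
  also have "\<dots> = 2 ^ card J * (D + 1) ^ (card S - 1)"
    using finS i0 finite_J by (simp add: card_cartesian_product card_Pow card_PiE)
  finally show "card ?N \<le> 2 ^ card J * (D + 1) ^ (card (V - L - z ` J) - 1)"
    by (simp add: S_def)
qed

text \<open>On the cone each \<open>F k\<close> agrees with its normal form, a combination of normal
  monomials of degree \<open>D\<close>. More forms than such monomials would satisfy a linear
  relation on the cone.\<close>

lemma card_independent_le:
  assumes "\<And>k. k < n \<Longrightarrow> F k \<in> cpoly_ring V" "\<And>k. k < n \<Longrightarrow> homogeneous D (F k)" "V - L \<noteq> {}"
    and indep: "\<And>c. (\<And>a. a \<in> cone \<Longrightarrow> (\<Sum>k<n. c k * cpoly_eval (F k) a) = 0) \<Longrightarrow> \<forall>k<n. c k = 0"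
  shows "n \<le> 2 ^ card J * (D + 1) ^ (card (V - L - z ` J) - 1)"
proof (rule ccontr)
  let ?N = "{\<mu>. normal \<mu> \<and> monomial_degree \<mu> = D}"
  assume "\<not> ?thesis"
  then have less: "card ?N < card {..<n}"
    using card_normal(2)[OF assms(3), of D] by simp
  have "\<exists>F'. homogeneous D F' \<and> (\<forall>\<nu>\<in>keys F'. normal \<nu>) \<and> F k - F' \<in> cpoly_ideal V gens"
    if "k < n" for k
    using homogeneous_reducible[of "F k" D] that assms(1,2) unfolding reducible_def by blast
  then obtain nf where nf: "\<And>k. k < n \<Longrightarrow> homogeneous D (nf k)"
      "\<And>k \<nu>. k < n \<Longrightarrow> \<nu> \<in> keys (nf k) \<Longrightarrow> normal \<nu>"
      "\<And>k. k < n \<Longrightarrow> F k - nf k \<in> cpoly_ideal V gens"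
    by metis
  have eval: "cpoly_eval (F k) a = (\<Sum>\<mu>\<in>?N. lookup (nf k) \<mu> * monomial_value \<mu> a)"
    if "k < n" "a \<in> cone" for k a
  proof -
    have "cpoly_eval (F k - nf k) a = 0"
      using cpoly_ideal_eval_0[OF nf(3)[OF that(1)], of a] that(2) unfolding cone_def by blast
    moreover have "keys (nf k) \<subseteq> ?N"
      using nf(1,2)[OF that(1)] by (auto simp: homogeneous_iff)
    ultimately show ?thesis
      using cpoly_eval_superset[OF card_normal(1)] by simp
  qed
  have "\<exists>c. (\<exists>k\<in>{..<n}. c k \<noteq> 0) \<and> (\<forall>\<mu>\<in>?N. (\<Sum>k<n. c k * lookup (nf k) \<mu>) = 0)"
    by (rule exists_linear_dependence[OF card_normal(1) finite_lessThan less])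
  then obtain c where c: "\<exists>k<n. c k \<noteq> 0" "\<And>\<mu>. \<mu> \<in> ?N \<Longrightarrow> (\<Sum>k<n. c k * lookup (nf k) \<mu>) = 0"
    by blast
  have "(\<Sum>k<n. c k * cpoly_eval (F k) a) = 0" if "a \<in> cone" for a
  proof -
    have "(\<Sum>k<n. c k * cpoly_eval (F k) a) =
        (\<Sum>k<n. \<Sum>\<mu>\<in>?N. c k * lookup (nf k) \<mu> * monomial_value \<mu> a)"
      using that by (intro sum.cong refl) (simp add: eval sum_distrib_left mult.assoc)
    also have "\<dots> = (\<Sum>\<mu>\<in>?N. (\<Sum>k<n. c k * lookup (nf k) \<mu>) * monomial_value \<mu> a)"
      by (subst sum.swap) (simp add: sum_distrib_right)
    also have "\<dots> = 0" using c(2) by simp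
    finally show ?thesis .
  qed
  then show False using indep c(1) by blast
qed

subsection \<open>A polynomial parametrization\<close>

text \<open>Solving a quadric for \<open>z j\<close> would mean dividing by \<open>y j\<close>.
  Scaling the variables in \<open>R j\<close> by \<open>u (y j)\<close> and squaring the value at
  \<open>y j\<close> avoids this: as \<open>r j\<close> is homogeneous of degree 2, it acquires the
  same factor \<open>u (y j) ^ 2\<close>. The index chosen by \<open>THE\<close> is unique because
  the \<open>R j\<close> are disjoint.\<close>

definition \<phi> :: "('i \<Rightarrow> complex) \<Rightarrow> 'i \<Rightarrow> complex" where
  "\<phi> u i = (if i \<in> y ` J then u i ^ 2
     else if i \<in> z ` J then - cpoly_eval (r (the_inv_into J z i)) u
     else if \<exists>j\<in>J. i \<in> R j then u (y (THE j. j \<in> J \<and> i \<in> R j)) * u i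
     else if i \<in> V - L then u i else 0)"

lemma \<phi>_y: "j \<in> J \<Longrightarrow> \<phi> u (y j) = u (y j) ^ 2"
  by (simp add: \<phi>_def)

lemma \<phi>_z: "j \<in> J \<Longrightarrow> \<phi> u (z j) = - cpoly_eval (r j) u"
  using y_z_disjoint the_inv_into_f_f[OF inj_z] by (auto simp: \<phi>_def)

lemma \<phi>_R:
  assumes "j \<in> J" "i \<in> R j"
  shows "\<phi> u i = u (y j) * u i"
proof -
  have "(THE j. j \<in> J \<and> i \<in> R j) = j"
    using assms R_disjoint by (intro the_equality) auto
  then show ?thesis using assms R_in[OF assms(1)] by (auto simp: \<phi>_def)
qed

lemma \<phi>_cone: "\<phi> u \<in> cone"
proof -
  have "cpoly_eval (r j) (\<phi> u) = u (y j) ^ 2 * cpoly_eval (r j) u" if "j \<in> J" for j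
  proof -
    have "cpoly_eval (r j) (\<phi> u) = cpoly_eval (r j) (\<lambda>i. u (y j) * u i)"
      using \<phi>_R[OF that] by (rule r_eval_cong[OF that])
    then show ?thesis using cpoly_eval_homogeneous[OF r_homogeneous[OF that]] by simp
  qed
  moreover have "\<phi> u c = 0" if "c \<in> L" for c
    using that y_in z_in R_in by (fastforce simp: \<phi>_def)
  ultimately show ?thesis by (simp add: cone_iff \<phi>_y \<phi>_z)
qed

lemma \<phi>_line_polynomial: "\<exists>p. \<forall>t. \<phi> (\<lambda>i. a i + t * (b i - a i)) i = poly p t"
proof -
  have line: "\<exists>p. \<forall>t. a i + t * (b i - a i) = poly p t" for i
    by (rule affine_line_polynomial)
  have mult: "\<exists>p. \<forall>t. (a i + t * (b i - a i)) * (a k + t * (b k - a k)) = poly p t" for i k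
    by (metis line poly_mult)
  have eval: "\<exists>p. \<forall>t. - cpoly_eval F (\<lambda>i. a i + t * (b i - a i)) = poly p t" for F
    using cpoly_eval_curve_polynomial[of "\<lambda>t i. a i + t * (b i - a i)" "- F"] line by simp
  have zero: "\<exists>p. \<forall>t. (0 :: complex) = poly p t"
    by (rule exI[of _ 0]) simp
  have if_poly: "\<exists>p. \<forall>t. f t = poly p t \<Longrightarrow> \<exists>p. \<forall>t. g t = poly p t \<Longrightarrow>
      \<exists>p. \<forall>t. (if Q then f t else g t) = poly p t" for Q and f g :: "complex \<Rightarrow> complex"
    by (cases Q) auto
  show ?thesis
    unfolding \<phi>_def power2_eq_square by (intro if_poly mult eval line zero)
qed

text \<open>The image under \<open>\<phi>\<close> of the coordinate subspace supported on
  \<open>S\<close> is irreducible; the line joining \<open>a\<close> and \<open>b\<close> stays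
  within that subspace.\<close>

lemma \<phi>_common_nonzero:
  assumes "cpoly_eval F (\<phi> a) \<noteq> 0" "cpoly_eval G (\<phi> b) \<noteq> 0" and supp: "\<And>i. i \<notin> S \<Longrightarrow> a i = 0 \<and> b i = 0"
  shows "\<exists>u. (\<forall>i. i \<notin> S \<longrightarrow> u i = 0) \<and> cpoly_eval F (\<phi> u) \<noteq> 0 \<and> cpoly_eval G (\<phi> u) \<noteq> 0"
proof -
  define \<gamma> where "\<gamma> t i = a i + t * (b i - a i)" for t i
  have \<gamma>: "\<exists>p. \<forall>t. \<phi> (\<gamma> t) i = poly p t" for i
    unfolding \<gamma>_def by (rule \<phi>_line_polynomial)
  obtain p where p: "\<And>t. cpoly_eval F (\<phi> (\<gamma> t)) = poly p t"
    using cpoly_eval_curve_polynomial[of "\<lambda>t. \<phi> (\<gamma> t)" F] \<gamma> by blast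
  obtain q where q: "\<And>t. cpoly_eval G (\<phi> (\<gamma> t)) = poly q t"
    using cpoly_eval_curve_polynomial[of "\<lambda>t. \<phi> (\<gamma> t)" G] \<gamma> by blast
  have "\<gamma> 0 = a" "\<gamma> 1 = b" by (auto simp: \<gamma>_def)
  then obtain t where "poly p t \<noteq> 0" "poly q t \<noteq> 0"
    using common_nonroot[of p 0 q 1] assms p q by metis
  moreover have "\<gamma> t i = 0" if "i \<notin> S" for i
    using supp[OF that] by (simp add: \<gamma>_def)
  ultimately show ?thesis using p q by metis
qed

end

section \<open>Projective space and its Zariski topology\<close>

locale coordinates =
  fixes e :: "nat \<Rightarrow> complex ^ 'n" and V :: "nat set"
  assumes basis: "is_basis e" and V_eq: "V = {1..CARD('n)}"
begin

lemma finite_V [simp]: "finite V"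
  by (simp add: V_eq)

definition vector :: "(nat \<Rightarrow> complex) \<Rightarrow> complex ^ 'n" where
  "vector a = (\<Sum>c\<in>V. a c *s e c)"

lemma inj_e: "inj_on e V" and independent_e: "vec.independent (e ` V)" and span_e: "vec.span (e ` V) = UNIV"
  using basis by (auto simp: is_basis_def V_eq)

lemma coord_eq: "coord e v c = vec.representation (e ` V) v (e c)"
  by (simp add: coord_def V_eq)

lemma coord_scale [simp]: "coord e (k *s v) c = k * coord e v c"
  by (simp add: coord_eq vec.representation_scale[OF independent_e] span_e)

lemma coord_add [simp]: "coord e (u + v) c = coord e u c + coord e v c"
  by (simp add: coord_eq vec.representation_add[OF independent_e] span_e)

lemma coord_0 [simp]: "coord e 0 c = 0"
  by (simp add: coord_eq vec.representation_zero)

lemma coord_sum [simp]: "coord e (sum f A) c = (\<Sum>x\<in>A. coord e (f x) c)"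
  by (induction A rule: infinite_finite_induct) auto

lemma coord_basis:
  assumes "i \<in> V" "c \<in> V"
  shows "coord e (e i) c = (if c = i then 1 else 0)"
proof -
  have "coord e (e i) c = (if e c = e i then 1 else 0)"
    using assms by (simp add: coord_eq vec.representation_basis[OF independent_e])
  then show ?thesis using inj_e assms by (auto dest: inj_onD)
qed

lemma vector_coord: "vector (coord e v) = v"
proof -
  have "(\<Sum>b\<in>e ` V. vec.representation (e ` V) v b *s b) = v"
    by (rule vec.sum_representation_eq[OF independent_e]) (auto simp: span_e)
  then show ?thesis
    by (simp add: vector_def coord_eq sum.reindex[OF inj_e])
qed

lemma coord_vector: "c \<in> V \<Longrightarrow> coord e (vector a) c = a c"
  by (simp add: vector_def coord_basis if_distrib sum.If_cases cong: if_cong)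

lemma vector_0_iff: "vector a = 0 \<longleftrightarrow> (\<forall>c\<in>V. a c = 0)"
proof
  assume "vector a = 0"
  then show "\<forall>c\<in>V. a c = 0" using coord_vector[of _ a] by simp
qed (simp add: vector_def)

lemma nonzero_coord: "v \<noteq> 0 \<Longrightarrow> \<exists>c\<in>V. coord e v c \<noteq> 0"
  using vector_0_iff[of "coord e v"] by (auto simp: vector_coord)

lemma line_in_projective: "v \<noteq> 0 \<Longrightarrow> vec.span {v} \<in> projective_space"
  by (simp add: grassmannian_def)

lemma projective_line:
  assumes "L \<in> projective_space"
  obtains v where "v \<noteq> 0" "L = vec.span {v}"
proof -
  have L: "vec.subspace L" "vec.dim L = 1"
    using assms by (auto simp: grassmannian_def)
  then obtain v where v: "v \<in> L" "v \<noteq> 0"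
    by (metis vec.dim_eq_0 subsetI singleton_iff zero_neq_one)
  have "vec.span {v} = L"
    by (rule vec.subspace_dim_equal) (use L v in \<open>auto simp: vec.span_minimal\<close>)
  then show ?thesis using that v by metis
qed

lemma span_singleton: "vec.span {v} = range (\<lambda>k. k *s (v :: complex ^ 'n))"
  by (auto simp: vec.span_singleton)

lemma eval_scaled:
  "homogeneous k F \<Longrightarrow> cpoly_eval F (coord e (s *s v)) = s ^ k * cpoly_eval F (coord e v)"
proof -
  have "coord e (s *s v) = (\<lambda>c. s * coord e v c)" by auto
  then show "homogeneous k F \<Longrightarrow> ?thesis" by (simp add: cpoly_eval_homogeneous)
qed

lemma vanishes_at_line:
  assumes "homogeneous k F"
  shows "vanishes_at e F (vec.span {v}) \<longleftrightarrow> cpoly_eval F (coord e v) = 0"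
proof
  assume "vanishes_at e F (vec.span {v})"
  then show "cpoly_eval F (coord e v) = 0"
    by (auto simp: vanishes_at_def vec.span_base)
next
  assume "cpoly_eval F (coord e v) = 0"
  then show "vanishes_at e F (vec.span {v})"
    using eval_scaled[OF assms] by (auto simp: vanishes_at_def span_singleton)
qed

lemma vanishes_at_mult:
  assumes "L \<in> projective_space" "homogeneous k F" "homogeneous l G"
  shows "vanishes_at e (F * G) L \<longleftrightarrow> vanishes_at e F L \<or> vanishes_at e G L"
proof -
  obtain v where "L = vec.span {v}" using projective_line[OF assms(1)] by blast
  then show ?thesis
    using vanishes_at_line[OF homogeneous_mult[OF assms(2,3)]] vanishes_at_line[OF assms(2)]
      vanishes_at_line[OF assms(3)] by simp
qed

lemma not_vanishes_at_1: "L \<in> projective_space \<Longrightarrow> \<not> vanishes_at e 1 L"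
  by (auto simp: vanishes_at_def grassmannian_def vec.subspace_def)

lemma nonvanishing_coordinate:
  assumes "L \<in> projective_space"
  shows "\<exists>c\<in>V. \<not> vanishes_at e (cpoly_var c) L"
proof -
  obtain v where "v \<noteq> 0" "L = vec.span {v}" using projective_line[OF assms] by blast
  then show ?thesis using nonzero_coord[of v] vanishes_at_line[OF homogeneous_var] by auto
qed

section \<open>Closed sets and homogeneous equations\<close>

lemma proj_zariski_eq: "proj_zariski e =
    topology_generated_by {projective_space - proj_zeros e {F} | F k. F \<in> cpoly_ring V \<and> homogeneous k F}"
  by (simp add: proj_zariski_def V_eq)

lemma topspace_proj_zariski [simp]: "topspace (proj_zariski e) = projective_space"
proof -
  have "projective_space - proj_zeros e {1} = (projective_space :: (complex ^ 'n) set set)"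
    using not_vanishes_at_1 by (auto simp: proj_zeros_def)
  moreover have "projective_space - proj_zeros e {1} \<in>
      {projective_space - proj_zeros e {F} | F k. F \<in> cpoly_ring V \<and> homogeneous k F}"
    using homogeneous_1 by (metis (mono_tags, lifting) cpoly_ring_1 mem_Collect_eq)
  ultimately show ?thesis
    by (auto simp: proj_zariski_eq)
qed

lemma closedin_hypersurface:
  assumes "F \<in> cpoly_ring V" "homogeneous k F"
  shows "closedin (proj_zariski e) (proj_zeros e {F})"
proof -
  have "openin (proj_zariski e) (projective_space - proj_zeros e {F})"
    unfolding proj_zariski_eq by (rule topology_generated_by_Basis) (use assms in blast)
  then show ?thesis
    by (auto simp: closedin_def proj_zeros_def)
qed

text \<open>The generating open sets are only a subbasis by definition. They form a basis because
  the product of two forms is nonzero exactly where both forms are.\<close>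

lemma open_contains_basic:
  assumes "openin (proj_zariski e) U" "L \<in> U"
  shows "\<exists>F k. F \<in> cpoly_ring V \<and> homogeneous k F \<and> \<not> vanishes_at e F L \<and>
    (\<forall>L'\<in>projective_space - U. vanishes_at e F L')"
proof -
  have "generate_topology_on
      {projective_space - proj_zeros e {F} | F k. F \<in> cpoly_ring V \<and> homogeneous k F} U"
    using assms(1) by (simp add: proj_zariski_eq openin_topology_generated_by_iff)
  then show ?thesis using assms(2)
  proof (induction rule: generate_topology_on.induct)
    case (Int A B)
    have "L \<in> A" "L \<in> B" using Int.prems by auto
    obtain F k where F: "F \<in> cpoly_ring V" "homogeneous k F" "\<not> vanishes_at e F L"
        "\<forall>L'\<in>projective_space - A. vanishes_at e F L'"
      using Int.IH(1)[OF \<open>L \<in> A\<close>] by blast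
    obtain G l where G: "G \<in> cpoly_ring V" "homogeneous l G" "\<not> vanishes_at e G L"
        "\<forall>L'\<in>projective_space - B. vanishes_at e G L'"
      using Int.IH(2)[OF \<open>L \<in> B\<close>] by blast
    have "openin (proj_zariski e) A"
      using Int.hyps by (simp add: proj_zariski_eq openin_topology_generated_by_iff)
    then have L: "L \<in> projective_space"
      using Int.prems openin_subset by (metis IntD1 subsetD topspace_proj_zariski)
    have "\<not> vanishes_at e (F * G) L"
      using F G vanishes_at_mult[OF L F(2) G(2)] by blast
    moreover have "\<forall>L'\<in>projective_space - (A \<inter> B). vanishes_at e (F * G) L'"
      using F G vanishes_at_mult[OF _ F(2) G(2)] by blast
    ultimately show ?case
      using cpoly_ring_mult[OF F(1) G(1)] homogeneous_mult[OF F(2) G(2)] by blast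
  next
    case (UN K)
    then obtain U where U: "U \<in> K" "L \<in> U" by blast
    then obtain F k where "F \<in> cpoly_ring V" "homogeneous k F" "\<not> vanishes_at e F L"
        "\<forall>L'\<in>projective_space - U. vanishes_at e F L'"
      using UN.IH by blast
    then show ?case using U(1) by (intro exI[of _ F] exI[of _ k]) auto
  next
    case (Basis U)
    then obtain F k where "U = projective_space - proj_zeros e {F}" "F \<in> cpoly_ring V" "homogeneous k F"
      by blast
    then show ?case using Basis.prems by (intro exI[of _ F] exI[of _ k]) (auto simp: proj_zeros_def)
  qed simp
qed

lemma closed_separation:
  assumes "Z \<subseteq> projective_space" "closedin (subtopology (proj_zariski e) Z) W" "L \<in> Z" "L \<notin> W"
  shows "\<exists>F k. F \<in> cpoly_ring V \<and> homogeneous k F \<and> \<not> vanishes_at e F L \<and> (\<forall>L'\<in>W. vanishes_at e F L')"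
proof -
  obtain C where C: "closedin (proj_zariski e) C" "W = Z \<inter> C"
    using assms(2) by (auto simp: closedin_subtopology)
  then have "openin (proj_zariski e) (projective_space - C)"
    by (auto simp: closedin_def)
  moreover have "L \<in> projective_space - C" using assms C by auto
  ultimately obtain F k where "F \<in> cpoly_ring V" "homogeneous k F" "\<not> vanishes_at e F L"
      "\<forall>L'\<in>projective_space - (projective_space - C). vanishes_at e F L'"
    using open_contains_basic by blast
  then show ?thesis
    using assms(1) C(2) by (intro exI[of _ F] exI[of _ k]) auto
qed

text \<open>The homogeneous ideal of an irreducible closed set is prime: \<open>W\<close> is the
  union of its intersections with the hypersurfaces of \<open>G\<close> and of
  \<open>H\<close>.\<close>

lemma irreducible_product:
  assumes "Z \<subseteq> projective_space" "irreducible_closed (subtopology (proj_zariski e) Z) W"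
    and G: "G \<in> cpoly_ring V" "homogeneous k G" and "L \<in> W" "\<not> vanishes_at e G L"
    and H: "H \<in> cpoly_ring V" "homogeneous l H"
    and vanish: "\<And>L. L \<in> W \<Longrightarrow> vanishes_at e (G * H) L"
  shows "\<forall>L\<in>W. vanishes_at e H L"
proof -
  have W: "closedin (subtopology (proj_zariski e) Z) W"
    using assms(2) by (simp add: irreducible_closed_def)
  then have WZ: "W \<subseteq> Z"
    using closedin_subset by fastforce
  have closed: "closedin (subtopology (proj_zariski e) Z) (W \<inter> proj_zeros e {F})"
    if "F \<in> cpoly_ring V" "homogeneous k F" for F k
  proof -
    have "closedin (subtopology (proj_zariski e) Z) (proj_zeros e {F} \<inter> Z)"
      using closedin_hypersurface[OF that] by (auto simp: closedin_subtopology)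
    then have "closedin (subtopology (proj_zariski e) Z) (W \<inter> (proj_zeros e {F} \<inter> Z))"
      using W by (rule closedin_Int[rotated])
    moreover have "W \<inter> (proj_zeros e {F} \<inter> Z) = W \<inter> proj_zeros e {F}" using WZ by auto
    ultimately show ?thesis by simp
  qed
  have proj: "W \<subseteq> projective_space" using WZ assms(1) by auto
  have "W = (W \<inter> proj_zeros e {G}) \<union> (W \<inter> proj_zeros e {H})"
  proof -
    have "L \<in> proj_zeros e {G} \<union> proj_zeros e {H}" if "L \<in> W" for L
      using vanish[OF that] that proj vanishes_at_mult[of L, OF _ G(2) H(2)]
      by (auto simp: proj_zeros_def)
    then show ?thesis by blast
  qed
  then have "W = W \<inter> proj_zeros e {G} \<or> W = W \<inter> proj_zeros e {H}"
    using assms(2) closed[OF G] closed[OF H] unfolding irreducible_closed_def by blast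
  moreover have "L \<notin> proj_zeros e {G}"
    using \<open>\<not> vanishes_at e G L\<close> by (simp add: proj_zeros_def)
  ultimately have "W \<subseteq> proj_zeros e {H}" using \<open>L \<in> W\<close> by blast
  then show ?thesis by (auto simp: proj_zeros_def)
qed

text \<open>
  If \<open>G\<close> vanishes on \<open>W\<^sub>i\<close> but not identically on \<open>W\<^sub>i\<^sub>+\<^sub>1\<close>, then a family independent on \<open>W\<^sub>i\<close>
  together with \<open>G\<close> times a family independent on \<open>W\<^sub>i\<^sub>+\<^sub>1\<close> is again independent on \<open>W\<^sub>i\<^sub>+\<^sub>1\<close>.
  This Pascal recurrence bounds the Hilbert function of \<open>W\<^sub>i\<close> from below by a polynomial of degree \<open>i\<close>.
\<close>

definition independent_on :: "(complex ^ 'n) set set \<Rightarrow> nat \<Rightarrow> nat \<Rightarrow> (nat \<Rightarrow> nat cpoly) \<Rightarrow> bool" where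
  "independent_on W d n F \<longleftrightarrow> (\<forall>k<n. F k \<in> cpoly_ring V \<and> homogeneous d (F k)) \<and>
     (\<forall>c. (\<forall>L\<in>W. \<forall>v\<in>L. (\<Sum>k<n. c k * cpoly_eval (F k) (coord e v)) = 0) \<longrightarrow> (\<forall>k<n. c k = 0))"

text \<open>This starts the Pascal recurrence, where the binomial coefficients on the boundary are
  1: a nonempty set carries a nonvanishing form in every degree.\<close>

lemma independent_on_power:
  assumes "W \<subseteq> projective_space" "W \<noteq> {}"
  shows "\<exists>F. independent_on W d 1 F"
proof -
  obtain L where L: "L \<in> W" using assms(2) by blast
  then obtain c where c: "c \<in> V" "\<not> vanishes_at e (cpoly_var c) L"
    using nonvanishing_coordinate assms(1) by blast
  then obtain v where v: "v \<in> L" "coord e v c \<noteq> 0"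
    by (auto simp: vanishes_at_def)
  have "independent_on W d 1 (\<lambda>_. cpoly_var c ^ d)"
    unfolding independent_on_def
  proof (intro conjI allI impI)
    show "cpoly_var c ^ d \<in> cpoly_ring V" using c(1) by (intro cpoly_ring_power cpoly_ring_var)
    show "homogeneous d (cpoly_var c ^ d)" using homogeneous_power[OF homogeneous_var, of d] by simp
    fix s :: "nat \<Rightarrow> complex" and k :: nat
    assume "\<forall>L\<in>W. \<forall>v\<in>L. (\<Sum>k<1. s k * cpoly_eval (cpoly_var c ^ d) (coord e v)) = 0" "k < 1"
    then have "(\<Sum>k<1. s k * cpoly_eval (cpoly_var c ^ d) (coord e v)) = 0" using L v(1) by blast
    then show "s k = 0" using v(2) \<open>k < 1\<close> by simp
  qed
  then show ?thesis by blast
qed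

lemma independent_on_step:
  assumes "Z \<subseteq> projective_space" "irreducible_closed (subtopology (proj_zariski e) Z) W'" "W \<subseteq> W'"
    and G: "G \<in> cpoly_ring V" "homogeneous \<delta> G" "L \<in> W'" "\<not> vanishes_at e G L"
      "\<forall>L\<in>W. vanishes_at e G L"
    and F: "independent_on W (\<delta> + d) n F" and F': "independent_on W' d n' F'"
  shows "\<exists>F''. independent_on W' (\<delta> + d) (n + n') F''"
proof -
  define F'' where "F'' k = (if k < n then F k else G * F' (k - n))" for k
  have split: "(\<Sum>k<n + n'. h k) = (\<Sum>k<n. h k) + (\<Sum>k<n'. h (n + k))" for h :: "nat \<Rightarrow> complex"
    by (induction n') auto
  have ring: "F'' k \<in> cpoly_ring V \<and> homogeneous (\<delta> + d) (F'' k)" if "k < n + n'" for k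
    using that F F' G by (auto simp: F''_def independent_on_def intro: cpoly_ring_mult homogeneous_mult)
  have zero: "c k = 0"
    if c: "\<forall>L\<in>W'. \<forall>v\<in>L. (\<Sum>k<n + n'. c k * cpoly_eval (F'' k) (coord e v)) = 0" and "k < n + n'"
    for c :: "nat \<Rightarrow> complex" and k
  proof -
    define H where "H = (\<Sum>k<n'. cpoly_const (c (n + k)) * F' k)"
    have H: "H \<in> cpoly_ring V" "homogeneous d H"
    proof -
      show "H \<in> cpoly_ring V" unfolding H_def
        by (intro cpoly_ring_sum cpoly_ring_mult) (use F' in \<open>auto simp: independent_on_def\<close>)
      have "homogeneous d (cpoly_const (c (n + k)) * F' k)" if "k < n'" for k
        using homogeneous_mult[OF homogeneous_const, of d "F' k"] that F' by (simp add: independent_on_def)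
      then show "homogeneous d H" unfolding H_def by (intro homogeneous_sum) auto
    qed
    have sum: "(\<Sum>k<n. c k * cpoly_eval (F k) (coord e v)) + cpoly_eval (G * H) (coord e v) = 0"
      if "L \<in> W'" "v \<in> L" for L v
    proof -
      have "(\<Sum>k<n + n'. c k * cpoly_eval (F'' k) (coord e v)) = 0" using c that by blast
      then show ?thesis
        unfolding split by (simp add: F''_def H_def sum_distrib_left mult_ac)
    qed
    have "(\<Sum>k<n. c k * cpoly_eval (F k) (coord e v)) = 0" if "L \<in> W" "v \<in> L" for L v
    proof -
      have "cpoly_eval G (coord e v) = 0" using G(5) that by (auto simp: vanishes_at_def)
      then show ?thesis using sum[of L v] that assms(3) by auto
    qed
    then have c1: "c k = 0" if "k < n" for k
      using F that unfolding independent_on_def by blast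
    \<comment> \<open>On \<open>W\<close> the terms with factor \<open>G\<close> vanish, which
      disposes of the first \<open>n\<close> coefficients. What remains is \<open>G * H\<close>, and
      primality cancels \<open>G\<close>.\<close>
    have "vanishes_at e (G * H) L" if "L \<in> W'" for L
      using sum[OF that] c1 by (simp add: vanishes_at_def)
    then have "\<forall>L\<in>W'. vanishes_at e H L"
      using irreducible_product[OF assms(1,2) G(1-4) H] by blast
    then have "\<forall>L\<in>W'. \<forall>v\<in>L. (\<Sum>k<n'. c (n + k) * cpoly_eval (F' k) (coord e v)) = 0"
      by (simp add: vanishes_at_def H_def)
    then have c2: "\<forall>k<n'. c (n + k) = 0"
      using F' unfolding independent_on_def by (elim conjE allE[where x = "\<lambda>k. c (n + k)"] impE) simp_all
    show "c k = 0"
    proof (cases "k < n")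
      case False
      then have "c (n + (k - n)) = 0" using c2 \<open>k < n + n'\<close> by (intro c2[rule_format]) simp
      then show ?thesis using False by simp
    qed (rule c1)
  qed
  have "independent_on W' (\<delta> + d) (n + n') F''"
    unfolding independent_on_def using ring zero by blast
  then show ?thesis by blast
qed

text \<open>The recurrence runs along the multiples of one degree \<open>\<delta>\<close>, so the
  forms separating \<open>W i\<close> from \<open>W (Suc i)\<close> must all have this degree. The
  sum of their original degrees is a common upper bound.\<close>

lemma chain_hilbert_bound:
  assumes Z: "Z \<subseteq> projective_space"
    and irr: "\<forall>i\<le>l. irreducible_closed (subtopology (proj_zariski e) Z) (W i)"
    and strict: "\<forall>i<l. W i \<subset> W (Suc i)"
  shows "\<exists>\<delta>. \<forall>j. \<exists>F. independent_on (W l) (\<delta> * j) ((l + j) choose l) F"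
proof -
  have WZ: "W i \<subseteq> Z" if "i \<le> l" for i
    using irr that closedin_subset[of "subtopology (proj_zariski e) Z"] by (fastforce simp: irreducible_closed_def)
  have "\<exists>F k L. F \<in> cpoly_ring V \<and> homogeneous k F \<and> L \<in> W (Suc i) \<and> \<not> vanishes_at e F L \<and>
      (\<forall>L'\<in>W i. vanishes_at e F L')" if "i < l" for i
  proof -
    have "W i \<subset> W (Suc i)" using strict that by blast
    then obtain L where L: "L \<in> W (Suc i)" "L \<notin> W i" by blast
    moreover have "L \<in> Z" using L WZ[of "Suc i"] that by auto
    moreover have "closedin (subtopology (proj_zariski e) Z) (W i)"
      using irr that by (simp add: irreducible_closed_def)
    ultimately show ?thesis using closed_separation[OF Z] by blast
  qed
  then obtain F k L where F: "\<And>i. i < l \<Longrightarrow> F i \<in> cpoly_ring V" "\<And>i. i < l \<Longrightarrow> homogeneous (k i) (F i)"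
      "\<And>i. i < l \<Longrightarrow> L i \<in> W (Suc i)" "\<And>i. i < l \<Longrightarrow> \<not> vanishes_at e (F i) (L i)"
      "\<And>i L'. i < l \<Longrightarrow> L' \<in> W i \<Longrightarrow> vanishes_at e (F i) L'"
    by metis
  define \<delta> where "\<delta> = (\<Sum>i<l. k i)"
  have G: "\<exists>G. G \<in> cpoly_ring V \<and> homogeneous \<delta> G \<and> \<not> vanishes_at e G (L i) \<and>
      (\<forall>L'\<in>W i. vanishes_at e G L')" if "i < l" for i
  proof -
    have "L i \<in> Z" using F(3)[OF that] WZ[of "Suc i"] that by auto
    then have proj: "L i \<in> projective_space" using Z by auto
    obtain c where c: "c \<in> V" "\<not> vanishes_at e (cpoly_var c) (L i)"
      using nonvanishing_coordinate[OF proj] by blast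
    have pow: "homogeneous n (cpoly_var c ^ n)" for n
      using homogeneous_power[OF homogeneous_var, of n] by simp
    \<comment> \<open>A power of a coordinate that is nonzero at the separating point
      \<open>L i\<close> raises the degree to \<open>\<delta>\<close> and keeps the
      separation.\<close>
    let ?G = "F i * cpoly_var c ^ (\<delta> - k i)"
    have "\<not> vanishes_at e (cpoly_var c ^ (\<delta> - k i)) (L i)"
      using c(2) by (auto simp: vanishes_at_def)
    then have "\<not> vanishes_at e ?G (L i)"
      using vanishes_at_mult[OF proj F(2)[OF that] pow] F(4)[OF that] by blast
    moreover have "vanishes_at e ?G L'" if "L' \<in> W i" for L'
      using F(5)[OF \<open>i < l\<close> that] by (simp add: vanishes_at_def)
    moreover have "?G \<in> cpoly_ring V"
      using F(1)[OF that] c(1) by (intro cpoly_ring_mult cpoly_ring_power cpoly_ring_var)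
    moreover have "k i \<le> \<delta>" unfolding \<delta>_def by (rule member_le_sum) (use that in auto)
    then have "homogeneous \<delta> ?G"
      using homogeneous_mult[OF F(2)[OF that] pow[of "\<delta> - k i"]] by simp
    ultimately show ?thesis by blast
  qed
  have "\<exists>F. independent_on (W i) (\<delta> * j) ((i + j) choose i) F" if "i \<le> l" for i j
    using that
  proof (induction i arbitrary: j)
    case 0
    have "W 0 \<subseteq> projective_space" "W 0 \<noteq> {}"
      using WZ[of 0] Z irr by (auto simp: irreducible_closed_def)
    then show ?case using independent_on_power by simp
  next
    case (Suc i)
    note IH = Suc.IH
    show ?case
    proof (induction j)
      case 0
      have "W (Suc i) \<subseteq> projective_space" "W (Suc i) \<noteq> {}"
        using WZ[of "Suc i"] Z irr Suc.prems by (auto simp: irreducible_closed_def)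
      then show ?case using independent_on_power by simp
    next
      case (Suc j)
      have i: "i < l" using \<open>Suc i \<le> l\<close> by simp
      obtain G where G: "G \<in> cpoly_ring V" "homogeneous \<delta> G" "\<not> vanishes_at e G (L i)"
          "\<forall>L'\<in>W i. vanishes_at e G L'"
        using G[OF i] by blast
      obtain F1 where F1: "independent_on (W i) (\<delta> + \<delta> * j) ((i + Suc j) choose i) F1"
        using IH[of "Suc j"] i by auto
      obtain F2 where F2: "independent_on (W (Suc i)) (\<delta> * j) ((Suc i + j) choose Suc i) F2"
        using Suc.IH by blast
      have irr': "irreducible_closed (subtopology (proj_zariski e) Z) (W (Suc i))"
        using irr \<open>Suc i \<le> l\<close> by blast
      have "W i \<subseteq> W (Suc i)" using strict[rule_format, OF i] by blast
      from independent_on_step[OF Z irr' this G(1,2) F(3)[OF i] G(3,4) F1 F2]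
      show ?case by (simp add: add.commute)
    qed
  qed
  then show ?thesis by blast
qed

end

text \<open>The left-hand side is at least \<open>((l + j) / l) ^ l\<close>, hence grows like
  \<open>j ^ l\<close>, the right-hand side at most like \<open>j ^ t\<close>. If
  \<open>t < l\<close>, dividing by \<open>(l + j) ^ t\<close> would bound \<open>l + j\<close> by a
  constant.\<close>

lemma binomial_growth:
  fixes K \<delta> t l :: nat
  assumes "\<And>j. (l + j) choose l \<le> K * (\<delta> * j + 1) ^ t"
  shows "l \<le> t"
proof (rule ccontr)
  assume "\<not> l \<le> t"
  then have l: "t < l" by simp
  have bound: "l + j \<le> l ^ l * K * (\<delta> + 1) ^ t" for j
  proof -
    have "(real (l + j) / real l) ^ l \<le> real ((l + j) choose l)"
      by (rule binomial_ge_n_over_k_pow_k) simp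
    then have "real (l + j) ^ l \<le> real l ^ l * real ((l + j) choose l)"
      using l by (simp add: power_divide divide_le_eq mult.commute)
    then have "(l + j) ^ l \<le> l ^ l * ((l + j) choose l)"
      by (metis of_nat_le_iff of_nat_mult of_nat_power)
    also have "\<dots> \<le> l ^ l * (K * (\<delta> * j + 1) ^ t)"
      by (rule mult_le_mono2[OF assms])
    also have "\<delta> * j + 1 \<le> (\<delta> + 1) * (l + j)"
      using l by (simp add: algebra_simps)
    then have "l ^ l * (K * (\<delta> * j + 1) ^ t) \<le> l ^ l * (K * ((\<delta> + 1) * (l + j)) ^ t)"
      by (intro mult_le_mono2 power_mono) auto
    also have "\<dots> = l ^ l * K * (\<delta> + 1) ^ t * (l + j) ^ t"
      by (simp only: power_mult_distrib mult.assoc)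
    finally have "(l + j) ^ (l - t) * (l + j) ^ t \<le> l ^ l * K * (\<delta> + 1) ^ t * (l + j) ^ t"
      using l by (simp add: power_add[symmetric])
    then have "(l + j) ^ (l - t) \<le> l ^ l * K * (\<delta> + 1) ^ t"
      using l by (subst (asm) mult_le_cancel2) auto
    moreover have "(l + j) ^ 1 \<le> (l + j) ^ (l - t)"
      by (rule power_increasing) (use l in auto)
    ultimately show ?thesis by simp
  qed
  \<comment> \<open>With the constant itself in place of \<open>j\<close>, the bound reads
    \<open>l\<close> plus constant at most constant, while \<open>l > 0\<close>.\<close>
  show False using bound[of "l ^ l * K * (\<delta> + 1) ^ t"] l by simp
qed

section \<open>Complete intersections of split quadrics\<close>

text \<open>\<open>L_proper\<close> says that the linear equations leave a variable free. This is
  what makes \<open>Z\<close> nonempty and gives it a dimension.\<close>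

locale projective_split_quadrics = coordinates e V + split_quadrics V L J y z R r
  for e :: "nat \<Rightarrow> complex ^ 'n" and V L :: "nat set" and J :: "'j set" and y z :: "'j \<Rightarrow> nat"
    and R :: "'j \<Rightarrow> nat set" and r :: "'j \<Rightarrow> nat cpoly" +
  assumes L_proper: "L \<noteq> V"
begin

definition Z :: "(complex ^ 'n) set set" where
  "Z = proj_zeros e gens"

lemma Z_projective: "Z \<subseteq> projective_space"
  by (auto simp: Z_def proj_zeros_def)

lemma Z_cone: "\<Lambda> \<in> Z \<Longrightarrow> v \<in> \<Lambda> \<Longrightarrow> coord e v \<in> cone"
  by (auto simp: Z_def proj_zeros_def vanishes_at_def cone_def)

lemma coord_vector_eval: "F \<in> cpoly_ring V \<Longrightarrow> cpoly_eval F (coord e (vector a)) = cpoly_eval F a"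
  by (rule cpoly_eval_cong) (auto simp: coord_vector)

lemma line_in_Z:
  assumes "a \<in> cone" "vector a \<noteq> 0"
  shows "vec.span {vector a} \<in> Z"
proof -
  have "vanishes_at e g (vec.span {vector a})" if g: "g \<in> gens" for g
  proof -
    obtain k where k: "homogeneous k g" using gens_homogeneous[OF g] by blast
    have "cpoly_eval g a = 0" using assms(1) g by (simp add: cone_def)
    moreover have "g \<in> cpoly_ring V" using gens_ring g by blast
    ultimately show ?thesis by (simp add: vanishes_at_line[OF k] coord_vector_eval)
  qed
  then show ?thesis
    using line_in_projective[OF assms(2)] by (simp add: Z_def proj_zeros_def)
qed

text \<open>The variables that remain when each quadric is used to eliminate \<open>z j\<close>. The
  parametrization \<open>\<phi>\<close> depends on these alone, and \<open>card S - 1\<close> turns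
  out to be the dimension of \<open>Z\<close>.\<close>

definition S :: "nat set" where
  "S = V - L - z ` J"

lemma finite_S: "finite S"
  by (simp add: S_def)

lemma y_in_S: "y ` J \<subseteq> S"
  using y_in y_z_disjoint by (auto simp: S_def)

lemma V_minus_L: "V - L \<noteq> {}"
  using L_proper L_subset by blast

lemma S_nonempty: "S \<noteq> {}"
proof (cases "J = {}")
  case True
  then show ?thesis using V_minus_L unfolding S_def by simp
qed (use y_in_S in blast)

section \<open>Upper and lower bounds for chains of irreducible closed subsets\<close>

lemma krull_upper_bound:
  assumes "has_irreducible_chain (subtopology (proj_zariski e) Z) l"
  shows "l \<le> card S - 1"
proof -
  obtain W where W: "\<forall>i\<le>l. irreducible_closed (subtopology (proj_zariski e) Z) (W i)"
      "\<forall>i<l. W i \<subset> W (Suc i)"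
    using assms by (auto simp: has_irreducible_chain_def)
  obtain \<delta> where \<delta>: "\<And>j. \<exists>F. independent_on (W l) (\<delta> * j) ((l + j) choose l) F"
    using chain_hilbert_bound[OF Z_projective W] by blast
  have "W l \<subseteq> Z"
    using W(1) closedin_subset[of "subtopology (proj_zariski e) Z" "W l"]
    by (auto simp: irreducible_closed_def)
  have "(l + j) choose l \<le> 2 ^ card J * (\<delta> * j + 1) ^ (card S - 1)" for j
  proof -
    obtain F where F: "independent_on (W l) (\<delta> * j) ((l + j) choose l) F" using \<delta> by blast
    show ?thesis unfolding S_def
    proof (rule card_independent_le[OF _ _ V_minus_L])
      show "F k \<in> cpoly_ring V" "homogeneous (\<delta> * j) (F k)" if "k < (l + j) choose l" for k
        using F that by (auto simp: independent_on_def)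
      fix c :: "nat \<Rightarrow> complex"
      assume c: "\<And>a. a \<in> cone \<Longrightarrow> (\<Sum>k<(l + j) choose l. c k * cpoly_eval (F k) a) = 0"
      have "\<forall>\<Lambda>\<in>W l. \<forall>v\<in>\<Lambda>. (\<Sum>k<(l + j) choose l. c k * cpoly_eval (F k) (coord e v)) = 0"
        using c Z_cone \<open>W l \<subseteq> Z\<close> by blast
      then show "\<forall>k<(l + j) choose l. c k = 0"
        using F unfolding independent_on_def by blast
    qed
  qed
  then show ?thesis by (rule binomial_growth)
qed

text \<open>The Zariski closure in \<open>Z\<close> of the set of lines through the points
  \<open>\<phi> u\<close> with \<open>u\<close> supported on \<open>A\<close>. Stating it by
  equations avoids excluding those \<open>u\<close> for which \<open>\<phi> u\<close> is the zero
  vector.\<close>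

definition param_closure :: "nat set \<Rightarrow> (complex ^ 'n) set set" where
  "param_closure A = {\<Lambda> \<in> Z. \<forall>F k. F \<in> cpoly_ring V \<longrightarrow> homogeneous k F \<longrightarrow>
     (\<forall>u. (\<forall>i. i \<notin> A \<longrightarrow> u i = 0) \<longrightarrow> cpoly_eval F (\<phi> u) = 0) \<longrightarrow> vanishes_at e F \<Lambda>}"

lemma param_closure_vanishes:
  assumes "\<Lambda> \<in> param_closure A" "F \<in> cpoly_ring V" "homogeneous k F"
    and "\<And>u. (\<And>i. i \<notin> A \<Longrightarrow> u i = 0) \<Longrightarrow> cpoly_eval F (\<phi> u) = 0"
  shows "vanishes_at e F \<Lambda>"
  using assms unfolding param_closure_def by blast

lemma param_closure_mono:
  assumes "A \<subseteq> B"
  shows "param_closure A \<subseteq> param_closure B"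
proof
  fix \<Lambda> assume \<Lambda>: "\<Lambda> \<in> param_closure A"
  show "\<Lambda> \<in> param_closure B"
    unfolding param_closure_def
  proof (intro CollectI conjI allI impI)
    show "\<Lambda> \<in> Z" using \<Lambda> by (simp add: param_closure_def)
    fix F k assume F: "F \<in> cpoly_ring V" "homogeneous k F"
      and vanish: "\<forall>u. (\<forall>i. i \<notin> B \<longrightarrow> u i = 0) \<longrightarrow> cpoly_eval F (\<phi> u) = 0"
    have "cpoly_eval F (\<phi> u) = 0" if "\<forall>i. i \<notin> A \<longrightarrow> u i = 0" for u
      using vanish that assms by blast
    then show "vanishes_at e F \<Lambda>"
      using \<Lambda> F unfolding param_closure_def by blast
  qed
qed

lemma param_closure_line:
  assumes "\<And>i. i \<notin> A \<Longrightarrow> u i = 0" "vector (\<phi> u) \<noteq> 0"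
  shows "vec.span {vector (\<phi> u)} \<in> param_closure A"
  unfolding param_closure_def
proof (intro CollectI conjI allI impI)
  show "vec.span {vector (\<phi> u)} \<in> Z"
    by (rule line_in_Z[OF \<phi>_cone assms(2)])
  fix F k assume "F \<in> cpoly_ring V" "homogeneous k F"
    and "\<forall>u. (\<forall>i. i \<notin> A \<longrightarrow> u i = 0) \<longrightarrow> cpoly_eval F (\<phi> u) = 0"
  then show "vanishes_at e F (vec.span {vector (\<phi> u)})"
    using assms(1) by (simp add: vanishes_at_line coord_vector_eval)
qed

text \<open>For a proper closed part some form vanishes on it but not at some
  \<open>\<phi> a\<close>. For two proper parts, the two forms are nonzero at a common
  \<open>\<phi> u\<close>, and the line through this point lies in neither part.\<close>

lemma param_closure_irreducible:
  assumes nonempty: "param_closure A \<noteq> {}"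
  shows "irreducible_closed (subtopology (proj_zariski e) Z) (param_closure A)"
  unfolding irreducible_closed_def
proof (intro conjI allI impI nonempty)
  let ?X = "subtopology (proj_zariski e) Z" and ?W = "param_closure A"
  define \<F> where "\<F> = {proj_zeros e {F} | F k. F \<in> cpoly_ring V \<and> homogeneous k F \<and>
     (\<forall>u. (\<forall>i. i \<notin> A \<longrightarrow> u i = 0) \<longrightarrow> cpoly_eval F (\<phi> u) = 0)}"
  have "proj_zeros e {0} \<in> \<F>"
    unfolding \<F>_def by (intro CollectI exI[of _ 0]) simp
  then have "\<F> \<noteq> {}" by blast
  moreover have "closedin (proj_zariski e) U" if U: "U \<in> \<F>" for U
  proof -
    obtain F k where "U = proj_zeros e {F}" "F \<in> cpoly_ring V" "homogeneous k F"
      using U unfolding \<F>_def by blast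
    then show ?thesis using closedin_hypersurface by simp
  qed
  ultimately have "closedin (proj_zariski e) (\<Inter>\<F>)"
    by (rule closedin_Inter)
  moreover have "?W = \<Inter>\<F> \<inter> Z"
  proof (intro equalityI subsetI IntI InterI)
    fix \<Lambda> assume \<Lambda>: "\<Lambda> \<in> ?W"
    then show Z: "\<Lambda> \<in> Z" by (simp add: param_closure_def)
    fix U assume "U \<in> \<F>"
    then obtain F k where "U = proj_zeros e {F}" "F \<in> cpoly_ring V" "homogeneous k F"
        "\<forall>u. (\<forall>i. i \<notin> A \<longrightarrow> u i = 0) \<longrightarrow> cpoly_eval F (\<phi> u) = 0"
      unfolding \<F>_def by blast
    then show "\<Lambda> \<in> U"
      using param_closure_vanishes[OF \<Lambda>, of F k] subsetD[OF Z_projective Z] by (simp add: proj_zeros_def)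
  next
    fix \<Lambda> assume \<Lambda>: "\<Lambda> \<in> \<Inter>\<F> \<inter> Z"
    show "\<Lambda> \<in> ?W"
      unfolding param_closure_def
    proof (intro CollectI conjI allI impI)
      show "\<Lambda> \<in> Z" using \<Lambda> by simp
      fix F k assume "F \<in> cpoly_ring V" "homogeneous k F"
        "\<forall>u. (\<forall>i. i \<notin> A \<longrightarrow> u i = 0) \<longrightarrow> cpoly_eval F (\<phi> u) = 0"
      then have "proj_zeros e {F} \<in> \<F>" unfolding \<F>_def by blast
      then have "\<Lambda> \<in> proj_zeros e {F}" using \<Lambda> by blast
      then show "vanishes_at e F \<Lambda>" by (simp add: proj_zeros_def)
    qed
  qed
  ultimately have "closedin (proj_zariski e) (\<Inter>\<F>)" and "?W = \<Inter>\<F> \<inter> Z" .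
  then show "closedin ?X ?W" unfolding closedin_subtopology by blast
  have WZ: "?W \<subseteq> Z" by (auto simp: param_closure_def)
  fix B C assume BC: "closedin ?X B \<and> closedin ?X C \<and> ?W = B \<union> C"
  have separate: "\<exists>F k u. F \<in> cpoly_ring V \<and> homogeneous k F \<and> (\<forall>\<Lambda>\<in>B. vanishes_at e F \<Lambda>) \<and>
      (\<forall>i. i \<notin> A \<longrightarrow> u i = 0) \<and> cpoly_eval F (\<phi> u) \<noteq> 0" if B: "closedin ?X B" "?W \<noteq> B" "B \<subseteq> ?W" for B
  proof -
    obtain \<Lambda> where \<Lambda>: "\<Lambda> \<in> ?W" "\<Lambda> \<notin> B" using B by blast
    then have "\<Lambda> \<in> Z" using WZ by blast
    then obtain F k where F: "F \<in> cpoly_ring V" "homogeneous k F" "\<not> vanishes_at e F \<Lambda>"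
        "\<forall>\<Lambda>\<in>B. vanishes_at e F \<Lambda>"
      using closed_separation[OF Z_projective B(1) _ \<Lambda>(2)] by blast
    then have "\<not> (\<forall>u. (\<forall>i. i \<notin> A \<longrightarrow> u i = 0) \<longrightarrow> cpoly_eval F (\<phi> u) = 0)"
      using \<Lambda>(1) unfolding param_closure_def by blast
    then show ?thesis using F by blast
  qed
  show "?W = B \<or> ?W = C"
  proof (rule ccontr)
    assume contra: "\<not> (?W = B \<or> ?W = C)"
    obtain F k a where F: "F \<in> cpoly_ring V" "homogeneous k F" "\<forall>\<Lambda>\<in>B. vanishes_at e F \<Lambda>"
        "\<forall>i. i \<notin> A \<longrightarrow> a i = 0" "cpoly_eval F (\<phi> a) \<noteq> 0"
      using separate[of B] BC contra by blast
    obtain G l b where G: "G \<in> cpoly_ring V" "homogeneous l G" "\<forall>\<Lambda>\<in>C. vanishes_at e G \<Lambda>"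
        "\<forall>i. i \<notin> A \<longrightarrow> b i = 0" "cpoly_eval G (\<phi> b) \<noteq> 0"
      using separate[of C] BC contra by blast
    obtain u where u: "\<forall>i. i \<notin> A \<longrightarrow> u i = 0" "cpoly_eval F (\<phi> u) \<noteq> 0" "cpoly_eval G (\<phi> u) \<noteq> 0"
      using \<phi>_common_nonzero[OF F(5) G(5), of A] F(4) G(4) by blast
    \<comment> \<open>The zero vector would define no point. It is ruled out because it lies on
      every line of the nonempty set \<open>B\<close>, so that \<open>F\<close> vanishes at
      it.\<close>
    have "vector (\<phi> u) \<noteq> 0"
    proof
      assume zero: "vector (\<phi> u) = 0"
      have "B \<noteq> {}" using BC contra by blast
      then obtain \<Lambda> where \<Lambda>: "\<Lambda> \<in> B" by blast
      then have "\<Lambda> \<in> projective_space" using BC WZ Z_projective by blast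
      then have "0 \<in> \<Lambda>" by (auto simp: grassmannian_def vec.subspace_def)
      then have "cpoly_eval F (coord e (vector (\<phi> u))) = 0"
        using F(3) \<Lambda> by (simp add: zero vanishes_at_def)
      then show False using u(2) coord_vector_eval[OF F(1)] by simp
    qed
    then have "vec.span {vector (\<phi> u)} \<in> B \<union> C"
      using param_closure_line[of A u] u(1) BC by blast
    moreover have "\<not> vanishes_at e F (vec.span {vector (\<phi> u)})"
      using vanishes_at_line[OF F(2)] coord_vector_eval[OF F(1)] u(2) by simp
    moreover have "\<not> vanishes_at e G (vec.span {vector (\<phi> u)})"
      using vanishes_at_line[OF G(2)] coord_vector_eval[OF G(1)] u(3) by simp
    ultimately show False using F(3) G(3) by blast
  qed
qed

lemma \<phi>_coordinate_zero:
  assumes "i \<in> S" "u i = 0"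
  shows "\<phi> u i = 0"
  using assms by (auto simp: \<phi>_def S_def)

text \<open>For \<open>i\<close> in \<open>R j\<close> the value of \<open>\<phi>\<close> carries
  the factor \<open>u (y j)\<close>, which is 1 only if \<open>y j\<close> belongs to
  \<open>A\<close>; hence the last assumption.\<close>

lemma \<phi>_indicator:
  assumes "i \<in> S" "i \<in> A" "i \<in> y ` J \<or> y ` J \<subseteq> A"
  shows "\<phi> (\<lambda>i. if i \<in> A then 1 else 0) i = 1"
proof -
  consider "i \<in> y ` J" | j where "j \<in> J" "i \<in> R j" "i \<notin> y ` J" | "i \<notin> y ` J" "\<forall>j\<in>J. i \<notin> R j" by blast
  then show ?thesis
  proof cases
    case 2
    then show ?thesis using \<phi>_R[OF 2(1,2)] assms by auto
  qed (use assms in \<open>auto simp: \<phi>_def S_def\<close>)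
qed

text \<open>The supports grow by one variable of \<open>S\<close> at a time. The new coordinate
  vanishes on the previous closure but not at the image of the new indicator vector. The variables
  \<open>y j\<close> come first in the list, since a variable in \<open>R j\<close> stays invisible
  as long as \<open>u (y j) = 0\<close>.\<close>

lemma krull_lower_bound: "has_irreducible_chain (subtopology (proj_zariski e) Z) (card S - 1)"
proof -
  obtain ys where ys: "set ys = y ` J" "distinct ys"
    using finite_distinct_list[of "y ` J"] finite_J by auto
  obtain ws where ws: "set ws = S - y ` J" "distinct ws"
    using finite_distinct_list[of "S - y ` J"] finite_S by auto
  define xs where "xs = ys @ ws"
  have xs: "set xs = S" "distinct xs" "length xs = card S"
  proof -
    show "set xs = S" "distinct xs" using ys ws y_in_S by (auto simp: xs_def)
    then show "length xs = card S" using distinct_card by fastforce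
  qed
  \<comment> \<open>With \<open>Suc k\<close> variables already \<open>A 0\<close> yields a point of
    projective space, and the chain ends at \<open>k = card S - 1\<close>.\<close>
  define A where "A k = set (take (Suc k) xs)" for k
  have A_nth: "xs ! k \<in> A k" if "k < card S" for k
    using that xs(3) by (auto simp: A_def take_Suc_conv_app_nth)
  have A_y: "xs ! k \<in> y ` J \<or> y ` J \<subseteq> A k" if "k < card S" for k
  proof (cases "k < length ys")
    case True
    then show ?thesis using ys by (auto simp: xs_def nth_append)
  next
    case False
    then show ?thesis using ys by (auto simp: xs_def A_def)
  qed
  define W where "W k = param_closure (A k)" for k
  define u :: "nat \<Rightarrow> nat \<Rightarrow> complex" where "u k = (\<lambda>i. if i \<in> A k then 1 else 0)" for k
  have point: "vec.span {vector (\<phi> (u k))} \<in> W k" "\<phi> (u k) (xs ! k) = 1" if "k < card S" for k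
  proof -
    have S: "xs ! k \<in> S" using that xs by (metis nth_mem)
    then show one: "\<phi> (u k) (xs ! k) = 1"
      unfolding u_def by (rule \<phi>_indicator[OF _ A_nth[OF that] A_y[OF that]])
    have "xs ! k \<in> V" using S by (auto simp: S_def)
    then have "vector (\<phi> (u k)) \<noteq> 0" using one vector_0_iff[of "\<phi> (u k)"] by auto
    then show "vec.span {vector (\<phi> (u k))} \<in> W k"
      unfolding W_def by (intro param_closure_line) (auto simp: u_def)
  qed
  have "W k \<subset> W (Suc k)" if "k < card S - 1" for k
  proof
    have "A k \<subseteq> A (Suc k)" unfolding A_def by (rule set_take_subset_set_take) simp
    then show "W k \<subseteq> W (Suc k)"
      unfolding W_def by (rule param_closure_mono)
    let ?i = "xs ! Suc k"
    have k: "Suc k < card S" using that by simp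
    then have S: "?i \<in> S" using xs by (metis nth_mem)
    then have V: "?i \<in> V" by (auto simp: S_def)
    have "?i \<notin> A k"
      using k xs by (auto simp: A_def in_set_conv_nth nth_eq_iff_index_eq)
    then have "vanishes_at e (cpoly_var ?i) \<Lambda>" if "\<Lambda> \<in> W k" for \<Lambda>
      using param_closure_vanishes[OF that[unfolded W_def] cpoly_ring_var[OF V] homogeneous_var]
        \<phi>_coordinate_zero[OF S] \<open>?i \<notin> A k\<close> by simp
    moreover have "\<not> vanishes_at e (cpoly_var ?i) (vec.span {vector (\<phi> (u (Suc k)))})"
      using point(2)[OF k] vanishes_at_line[OF homogeneous_var] coord_vector[OF V] by simp
    ultimately show "W k \<noteq> W (Suc k)" using point(1)[OF k] by blast
  qed
  moreover have "irreducible_closed (subtopology (proj_zariski e) Z) (W k)" if "k \<le> card S - 1" for k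
  proof -
    have "k < card S" using that S_nonempty finite_S card_gt_0_iff[of S] by linarith
    then have "param_closure (A k) \<noteq> {}"
      using point(1)[of k] unfolding W_def by blast
    then show ?thesis unfolding W_def by (rule param_closure_irreducible)
  qed
  ultimately show ?thesis
    unfolding has_irreducible_chain_def by blast
qed

lemma Z_nonempty: "Z \<noteq> {}"
proof -
  obtain W where "irreducible_closed (subtopology (proj_zariski e) Z) (W (0 :: nat))"
    using krull_lower_bound by (auto simp: has_irreducible_chain_def)
  then show ?thesis
    using closedin_subset[of "subtopology (proj_zariski e) Z" "W 0"] by (auto simp: irreducible_closed_def)
qed

text \<open>The codimension is compared with the size of a set, so distinct indices must give
  distinct generators. At the indicator vector of \<open>y j\<close> and \<open>z j\<close> the
  quadric \<open>q k\<close> is 1 if \<open>k = j\<close> and 0 otherwise, and all variables in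
  \<open>L\<close> vanish.\<close>

lemma card_gens: "card gens = card J + card L"
proof -
  have q_eval: "cpoly_eval (q k) (\<lambda>i. if i = y j \<or> i = z j then 1 else 0) = (if j = k then 1 else 0)"
    if "j \<in> J" "k \<in> J" for j k
  proof -
    let ?a = "\<lambda>i. if i = y j \<or> i = z j then 1 else (0 :: complex)"
    have "cpoly_eval (r k) ?a = cpoly_eval (r k) (\<lambda>i. 0 * ?a i)"
    proof (rule r_eval_cong[OF that(2)])
      fix i assume "i \<in> R k"
      then have "i \<notin> y ` J" "i \<notin> z ` J" using R_in[OF that(2)] by blast+
      then have "i \<noteq> y j" "i \<noteq> z j" using that(1) by blast+
      then show "?a i = 0 * ?a i" by simp
    qed
    also have "\<dots> = 0" using cpoly_eval_homogeneous[OF r_homogeneous[OF that(2)], of 0 ?a] by simp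
    finally have "cpoly_eval (r k) ?a = 0" .
    moreover have "y k \<noteq> z j" "z k \<noteq> y j" using that y_z_disjoint by blast+
    moreover have "y k = y j \<longleftrightarrow> k = j" using that inj_y by (auto dest: inj_onD)
    ultimately show ?thesis by (auto simp: q_def)
  qed
  have "inj_on q J"
  proof (rule inj_onI)
    fix j k assume jk: "j \<in> J" "k \<in> J" "q j = q k"
    have "(1 :: complex) = (if j = k then 1 else 0)"
      using q_eval[OF jk(1) jk(1)] q_eval[OF jk(1,2)] jk(3) by simp
    then show "j = k" by (auto split: if_splits)
  qed
  moreover have "inj_on cpoly_var L"
  proof (rule inj_onI)
    fix c d :: nat assume "(cpoly_var c :: nat cpoly) = cpoly_var d"
    then have "cpoly_eval (cpoly_var c) (\<lambda>i. if i = c then 1 else 0) =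
        cpoly_eval (cpoly_var d) (\<lambda>i. if i = c then 1 else 0)" by simp
    then show "c = d" by (simp split: if_splits)
  qed
  moreover have "q ` J \<inter> cpoly_var ` L = {}"
  proof -
    have False if "j \<in> J" "c \<in> L" "q j = cpoly_var c" for j c
    proof -
      have "c \<noteq> y j" "c \<noteq> z j" using that y_in z_in by blast+
      then show False using q_eval[OF that(1) that(1)] by (simp add: that(3))
    qed
    then show ?thesis by blast
  qed
  ultimately show ?thesis
    using finite_J finite_subset[OF L_subset finite_V]
    by (simp add: gens_def card_Un_disjoint card_image)
qed

lemma homogeneous_ideal_Z: "homogeneous_ideal e Z = cpoly_ideal V gens"
proof -
  let ?I = "{F \<in> cpoly_ring V. (\<exists>k. homogeneous k F) \<and> (\<forall>\<Lambda>\<in>Z. vanishes_at e F \<Lambda>)}"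
  have "?I \<subseteq> cpoly_ideal V gens"
  proof
    fix F assume "F \<in> ?I"
    then obtain k where F: "F \<in> cpoly_ring V" "homogeneous k F" "\<And>\<Lambda>. \<Lambda> \<in> Z \<Longrightarrow> vanishes_at e F \<Lambda>"
      by blast
    have "cpoly_eval F a = 0" if "a \<in> cone" for a
    proof -
      have "cpoly_eval F (coord e (vector a)) = 0"
      proof (cases "vector a = 0")
        case True
        \<comment> \<open>The apex of the cone is not a point of \<open>Z\<close>, but it lies on
          every line in \<open>Z\<close>. This excludes nonzero constants, and fails for empty
          \<open>Z\<close>.\<close>
        obtain \<Lambda> where "\<Lambda> \<in> Z" using Z_nonempty by blast
        moreover then have "0 \<in> \<Lambda>"
          using Z_projective by (auto simp: grassmannian_def vec.subspace_def)
        ultimately show ?thesis using F(3) by (auto simp: True vanishes_at_def)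
      next
        case False
        then show ?thesis using F(3)[OF line_in_Z[OF that]] vanishes_at_line[OF F(2)] by blast
      qed
      then show ?thesis using coord_vector_eval[OF F(1)] by simp
    qed
    then show "F \<in> cpoly_ideal V gens" by (rule vanishing_in_ideal[OF F(1,2)])
  qed
  moreover have "gens \<subseteq> ?I"
    using gens_ring gens_homogeneous by (auto simp: Z_def proj_zeros_def)
  then have "gens \<subseteq> cpoly_ideal V ?I"
    using cpoly_ideal_gen by blast
  ultimately show ?thesis
    unfolding homogeneous_ideal_def V_eq[symmetric] by (intro equalityI cpoly_ideal_subset)
qed

theorem complete_intersection: "complete_intersection_cut_out_by e Z gens"
proof -
  have "has_krull_dim (subtopology (proj_zariski e) Z) (card S - 1)"
    unfolding has_krull_dim_def using krull_lower_bound krull_upper_bound by blast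
  moreover have "card S - 1 + card gens = CARD('n) - 1"
  proof -
    have "card (V - L) = card S + card (z ` J)"
      using z_in finite_J finite_S unfolding S_def
      by (subst card_Un_disjoint[symmetric]) (auto intro: arg_cong[where f = card])
    moreover have "card (z ` J) = card J" by (rule card_image[OF inj_z])
    moreover have "card V = card (V - L) + card L"
      using L_subset by (metis card_Diff_subset card_mono finite_V finite_subset le_add_diff_inverse2)
    moreover have "card V = CARD('n)" by (simp add: V_eq)
    moreover have "card S > 0" using S_nonempty finite_S by (simp add: card_gt_0_iff)
    ultimately show ?thesis by (simp add: card_gens)
  qed
  ultimately show ?thesis
    unfolding complete_intersection_cut_out_by_def
    using finite_gens gens_ring homogeneous_ideal_Z by (auto simp: V_eq)
qed

end

section \<open>Cuts in terms of counting functions\<close>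

abbreviation count_upto :: "nat set \<Rightarrow> nat \<Rightarrow> nat" where
  "count_upto A c \<equiv> card (A \<inter> {1..c})"

lemma count_upto_Suc:
  "count_upto A (Suc c) = count_upto A c + (if Suc c \<in> A then 1 else 0)"
proof (cases "Suc c \<in> A")
  case True
  then have "A \<inter> {1..Suc c} = insert (Suc c) (A \<inter> {1..c})" by (auto simp: le_Suc_eq)
  then show ?thesis using True by simp
next
  case False
  then have "A \<inter> {1..Suc c} = A \<inter> {1..c}" by (auto simp: le_Suc_eq)
  then show ?thesis using False by simp
qed

lemma count_upto_step:
  "1 \<le> c \<Longrightarrow> count_upto A c = count_upto A (c - 1) + (if c \<in> A then 1 else 0)"
  using count_upto_Suc[of A "c - 1"] by simp

lemma nth_sorted_list_le_iff:
  fixes A :: "nat set"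
  assumes "finite A" "j < card A"
  shows "sorted_list_of_set A ! j \<le> c \<longleftrightarrow> j < card {x \<in> A. x \<le> c}"
proof
  let ?xs = "sorted_list_of_set A"
  have len: "length ?xs = card A" and set: "set ?xs = A" and dist: "distinct ?xs" and sorted: "sorted ?xs"
    using assms(1) by auto
  {
    assume le: "?xs ! j \<le> c"
    have "(\<lambda>k. ?xs ! k) ` {..j} \<subseteq> {x \<in> A. x \<le> c}"
    proof
      fix x assume "x \<in> (\<lambda>k. ?xs ! k) ` {..j}"
      then obtain k where k: "k \<le> j" "x = ?xs ! k" by auto
      then have "x \<le> ?xs ! j" using sorted_nth_mono[OF sorted, of k j] assms len by simp
      moreover have "x \<in> A" using k assms len set nth_mem[of k ?xs] by simp
      ultimately show "x \<in> {x \<in> A. x \<le> c}" using le by simp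
    qed
    then have "card ((\<lambda>k. ?xs ! k) ` {..j}) \<le> card {x \<in> A. x \<le> c}"
      using assms(1) by (intro card_mono) auto
    moreover have "inj_on (\<lambda>k. ?xs ! k) {..j}"
      using dist assms(2) len by (auto simp: inj_on_def nth_eq_iff_index_eq)
    then have "card ((\<lambda>k. ?xs ! k) ` {..j}) = Suc j" by (simp add: card_image)
    ultimately show "j < card {x \<in> A. x \<le> c}" by simp
  }
  {
    assume less: "j < card {x \<in> A. x \<le> c}"
    show "?xs ! j \<le> c"
    proof (rule ccontr)
      assume "\<not> ?xs ! j \<le> c"
      have "{x \<in> A. x \<le> c} \<subseteq> (\<lambda>k. ?xs ! k) ` {..<j}"
      proof
        fix x assume x: "x \<in> {x \<in> A. x \<le> c}"
        then obtain k where k: "k < card A" "x = ?xs ! k"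
          using set len by (metis (no_types, lifting) in_set_conv_nth mem_Collect_eq)
        have "k < j"
        proof (rule ccontr)
          assume "\<not> k < j"
          then have "?xs ! j \<le> x" using sorted_nth_mono[OF sorted, of j k] k len by simp
          then show False using x \<open>\<not> ?xs ! j \<le> c\<close> by simp
        qed
        then show "x \<in> (\<lambda>k. ?xs ! k) ` {..<j}" using k(2) by blast
      qed
      then have "card {x \<in> A. x \<le> c} \<le> card ((\<lambda>k. ?xs ! k) ` {..<j})"
        by (intro card_mono) auto
      also have "\<dots> \<le> j" using card_image_le[of "{..<j}" "\<lambda>k. ?xs ! k"] by simp
      finally show False using less by simp
    qed
  }
qed

text \<open>Enumeration and counting function form a Galois connection. The bound
  \<open>c \<le> N\<close> makes the default entry \<open>N + 1\<close> count as larger than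
  \<open>c\<close>.\<close>

lemma entry_le_iff:
  assumes "A \<subseteq> {1..N}" "c \<le> N"
  shows "entry N A i \<le> c \<longleftrightarrow> i \<le> count_upto A c"
proof -
  have fin: "finite A" using assms(1) finite_subset by blast
  have eq: "A \<inter> {1..c} = {x \<in> A. x \<le> c}" using assms(1) by auto
  consider "i = 0" | "1 \<le> i" "i \<le> card A" | "i > card A" by linarith
  then show ?thesis
  proof cases
    case 2
    then have "entry N A i \<le> c \<longleftrightarrow> i - 1 < card {x \<in> A. x \<le> c}"
      using nth_sorted_list_le_iff[OF fin, of "i - 1" c] by (simp add: entry_def)
    then show ?thesis unfolding eq using 2 by auto
  next
    case 3
    then show ?thesis
      using assms(2) card_mono[OF fin, of "A \<inter> {1..c}"] by (simp add: entry_def)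
  qed (simp add: entry_def)
qed

lemma entry_eq_iff:
  assumes "A \<subseteq> {1..N}" "1 \<le> c" "c \<le> N" "1 \<le> i"
  shows "entry N A i = c \<longleftrightarrow> c \<in> A \<and> i = count_upto A c"
proof -
  have "entry N A i = c \<longleftrightarrow> entry N A i \<le> c \<and> \<not> entry N A i \<le> c - 1" using assms(2) by auto
  also have "\<dots> \<longleftrightarrow> i \<le> count_upto A c \<and> \<not> i \<le> count_upto A (c - 1)"
    using entry_le_iff[OF assms(1)] assms by simp
  also have "\<dots> \<longleftrightarrow> c \<in> A \<and> i = count_upto A c"
    using count_upto_step[OF assms(2), of A] by auto
  finally show ?thesis .
qed

text \<open>\<open>count_le\<close> is \<open>T \<le> P\<close> in terms of counting functions. The
  geometric relation \<open>T \<preceq> P\<close> is not part of the locale, so \<open>L\<close> may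
  still contain all variables here.\<close>

locale symbol_pair =
  fixes \<tau> :: lie_type and N n m :: nat and P T :: "nat set"
  assumes P_symbol: "P \<in> schubert_symbols N m" and T_symbol: "T \<in> schubert_symbols N m"
    and N_eq: "N = (case \<tau> of Type_B \<Rightarrow> 2 * n + 1 | Type_C \<Rightarrow> 2 * n | Type_D \<Rightarrow> 2 * n + 2)"
    and m_pos: "1 \<le> m"
    and count_le: "count_upto P c \<le> count_upto T c"
begin

abbreviation "p \<equiv> count_upto P"
abbreviation "t \<equiv> count_upto T"

lemma P_sub: "P \<subseteq> {1..N}" and T_sub: "T \<subseteq> {1..N}" and card_P: "card P = m" and card_T: "card T = m"
  using P_symbol T_symbol by (auto simp: schubert_symbols_def)

lemma P_mirror: "c \<in> P \<Longrightarrow> N + 1 - c \<notin> P"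
proof
  assume "c \<in> P" "N + 1 - c \<in> P"
  then have "c + (N + 1 - c) \<noteq> N + 1" using P_symbol unfolding schubert_symbols_def by blast
  then show False using P_sub \<open>c \<in> P\<close> by auto
qed

lemma T_mirror: "c \<in> T \<Longrightarrow> N + 1 - c \<notin> T"
proof
  assume "c \<in> T" "N + 1 - c \<in> T"
  then have "c + (N + 1 - c) \<noteq> N + 1" using T_symbol unfolding schubert_symbols_def by blast
  then show False using T_sub \<open>c \<in> T\<close> by auto
qed

lemma p_step: "1 \<le> c \<Longrightarrow> p c = p (c - 1) + (if c \<in> P then 1 else 0)"
  and t_step: "1 \<le> c \<Longrightarrow> t c = t (c - 1) + (if c \<in> T then 1 else 0)"
  using count_upto_step by auto

lemma p_le_m: "p c \<le> m" and t_le_m: "t c \<le> m"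
  using card_mono[of P "P \<inter> {1..c}"] card_mono[of T "T \<inter> {1..c}"] P_sub T_sub card_P card_T
  by (auto intro: finite_subset)

text \<open>An index \<open>i\<close> witnesses the cut iff \<open>t c \<le> i \<le> p c\<close>. By
  \<open>count_le\<close> a visible cut is thus a column where the two counts agree.\<close>

lemma visible_iff: "c \<in> visible_cuts N P T \<longleftrightarrow> c \<le> N \<and> t c \<le> p c"
proof -
  have "(\<exists>i\<in>{0..card P}. entry N P i \<le> c \<and> c < entry N T (i + 1)) \<longleftrightarrow> t c \<le> p c" if c: "c \<le> N"
  proof -
    have "entry N P i \<le> c \<and> c < entry N T (i + 1) \<longleftrightarrow> i \<le> p c \<and> t c \<le> i" for i
      using entry_le_iff[OF P_sub c, of i] entry_le_iff[OF T_sub c, of "i + 1"] by linarith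
    then have "(\<exists>i\<in>{0..card P}. entry N P i \<le> c \<and> c < entry N T (i + 1)) \<longleftrightarrow>
        (\<exists>i\<in>{0..card P}. i \<le> p c \<and> t c \<le> i)"
      by (intro bex_cong refl)
    also have "\<dots> \<longleftrightarrow> t c \<le> p c"
      using p_le_m[of c] card_P by (auto intro: bexI[of _ "p c"])
    finally show ?thesis .
  qed
  then show ?thesis by (auto simp: visible_cuts_def)
qed

text \<open>By \<open>count_le\<close> the inequality means that the counts agree at
  \<open>c - 1\<close> and at \<open>c\<close> and that \<open>c\<close> lies in neither
  symbol.\<close>

lemma zero_column_iff: "1 \<le> c \<Longrightarrow> c \<le> N \<Longrightarrow> zero_column N P T c \<longleftrightarrow> t c \<le> p (c - 1)"
proof -
  assume c: "1 \<le> c" "c \<le> N"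
  have "entry N P i < c \<longleftrightarrow> entry N P i \<le> c - 1" for i using c by linarith
  then have "entry N P i < c \<and> c < entry N T (i + 1) \<longleftrightarrow> i \<le> p (c - 1) \<and> t c \<le> i" for i
    using entry_le_iff[OF P_sub, of "c - 1" i] entry_le_iff[OF T_sub c(2), of "i + 1"] c by linarith
  then have "zero_column N P T c \<longleftrightarrow> (\<exists>i\<in>{0..card P}. i \<le> p (c - 1) \<and> t c \<le> i)"
    unfolding zero_column_def by (intro bex_cong refl)
  also have "\<dots> \<longleftrightarrow> t c \<le> p (c - 1)"
    using p_le_m[of "c - 1"] card_P by (auto intro: bexI[of _ "p (c - 1)"])
  finally show ?thesis .
qed

text \<open>The index in the definition is forced: it is the position of \<open>n + 2\<close> in
  \<open>P\<close>, or that of \<open>n + 1\<close> in \<open>T\<close>, and in the second case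
  \<open>i - 1 = t n\<close>.\<close>

lemma middle_iff:
  assumes "N = 2 * n + 2"
  shows "c \<in> middle_exceptional_cuts N n P T \<longleftrightarrow> c = n + 1 \<and>
    (n + 2 \<in> P \<and> t (n + 1) \<le> p (n + 2) \<or> n + 1 \<in> T \<and> t n \<le> p (n + 1))"
proof -
  have n: "n + 2 \<le> N" "n + 1 \<le> N" using assms by auto
  have first: "(entry N P i = n + 2 \<and> n + 2 \<le> entry N T (i + 1)) \<longleftrightarrow>
      n + 2 \<in> P \<and> i = p (n + 2) \<and> t (n + 1) \<le> i" if i: "1 \<le> i" for i
  proof -
    have "n + 2 \<le> entry N T (i + 1) \<longleftrightarrow> \<not> entry N T (i + 1) \<le> n + 1" by auto
    then show ?thesis
      using entry_eq_iff[OF P_sub _ n(1) i] entry_le_iff[OF T_sub n(2), of "i + 1"] by auto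
  qed
  have second: "(entry N T i = n + 1 \<and> entry N P (i - 1) \<le> n + 1) \<longleftrightarrow>
      n + 1 \<in> T \<and> i = t (n + 1) \<and> i - 1 \<le> p (n + 1)" if i: "1 \<le> i" for i
    using entry_eq_iff[OF T_sub _ n(2) i] entry_le_iff[OF P_sub n(2), of "i - 1"] by auto
  have ps: "p (n + 2) \<ge> 1" if "n + 2 \<in> P" using p_step[of "n + 2"] that by simp
  have ts: "t (n + 1) = t n + 1" if "n + 1 \<in> T" using t_step[of "n + 1"] that by simp
  have "(\<exists>i\<in>{1..card P}. (entry N P i = n + 2 \<and> n + 2 \<le> entry N T (i + 1)) \<or>
      (entry N T i = n + 1 \<and> entry N P (i - 1) \<le> n + 1)) \<longleftrightarrow>
      (\<exists>i\<in>{1..m}. n + 2 \<in> P \<and> i = p (n + 2) \<and> t (n + 1) \<le> i \<or>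
        n + 1 \<in> T \<and> i = t (n + 1) \<and> i - 1 \<le> p (n + 1))"
    using first second card_P by (intro bex_cong) auto
  also have "\<dots> \<longleftrightarrow> (n + 2 \<in> P \<and> t (n + 1) \<le> p (n + 2) \<or> n + 1 \<in> T \<and> t n \<le> p (n + 1))"
    using ps ts p_le_m[of "n + 2"] t_le_m[of "n + 1"] by auto
  finally show ?thesis by (simp add: middle_exceptional_cuts_def)
qed

text \<open>The condition \<open>[c + 1, n + 1] \<subseteq> [P] \<inter> [T]\<close> of the
  exceptional cuts, in a form suited to changing \<open>c\<close> by one. It is vacuous for
  \<open>c > n\<close>.\<close>

definition closed :: "nat \<Rightarrow> bool" where
  "closed c \<longleftrightarrow> (\<forall>k\<in>{c + 1..n + 1}. (k \<in> P \<or> N + 1 - k \<in> P) \<and> (k \<in> T \<or> N + 1 - k \<in> T))"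

text \<open>For \<open>c \<le> n\<close>, \<open>closed c\<close> puts \<open>n + 1\<close> into
  both \<open>[P]\<close> and \<open>[T]\<close>. Then neither type is 2, and the types differ iff
  \<open>t (n + 1) + p (n + 1)\<close> is odd.\<close>

definition exceptional :: "nat \<Rightarrow> bool" where
  "exceptional c \<longleftrightarrow> 1 \<le> c \<and> c \<le> n \<and> odd (t (n + 1) + p (n + 1)) \<and> closed c \<and> t c = p c + 1"

lemma exceptional_le: "exceptional c \<Longrightarrow> c \<le> n"
  unfolding exceptional_def by blast

lemma closed_step: "1 \<le> c \<Longrightarrow> closed (c - 1) \<longleftrightarrow>
    closed c \<and> (c \<le> n + 1 \<longrightarrow> (c \<in> P \<or> N + 1 - c \<in> P) \<and> (c \<in> T \<or> N + 1 - c \<in> T))"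
proof -
  assume "1 \<le> c"
  then have "{c - 1 + 1..n + 1} = (if c \<le> n + 1 then insert c {c + 1..n + 1} else {c + 1..n + 1})" by auto
  then show ?thesis by (auto simp: closed_def)
qed

lemma parity_exceptional_iff:
  assumes N: "N = 2 * n + 2"
  shows "c \<in> parity_exceptional_cuts N n P T \<longleftrightarrow> c \<le> N \<and> (exceptional c \<or> exceptional (N - c))"
proof -
  have diff: "card ({1..n + 1} - A) = n + 1 - count_upto A (n + 1)" for A
    by (simp add: card_Diff_subset_Int Int_commute)
  have le: "count_upto A (n + 1) \<le> n + 1" for A
    using card_mono[of "{1..n + 1}" "A \<inter> {1..n + 1}"] by simp
  have sub: "{c + 1..n + 1} \<subseteq> sym_closure N P \<inter> sym_closure N T \<longleftrightarrow> closed c" for c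
  proof -
    have "k \<in> sym_closure N A \<longleftrightarrow> k \<in> A \<or> N + 1 - k \<in> A" if "k \<in> {c + 1..n + 1}" for k A
      using that N by (simp add: sym_closure_def)
    then have "(\<forall>k\<in>{c + 1..n + 1}. k \<in> sym_closure N P \<inter> sym_closure N T) \<longleftrightarrow> closed c"
      unfolding closed_def by (intro ball_cong refl) blast
    then show ?thesis unfolding subset_iff by blast
  qed
  have par: "type_parity N n T \<noteq> type_parity N n P \<longleftrightarrow> odd (t (n + 1) + p (n + 1))" if "closed c" "c \<le> n" for c
  proof -
    have "{c + 1..n + 1} \<subseteq> sym_closure N P \<inter> sym_closure N T"
      using sub that(1) by blast
    moreover have "n + 1 \<in> {c + 1..n + 1}" using that(2) by simp
    ultimately have "n + 1 \<in> sym_closure N P" "n + 1 \<in> sym_closure N T" by blast+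
    then have "type_parity N n T \<noteq> type_parity N n P \<longleftrightarrow>
        (n + 1 - t (n + 1)) mod 2 \<noteq> (n + 1 - p (n + 1)) mod 2"
      by (simp only: type_parity_def diff if_True)
    also have "\<dots> \<longleftrightarrow> odd (t (n + 1) + p (n + 1))"
    proof -
      have "(x - a) mod 2 \<noteq> (x - b) mod 2 \<longleftrightarrow> odd (a + b)" if "a \<le> x" "b \<le> x" for x a b :: nat
      proof -
        obtain k where k: "x = a + k" using le_Suc_ex[OF \<open>a \<le> x\<close>] by blast
        obtain l where l: "x = b + l" using le_Suc_ex[OF \<open>b \<le> x\<close>] by blast
        have "k mod 2 \<noteq> l mod 2 \<longleftrightarrow> odd (k + l)" by presburger
        moreover have "even (a + b) \<longleftrightarrow> even (k + l)" using k l by presburger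
        moreover have "x - a = k" "x - b = l" using k l by simp_all
        ultimately show ?thesis by simp
      qed
      then show ?thesis using le by blast
    qed
    finally show ?thesis .
  qed
  have "d \<in> {1..n} \<and> type_parity N n T \<noteq> type_parity N n P \<and>
      {d + 1..n + 1} \<subseteq> sym_closure N P \<inter> sym_closure N T \<and> t d = p d + 1 \<longleftrightarrow> exceptional d" for d
    unfolding exceptional_def sub atLeastAtMost_iff using par[of d] by blast
  then have "c \<in> parity_exceptional_cuts N n P T \<longleftrightarrow> (\<exists>d. exceptional d \<and> (c = d \<or> c = N - d))"
    unfolding parity_exceptional_cuts_def by blast
  also have "\<dots> \<longleftrightarrow> c \<le> N \<and> (exceptional c \<or> exceptional (N - c))"
  proof
    assume "\<exists>d. exceptional d \<and> (c = d \<or> c = N - d)"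
    then obtain d where d: "exceptional d" "c = d \<or> c = N - d" by blast
    have "d \<le> N" using N exceptional_le[OF d(1)] by linarith
    then have "N - (N - d) = d" "N - d \<le> N" by simp_all
    then show "c \<le> N \<and> (exceptional c \<or> exceptional (N - c))" using d \<open>d \<le> N\<close> by metis
  next
    assume c: "c \<le> N \<and> (exceptional c \<or> exceptional (N - c))"
    then have "c = N - (N - c)" by simp
    then show "\<exists>d. exceptional d \<and> (c = d \<or> c = N - d)" using c by blast
  qed
  finally show ?thesis .
qed

section \<open>Cuts, their mirror symmetry, and the passage to neighbouring columns\<close>

abbreviation "C \<equiv> cuts \<tau> N n P T"
abbreviation "L \<equiv> L_set \<tau> N n P T"
abbreviation "Q \<equiv> Q_set \<tau> N n P T"

definition mid :: bool where
  "mid \<longleftrightarrow> n + 2 \<in> P \<and> t (n + 1) \<le> p (n + 2) \<or> n + 1 \<in> T \<and> t n \<le> p (n + 1)"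

lemma cuts_iff: "c \<in> C \<longleftrightarrow> c \<le> N \<and> (t c \<le> p c \<or> t (N - c) \<le> p (N - c) \<or>
    \<tau> = Type_D \<and> (c = n + 1 \<and> mid \<or> exceptional c \<or> exceptional (N - c)))"
proof (cases "\<tau> = Type_D")
  case True
  then have N: "N = 2 * n + 2" using N_eq by simp
  have "c \<in> C \<longleftrightarrow> c \<in> apparent_cuts N P T \<or>
      c \<in> middle_exceptional_cuts N n P T \<or> c \<in> parity_exceptional_cuts N n P T"
    using True by (simp add: cuts_def)
  moreover have "c \<in> apparent_cuts N P T \<longleftrightarrow> c \<le> N \<and> (t c \<le> p c \<or> t (N - c) \<le> p (N - c))"
    by (auto simp: apparent_cuts_def visible_iff)
  moreover have "c = n + 1 \<Longrightarrow> c \<le> N" using N by linarith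
  ultimately show ?thesis
    using True unfolding middle_iff[OF N] parity_exceptional_iff[OF N] mid_def by blast
qed (auto simp: cuts_def apparent_cuts_def visible_iff)

lemma N_D: "\<tau> = Type_D \<Longrightarrow> N = 2 * n + 2"
  using N_eq by simp

lemma cuts_mirror:
  assumes "c \<le> N"
  shows "N - c \<in> C \<longleftrightarrow> c \<in> C"
proof -
  have "N - (N - c) = c" "N - c \<le> N" using assms by simp_all
  moreover have "N - c = n + 1 \<longleftrightarrow> c = n + 1" if "\<tau> = Type_D"
    using N_D[OF that] assms by linarith
  ultimately show ?thesis
    using assms unfolding cuts_iff by metis
qed

text \<open>In type D the middle column always bounds a quadric, whether or not it is a cut.\<close>

definition C' :: "nat set" where
  "C' = C \<union> (if \<tau> = Type_D then {n + 1} else {})"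

lemma visible_C':
  assumes "c \<le> N" "t c \<le> p c"
  shows "c \<in> C'"
  using assms by (simp add: C'_def cuts_iff)

lemma visible_mirror_C':
  assumes "c \<le> N" "t (N - c) \<le> p (N - c)"
  shows "c \<in> C'"
  using assms by (simp add: C'_def cuts_iff)

lemma C'_D: "\<tau> = Type_D \<Longrightarrow> c \<in> C' \<longleftrightarrow> c \<in> C \<or> c = n + 1"
  unfolding C'_def by auto

lemma C'_not_D: "\<tau> \<noteq> Type_D \<Longrightarrow> c \<in> C' \<longleftrightarrow> c \<in> C"
  unfolding C'_def by simp

lemma exceptional_C':
  assumes "\<tau> = Type_D" "exceptional c"
  shows "c \<in> C'"
proof -
  have "c \<le> N" using N_D[OF assms(1)] exceptional_le[OF assms(2)] by linarith
  then show ?thesis unfolding C'_D[OF assms(1)] cuts_iff using assms by blast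
qed

lemma C'_mirror:
  assumes "c \<le> N"
  shows "N - c \<in> C' \<longleftrightarrow> c \<in> C'"
proof (cases "\<tau> = Type_D")
  case True
  have "N - c = n + 1 \<longleftrightarrow> c = n + 1" using N_D[OF True] assms by linarith
  then show ?thesis unfolding C'_D[OF True] using cuts_mirror[OF assms] by blast
next
  case False
  show ?thesis unfolding C'_not_D[OF False] by (rule cuts_mirror[OF assms])
qed

lemma L_iff: "c \<in> L \<longleftrightarrow> 1 \<le> c \<and> c \<le> N \<and>
    (t c \<le> p (c - 1) \<or> lone_star \<tau> N n P T (N + 1 - c))"
  using zero_column_iff by (auto simp: L_set_def)

lemma lone_star_L:
  assumes "1 \<le> c" "c \<le> N" "lone_star \<tau> N n P T c"
  shows "N + 1 - c \<in> L"
  using assms by (auto simp: L_iff)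

text \<open>At an exceptional column \<open>T\<close> is ahead of \<open>P\<close> by one, and by
  assumption the lead does not grow at \<open>c + 1\<close>. If it persists, \<open>c + 1\<close> is
  exceptional again, otherwise the counts agree there; for \<open>c = n\<close> the middle column is
  reached, which lies in \<open>C'\<close> in any case.\<close>

lemma exceptional_next:
  assumes "\<tau> = Type_D" "exceptional c" "c + 1 \<in> P \<or> c + 1 \<notin> T"
  shows "c + 1 \<in> C'"
proof (cases "c = n")
  case True
  then show ?thesis unfolding C'_D[OF assms(1)] by simp
next
  case False
  have N: "N = 2 * n + 2" using N_eq assms(1) by simp
  have steps: "p (c + 1) = p c + (if c + 1 \<in> P then 1 else 0)" "t (c + 1) = t c + (if c + 1 \<in> T then 1 else 0)"
    using p_step[of "c + 1"] t_step[of "c + 1"] by auto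
  have c: "1 \<le> c" "c < n" "odd (t (n + 1) + p (n + 1))" "closed (c + 1)" "t c = p c + 1"
    using assms(2) False closed_step[of "c + 1"] by (auto simp: exceptional_def)
  then have "t (c + 1) \<le> p (c + 1) \<or> exceptional (c + 1)"
    using steps assms(3) by (auto simp: exceptional_def)
  moreover have "c + 1 \<le> N" using N c(2) by linarith
  ultimately show ?thesis
    using visible_C' exceptional_C'[OF assms(1)] by blast
qed

text \<open>Of each pair \<open>k\<close>, \<open>N + 1 - k\<close> with \<open>k\<close> in
  \<open>[c + 1, n + 1]\<close> exactly one element lies in \<open>P\<close>, and exactly one in
  \<open>T\<close>. The lead of \<open>T\<close> over \<open>P\<close> is therefore the same at
  \<open>N - c\<close> as at \<open>c\<close>.\<close>

lemma closed_count:
  assumes N: "N = 2 * n + 2" and "closed c" "c \<le> n + 1"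
  shows "p (N - c) = p c + (n + 1 - c) \<and> t (N - c) = t c + (n + 1 - c)"
  using assms(3,2)
proof (induction c rule: inc_induct)
  case base
  then show ?case using N by simp
next
  case (step c)
  have "closed (Suc c)" and c: "(Suc c \<in> P \<or> N + 1 - Suc c \<in> P) \<and> (Suc c \<in> T \<or> N + 1 - Suc c \<in> T)"
    using step closed_step[of "Suc c"] by auto
  then have IH: "p (N - Suc c) = p (Suc c) + (n + 1 - Suc c) \<and> t (N - Suc c) = t (Suc c) + (n + 1 - Suc c)"
    using step by simp
  have eq: "N - c - 1 = N - Suc c" "N + 1 - Suc c = N - c" using step N by auto
  have "p (N - c) = p (N - Suc c) + (if N - c \<in> P then 1 else 0)"
    "t (N - c) = t (N - Suc c) + (if N - c \<in> T then 1 else 0)"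
    using p_step[of "N - c"] t_step[of "N - c"] step N eq by auto
  moreover have "p (Suc c) = p c + (if Suc c \<in> P then 1 else 0)" "t (Suc c) = t c + (if Suc c \<in> T then 1 else 0)"
    using p_step[of "Suc c"] t_step[of "Suc c"] by auto
  moreover have "N - c \<in> P \<longleftrightarrow> Suc c \<notin> P" "N - c \<in> T \<longleftrightarrow> Suc c \<notin> T"
    using c P_mirror[of "Suc c"] T_mirror[of "Suc c"] eq by auto
  then have "(if N - c \<in> P then 1 else 0) + (if Suc c \<in> P then 1 else 0) = (1 :: nat)"
    "(if N - c \<in> T then 1 else 0) + (if Suc c \<in> T then 1 else 0) = (1 :: nat)"
    by simp_all
  moreover have "n + 1 - c = n + 1 - Suc c + 1" using step(2) by simp
  ultimately show ?case using IH by linarith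
qed

text \<open>Going down, the lead of \<open>T\<close> either disappears at \<open>c - 1\<close>, or
  persists there and makes \<open>c - 1\<close> exceptional, or \<open>P\<close> catches up at
  \<open>N + 1 - c\<close>, the mirror of \<open>c - 1\<close>. In the second case
  \<open>c \<noteq> 1\<close>, as both counts are 0 at column 0. The third case occurs if only
  \<open>P\<close> contains \<open>N + 1 - c\<close>.\<close>

lemma exceptional_previous:
  assumes "\<tau> = Type_D" "exceptional c" "c \<in> T \<or> N + 1 - c \<in> P"
  shows "c - 1 \<in> C'"
proof -
  have N: "N = 2 * n + 2" using N_eq assms(1) by simp
  have c: "1 \<le> c" "c \<le> n" "odd (t (n + 1) + p (n + 1))" "closed c" "t c = p c + 1"
    using assms(2) by (auto simp: exceptional_def)
  have steps: "p c = p (c - 1) + (if c \<in> P then 1 else 0)" "t c = t (c - 1) + (if c \<in> T then 1 else 0)"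
    using p_step[of c] t_step[of c] c by auto
  have zero: "p 0 = 0" "t 0 = 0" by auto
  have ex: "exceptional (c - 1)" if "t (c - 1) = p (c - 1) + 1" "c \<in> P \<or> N + 1 - c \<in> P" "c \<in> T \<or> N + 1 - c \<in> T"
  proof -
    have "c \<noteq> 1" using that(1) zero by auto
    then show ?thesis using c closed_step[of c] that by (auto simp: exceptional_def)
  qed
  have mirror: "N + 1 - c - 1 = N - c" "N - (c - 1) = N + 1 - c" using c N by auto
  consider "t (c - 1) \<le> p (c - 1)" | "exceptional (c - 1)" | "t (N + 1 - c) \<le> p (N + 1 - c)"
  proof (cases "c \<in> T")
    case True
    then show ?thesis using that steps c(5) ex by (cases "c \<in> P") auto
  next
    case False
    then have cP: "c \<notin> P" "N + 1 - c \<in> P" using assms(3) P_mirror[of "N + 1 - c"] c N by auto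
    show ?thesis
    proof (cases "N + 1 - c \<in> T")
      case True
      then show ?thesis using that False cP steps c(5) ex by auto
    next
      case nT: False
      have "1 \<le> N + 1 - c" using c N by simp
      then have "t (N + 1 - c) = t (N - c)" "p (N + 1 - c) = p (N - c) + 1"
        using p_step[of "N + 1 - c"] t_step[of "N + 1 - c"] nT cP(2) unfolding mirror(1) by simp_all
      moreover have "p (N - c) = p c + (n + 1 - c) \<and> t (N - c) = t c + (n + 1 - c)"
        using closed_count[OF N c(4)] c(2) by simp
      ultimately have "t (N + 1 - c) \<le> p (N + 1 - c)" using c(5) by linarith
      then show ?thesis by (rule that(3))
    qed
  qed
  then show ?thesis
  proof cases
    case 1
    have "c - 1 \<le> N" using c(2) N by linarith
    then show ?thesis using 1 by (rule visible_C')
  next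
    case 2
    then show ?thesis by (rule exceptional_C'[OF assms(1)])
  next
    case 3
    then have "t (N - (c - 1)) \<le> p (N - (c - 1))" unfolding mirror(2) .
    moreover have "c - 1 \<le> N" using c(2) N by linarith
    ultimately show ?thesis using visible_mirror_C' by blast
  qed
qed

text \<open>The exceptional middle cut alone does not bound both sides of a column. By a check of
  memberships of \<open>n + 1\<close> and \<open>n + 2\<close>, the counts agree at \<open>n\<close>
  or at its mirror \<open>n + 2\<close>, or \<open>n\<close> is exceptional.\<close>

lemma middle_neighbour:
  assumes D: "\<tau> = Type_D" and mid and "n + 1 \<in> T \<or> n + 2 \<in> P"
  shows "n \<in> C"
proof -
  have N: "N = 2 * n + 2" using N_eq D by simp
  have mirror: "N + 1 - (n + 1) = n + 2" "N + 1 - (n + 2) = n + 1" "N - n = n + 2" using N by auto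
  have excl: "\<not> (n + 1 \<in> P \<and> n + 2 \<in> P)" "\<not> (n + 1 \<in> T \<and> n + 2 \<in> T)"
    using P_mirror[of "n + 1"] T_mirror[of "n + 1"] mirror by auto
  have steps: "p (n + 1) = p n + (if n + 1 \<in> P then 1 else 0)" "t (n + 1) = t n + (if n + 1 \<in> T then 1 else 0)"
    "p (n + 2) = p (n + 1) + (if n + 2 \<in> P then 1 else 0)" "t (n + 2) = t (n + 1) + (if n + 2 \<in> T then 1 else 0)"
    using p_step[of "n + 1"] t_step[of "n + 1"] p_step[of "n + 2"] t_step[of "n + 2"] by auto
  \<comment> \<open>At \<open>n\<close> the parity condition is automatic: the lead of one persists
    at \<open>n + 1\<close>, so the two counts there have an odd sum.\<close>
  have ex: "exceptional n" if "t n = p n + 1" "n + 1 \<in> P \<longleftrightarrow> n + 1 \<in> T"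
      "n + 1 \<in> P \<or> n + 2 \<in> P" "n + 1 \<in> T \<or> n + 2 \<in> T"
  proof -
    have "n \<noteq> 0" using that(1) by (intro notI) simp
    moreover have "closed n" using that(3,4) mirror(1) by (simp add: closed_def)
    ultimately show ?thesis using that(1,2) steps by (auto simp: exceptional_def)
  qed
  have "t n \<le> p n \<or> exceptional n \<or> t (n + 2) \<le> p (n + 2)"
    using assms(2,3) steps excl ex unfolding mid_def
    by (cases "n + 1 \<in> P"; cases "n + 1 \<in> T"; cases "n + 2 \<in> P"; cases "n + 2 \<in> T") force+
  moreover have "n \<le> N" using N by linarith
  ultimately show ?thesis unfolding cuts_iff mirror(3) using D by blast
qed

text \<open>The definition of a lone star supplies a cut on one side of the column only. The cut on
  the other side is found separately for each kind of cut; it ensures that a linear equation never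
  falls inside a gap of length at least 2.\<close>

lemma lone_star_C':
  assumes a: "1 \<le> a" "a \<le> N" and star: "lone_star \<tau> N n P T a"
  shows "a - 1 \<in> C' \<and> a \<in> C'"
proof -
  have mirror: "N - (a - 1) = N + 1 - a" "N + 1 - a - 1 = N - a" "1 \<le> N + 1 - a" using a by auto
  have steps: "p a = p (a - 1) + (if a \<in> P then 1 else 0)" "t a = t (a - 1) + (if a \<in> T then 1 else 0)"
    "p (N + 1 - a) = p (N - a) + (if N + 1 - a \<in> P then 1 else 0)"
    "t (N + 1 - a) = t (N - a) + (if N + 1 - a \<in> T then 1 else 0)"
    using p_step[OF a(1)] t_step[OF a(1)] p_step[OF mirror(3), unfolded mirror(2)]
      t_step[OF mirror(3), unfolded mirror(2)] by blast+
  have excl: "\<not> (a \<in> P \<and> N + 1 - a \<in> P)" "\<not> (a \<in> T \<and> N + 1 - a \<in> T)"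
    using P_mirror[of a] T_mirror[of a] by auto
  have le: "p a \<le> t a" "p (a - 1) \<le> t (a - 1)" "p (N - a) \<le> t (N - a)" "p (N + 1 - a) \<le> t (N + 1 - a)"
    using count_le by auto
  have sym: "N - (N - a) = a" "N - (N + 1 - a) = a - 1" using a by auto
  from star consider (T) "a \<in> T" "a \<in> C" | (P) "a \<in> P" "a - 1 \<in> C"
    by (auto simp: lone_star_def)
  then show ?thesis
  proof cases
    case T
    have "a - 1 \<in> C'"
    proof -
      consider "t a \<le> p a" | "t (N - a) \<le> p (N - a)" | "\<tau> = Type_D" "a = n + 1" mid
        | "\<tau> = Type_D" "exceptional a" | "\<tau> = Type_D" "exceptional (N - a)"
        using T(2) unfolding cuts_iff by blast
      then show ?thesis
      proof cases
        case 1
        then have "t (a - 1) \<le> p (a - 1)" using steps(1,2) T(1) by (simp split: if_splits)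
        then show ?thesis using a by (intro visible_C') simp_all
      next
        case 2
        have "N + 1 - a \<notin> T" using excl T(1) by blast
        then have "t (N + 1 - a) \<le> p (N + 1 - a)" using steps(3,4) 2 by simp
        then have "t (N - (a - 1)) \<le> p (N - (a - 1))" unfolding mirror(1) .
        then show ?thesis using a(2) by (intro visible_mirror_C') linarith
      next
        case 3
        then have "n \<in> C" using T(1) by (intro middle_neighbour) simp_all
        then show ?thesis using 3(2) by (simp add: C'_def)
      next
        case 4
        then show ?thesis using exceptional_previous T(1) by blast
      next
        case 5
        have eq: "N - a + 1 = N + 1 - a" using a by simp
        have "N + 1 - a \<notin> T" using excl T(1) by blast
        then have "N + 1 - a \<in> C'" using exceptional_next[OF 5] unfolding eq by blast
        then show ?thesis using C'_mirror[of "N + 1 - a"] a unfolding sym(2) by simp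
      qed
    qed
    then show ?thesis using T(2) by (simp add: C'_def)
  next
    case P
    have "a \<in> C'"
    proof -
      consider "t (a - 1) \<le> p (a - 1)" | "t (N + 1 - a) \<le> p (N + 1 - a)" | "\<tau> = Type_D" "a = n + 2" mid
        | "\<tau> = Type_D" "exceptional (a - 1)" | "\<tau> = Type_D" "exceptional (N + 1 - a)"
      proof -
        have "a - 1 = n + 1 \<Longrightarrow> a = n + 2" by linarith
        then show ?thesis using P(2) that unfolding cuts_iff mirror(1) by blast
      qed
      then show ?thesis
      proof cases
        case 1
        then have "t a \<le> p a" using steps(1,2) P(1) by simp
        then show ?thesis using a by (intro visible_C')
      next
        case 2
        have "N + 1 - a \<notin> P" using excl P(1) by blast
        then have "t (N - a) \<le> p (N - a)" using steps(3,4) 2 by (simp split: if_splits)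
        then show ?thesis using a by (intro visible_mirror_C')
      next
        case 3
        then have "N - n = a" "n \<le> N" using N_eq by simp_all
        moreover have "n \<in> C" using 3 P(1) by (intro middle_neighbour) simp_all
        ultimately show ?thesis using cuts_mirror[of n] by (simp add: C'_def)
      next
        case 4
        have "a - 1 + 1 = a" using a by simp
        then show ?thesis using exceptional_next[OF 4] P(1) by simp
      next
        case 5
        have "N + 1 - (N + 1 - a) = a" using a by simp
        then have "N - a \<in> C'" using exceptional_previous[OF 5] P(1) unfolding mirror(2) by simp
        then show ?thesis using C'_mirror[of a] a by simp
      qed
    qed
    then show ?thesis using P(2) by (simp add: C'_def)
  qed
qed

lemma L_C':
  assumes "c \<in> L"
  shows "c - 1 \<in> C' \<and> c \<in> C'"
proof -
  have c: "1 \<le> c" "c \<le> N" using assms by (auto simp: L_iff)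
  consider "t c \<le> p (c - 1)" | "lone_star \<tau> N n P T (N + 1 - c)"
    using assms by (auto simp: L_iff)
  then show ?thesis
  proof cases
    case 1
    then have "t (c - 1) \<le> p (c - 1)" "t c \<le> p c"
      using p_step[OF c(1)] t_step[OF c(1)] by auto
    then show ?thesis using c by (auto simp: C'_def cuts_iff)
  next
    case 2
    then have "N + 1 - c - 1 \<in> C' \<and> N + 1 - c \<in> C'"
      using lone_star_C'[of "N + 1 - c"] c by auto
    moreover have "N + 1 - c - 1 = N - c" "N - (c - 1) = N + 1 - c" using c by auto
    ultimately show ?thesis
      using C'_mirror[of c] C'_mirror[of "c - 1"] c by auto
  qed
qed

section \<open>Columns between two adjacent cuts\<close>

lemma visible_left_L:
  assumes "1 \<le> c" "c \<le> N" "t (c - 1) \<le> p (c - 1)" "c \<in> C"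
  shows "c \<in> L \<or> N + 1 - c \<in> L"
proof (cases "c \<in> T")
  case True
  then show ?thesis using lone_star_L[of c] assms by (auto simp: lone_star_def)
next
  case False
  then show ?thesis using assms t_step[OF assms(1)] by (auto simp: L_iff)
qed

lemma visible_right_L:
  assumes "1 \<le> c" "c \<le> N" "t c \<le> p c" "c - 1 \<in> C"
  shows "c \<in> L \<or> N + 1 - c \<in> L"
proof (cases "c \<in> P")
  case True
  then show ?thesis using lone_star_L[of c] assms by (auto simp: lone_star_def)
next
  case False
  then show ?thesis using assms p_step[OF assms(1)] by (auto simp: L_iff)
qed

text \<open>If the counts agree on one side of a column, it is either a zero column or contains a
  lone star. The mirror symmetry of cuts reduces the last two alternatives to the first two.\<close>

lemma apparent_L:
  assumes c: "1 \<le> c" "c \<le> N" and cut: "c - 1 \<in> C" "c \<in> C"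
    and vis: "t (c - 1) \<le> p (c - 1) \<or> t c \<le> p c \<or> t (N - c) \<le> p (N - c) \<or> t (N + 1 - c) \<le> p (N + 1 - c)"
  shows "c \<in> L \<or> N + 1 - c \<in> L"
proof -
  have eq: "N - (c - 1) = N + 1 - c" "N + 1 - c - 1 = N - c" "N + 1 - (N + 1 - c) = c"
    "1 \<le> N + 1 - c" "N + 1 - c \<le> N" using c by auto
  have cut': "N + 1 - c - 1 \<in> C" "N + 1 - c \<in> C"
    using cuts_mirror[of c] cuts_mirror[of "c - 1"] cut c eq by auto
  show ?thesis
    using vis visible_left_L[OF c _ cut(2)] visible_right_L[OF c _ cut(1)]
      visible_left_L[OF eq(4,5) _ cut'(2)] visible_right_L[OF eq(4,5) _ cut'(1)] eq by auto
qed

text \<open>In the lower half the mirror columns exceed \<open>n\<close>, apart from the middle one,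
  and cannot be exceptional. The upper half follows by reflection.\<close>

lemma adjacent_C'_L_half:
  assumes D: "\<tau> = Type_D" and c: "1 \<le> c" "c \<le> n + 1" and cut: "c - 1 \<in> C'" "c \<in> C'"
  shows "c \<in> L \<or> N + 1 - c \<in> L"
proof -
  have N: "N = 2 * n + 2" using N_eq D by simp
  have cN: "c \<le> N" using c N by simp
  have eq: "N - (c - 1) = N + 1 - c" "1 \<le> N + 1 - c" "N + 1 - c \<le> N" "N + 1 - (N + 1 - c) = c"
      "c - 1 \<le> N" "c - 1 \<noteq> n + 1" "\<not> N + 1 - c \<le> n"
    using c N by linarith+
  have c1: "c - 1 \<in> C" using cut(1) eq(6) unfolding C'_D[OF D] by blast
  have not_ex: "\<not> exceptional (N + 1 - c)" using eq(7) by (simp add: exceptional_def)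
  have mirror: "N + 1 - c \<in> C" using cuts_mirror[OF eq(5)] c1 unfolding eq(1) by blast
  show ?thesis
  proof (cases "c = n + 1")
    case False
    then have cC: "c \<in> C" using cut(2) unfolding C'_D[OF D] by blast
    have "\<not> N - c \<le> n" using c N False by linarith
    then have not_ex': "\<not> exceptional (N - c)" by (simp add: exceptional_def)
    show ?thesis
    proof (cases "t (c - 1) \<le> p (c - 1) \<or> t c \<le> p c \<or> t (N - c) \<le> p (N - c) \<or> t (N + 1 - c) \<le> p (N + 1 - c)")
      case True
      then show ?thesis by (rule apparent_L[OF c(1) cN c1 cC])
    next
      case app: False
      \<comment> \<open>No count agrees, so both sides are exceptional. The lead of one is constant
        across the column, and closedness puts \<open>c\<close> or its mirror into \<open>T\<close>;
        either way there is a lone star.\<close>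
      have ex: "exceptional (c - 1)" "exceptional c"
        using c1 cC app not_ex not_ex' False eq(6) unfolding cuts_iff eq(1) by blast+
      then have "t (c - 1) = p (c - 1) + 1" "t c = p c + 1"
        unfolding exceptional_def by blast+
      then have same: "c \<in> P \<longleftrightarrow> c \<in> T"
        using p_step[OF c(1)] t_step[OF c(1)] by (cases "c \<in> P"; cases "c \<in> T") simp_all
      have "N + 1 - c \<in> T" if "c \<notin> T"
        using ex(1) that c(2) unfolding exceptional_def closed_step[OF c(1)] by blast
      then have "lone_star \<tau> N n P T c \<or> lone_star \<tau> N n P T (N + 1 - c)"
        using same c1 mirror unfolding lone_star_def by blast
      then show ?thesis
        using lone_star_L[OF c(1) cN] lone_star_L[OF eq(2,3)] unfolding eq(4) by blast
    qed
  next
    case True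
    \<comment> \<open>The middle column was added to \<open>C'\<close> without being a cut, so
      everything has to come from the cut \<open>n\<close>, which may in turn make the middle column
      a cut.\<close>
    have nC: "n \<in> C" using c1 True by simp
    have m2: "N + 1 - (n + 1) = n + 2" "N + 1 - (n + 2) = n + 1" "N - n = n + 2" "n + 2 \<le> N"
        "n \<le> N" "n + 1 \<le> N" "\<not> n + 2 \<le> n"
      using N by linarith+
    have n2: "n + 2 \<in> C" using cuts_mirror[OF m2(5)] nC unfolding m2(3) by blast
    have steps: "p (n + 1) = p n + (if n + 1 \<in> P then 1 else 0)" "t (n + 1) = t n + (if n + 1 \<in> T then 1 else 0)"
      "p (n + 2) = p (n + 1) + (if n + 2 \<in> P then 1 else 0)" "t (n + 2) = t (n + 1) + (if n + 2 \<in> T then 1 else 0)"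
      using p_step[of "n + 1"] t_step[of "n + 1"] p_step[of "n + 2"] t_step[of "n + 2"] by auto
    have midC: "n + 1 \<in> C" if mid unfolding cuts_iff using that D m2(6) by blast
    have "\<not> exceptional (n + 2)" using exceptional_le[of "n + 2"] m2(7) by blast
    then consider "t n \<le> p n" | "t (n + 2) \<le> p (n + 2)" | "exceptional n"
      using nC unfolding cuts_iff m2(3) by (metis Suc_eq_plus1 n_not_Suc_n)
    then have "n + 1 \<in> L \<or> n + 2 \<in> L \<or> lone_star \<tau> N n P T (n + 1) \<or> lone_star \<tau> N n P T (n + 2)"
    proof cases
      case 1
      show ?thesis
      proof (cases "n + 1 \<in> T")
        case True
        then have mid using 1 steps by (simp add: mid_def)
        then show ?thesis using True midC unfolding lone_star_def by blast
      next
        case False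
        then have "t (n + 1) \<le> p (n + 1 - 1)" using 1 steps(2) by simp
        then show ?thesis using m2(6) unfolding L_iff by simp
      qed
    next
      case 2
      show ?thesis
      proof (cases "n + 2 \<in> P")
        case True
        then have mid using 2 steps by (simp add: mid_def)
        moreover have "n + 2 - 1 = n + 1" by simp
        ultimately show ?thesis using True midC unfolding lone_star_def by metis
      next
        case False
        then have "t (n + 2) \<le> p (n + 2 - 1)" using 2 steps(3) by simp
        then show ?thesis using m2(4) unfolding L_iff by simp
      qed
    next
      case 3
      then have ex: "odd (t (n + 1) + p (n + 1))" "t n = p n + 1" "closed n" unfolding exceptional_def by blast+
      have "n + 1 \<in> P \<longleftrightarrow> n + 1 \<in> T"
        using steps(1,2) ex(1,2) by (cases "n + 1 \<in> P"; cases "n + 1 \<in> T") simp_all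
      moreover have "n + 1 \<in> {n + 1..n + 1}" by simp
      then have "n + 1 \<in> P \<or> n + 2 \<in> P" "n + 1 \<in> T \<or> n + 2 \<in> T"
        using ex(3) m2(1) unfolding closed_def by metis+
      moreover have "n + 1 - 1 = n" by simp
      ultimately show ?thesis using nC n2 unfolding lone_star_def by metis
    qed
    moreover have "1 \<le> n + 1" "1 \<le> n + 2" by simp_all
    ultimately show ?thesis
      using lone_star_L[of "n + 1"] lone_star_L[of "n + 2"] m2(4,6) unfolding True m2(1,2) by blast
  qed
qed

lemma adjacent_C'_L:
  assumes c: "1 \<le> c" "c \<le> N" and cut: "c - 1 \<in> C'" "c \<in> C'"
  shows "c \<in> L \<or> N + 1 - c \<in> L"
proof (cases "\<tau> = Type_D")
  case True
  then have N: "N = 2 * n + 2" using N_eq by simp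
  show ?thesis
  proof (cases "c \<le> n + 1")
    case True
    then show ?thesis using adjacent_C'_L_half[OF \<open>\<tau> = Type_D\<close> c(1)] cut by blast
  next
    case False
    have eq: "N - (c - 1) = N + 1 - c" "N + 1 - c - 1 = N - c" "N + 1 - (N + 1 - c) = c" using c by auto
    have "N + 1 - c - 1 \<in> C'" "N + 1 - c \<in> C'"
      using C'_mirror[of c] C'_mirror[of "c - 1"] cut c eq by auto
    then have "N + 1 - c \<in> L \<or> N + 1 - (N + 1 - c) \<in> L"
    proof (rule adjacent_C'_L_half[OF \<open>\<tau> = Type_D\<close>, rotated 2])
      show "1 \<le> N + 1 - c" "N + 1 - c \<le> n + 1" using False N c by linarith+
    qed
    then show ?thesis using eq(3) by auto
  qed
next
  case False
  then have "c - 1 \<in> C" "c \<in> C" using cut by (auto simp: C'_def)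
  moreover have "N - (c - 1) = N + 1 - c" using c by simp
  ultimately show ?thesis
    using apparent_L[OF c] False by (auto simp: cuts_iff)
qed

section \<open>Adjacent elements of \<open>Q\<close> and linear equations\<close>

lemma Q_iff: "c \<in> Q \<longleftrightarrow> c \<in> C \<and> c \<le> n \<or> c = n + 1 \<and> \<tau> \<noteq> Type_C"
  by (auto simp: Q_set_def)

text \<open>In type B the element \<open>n + 1\<close> of \<open>Q\<close> need not be a cut by
  itself. If \<open>n\<close> is a cut, then so is \<open>n + 1 = N - n\<close> by symmetry.\<close>

lemma adjacent_Q_L:
  assumes "Suc c \<in> Q" "c \<in> Q"
  shows "Suc c \<in> L \<or> N - c \<in> L"
proof -
  have C': "c \<in> C'" "Suc c \<in> C'" and "Suc c \<le> N"
  proof -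
    have "c \<in> C \<or> c = n + 1" using assms(2) unfolding Q_iff by blast
    moreover have "c \<noteq> n + 1" using assms(1) unfolding Q_iff by auto
    ultimately show "c \<in> C'" unfolding C'_def by blast
    have "Suc c \<le> n \<or> Suc c = n + 1 \<and> \<tau> \<noteq> Type_C" using assms(1) unfolding Q_iff by blast
    then show "Suc c \<le> N" using N_eq by (cases \<tau>) auto
    show "Suc c \<in> C'"
    proof (cases "Suc c = n + 1 \<and> \<tau> = Type_B")
      case True
      then have "n \<in> C" using assms(2) unfolding Q_iff by simp
      moreover have "N - n = Suc c" "n \<le> N" using True N_eq by simp_all
      ultimately have "Suc c \<in> C" using cuts_mirror[of n] by simp
      then show ?thesis unfolding C'_def by blast
    next
      case False
      then have "Suc c \<in> C \<or> Suc c = n + 1 \<and> \<tau> = Type_D"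
        using assms(1) unfolding Q_iff by (cases \<tau>) blast+
      then show ?thesis unfolding C'_def by auto
    qed
  qed
  then show ?thesis using adjacent_C'_L[of "Suc c"] by auto
qed

text \<open>Here \<open>b\<close> is the lower of the two indices \<open>c\<close> and
  \<open>N + 1 - c\<close>. A variable in \<open>L\<close> thus occurs only between adjacent
  elements of \<open>Q\<close>, never in a quadric of a longer gap.\<close>

lemma L_Q:
  assumes "c \<in> L" "b = c \<or> b = N + 1 - c" "b \<le> N + 1 - b"
  shows "b \<in> Q \<and> b - 1 \<in> Q"
proof -
  have c: "1 \<le> c" "c \<le> N" using assms(1) by (auto simp: L_iff)
  have "c - 1 \<in> C'" "c \<in> C'" using L_C'[OF assms(1)] by auto
  moreover have "N - (c - 1) = N + 1 - c" "N + 1 - c - 1 = N - c" using c by auto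
  ultimately have b: "b - 1 \<in> C'" "b \<in> C'"
    using assms(2) C'_mirror[of c] C'_mirror[of "c - 1"] c by auto
  have "1 \<le> b" "2 * b \<le> N + 1" using assms c by auto
  have "N = 2 * n \<or> N = 2 * n + 1 \<or> N = 2 * n + 2" "\<tau> = Type_C \<Longrightarrow> N = 2 * n"
    using N_eq by (cases \<tau>; simp)+
  then have "b \<le> n + 1" "\<tau> = Type_C \<Longrightarrow> b \<le> n"
    using \<open>2 * b \<le> N + 1\<close> by linarith+
  then have "b \<le> n \<or> b = n + 1 \<and> \<tau> \<noteq> Type_C" "b - 1 \<le> n" "b - 1 \<noteq> n + 1"
    using \<open>1 \<le> b\<close> by (linarith | auto)+
  moreover have "b - 1 \<in> C \<or> b - 1 = n + 1" "b \<in> C \<or> b = n + 1"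
    using b unfolding C'_def by (auto split: if_splits)
  moreover have "b \<le> n \<Longrightarrow> b \<noteq> n + 1" by linarith
  ultimately show ?thesis
    unfolding Q_iff by blast
qed

lemma zero_Q: "0 \<in> Q"
proof -
  have "p N = m" "t N = m"
    using P_sub T_sub card_P card_T by (simp_all add: Int_absorb2)
  then show ?thesis by (simp add: Q_iff cuts_iff)
qed

text \<open>A column of \<open>T\<close> is not a zero column, so its mirror contains a lone star,
  and that star comes from \<open>P\<close>. The inequalities between the counts exclude an apparent
  cut at \<open>N - k\<close>, which leaves the exceptional cuts of type D.\<close>

lemma T_subset_L_element:
  assumes "k \<in> T" "k \<in> L"
  shows "\<tau> = Type_D \<and> N + 1 - k \<in> P \<and> odd (t (n + 1) + p (n + 1)) \<and>
    closed (min k (N + 1 - k) - 1)"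
proof -
  have k: "1 \<le> k" "k \<le> N" using assms(1) T_sub by auto
  let ?a = "N + 1 - k"
  have a: "?a - 1 = N - k" "N + 1 - ?a = k" "1 \<le> ?a" "N - (N - k) = k" using k by auto
  have aT: "?a \<notin> T" by (rule T_mirror[OF assms(1)])
  have steps: "p k = p (k - 1) + (if k \<in> P then 1 else 0)" "t k = t (k - 1) + 1"
    "p ?a = p (N - k) + (if ?a \<in> P then 1 else 0)" "t ?a = t (N - k)"
    using p_step[OF k(1)] t_step[OF k(1)] p_step[OF a(3), unfolded a(1)]
      t_step[OF a(3), unfolded a(1)] assms(1) aT by simp_all
  have le: "p k \<le> t k" "p (k - 1) \<le> t (k - 1)" "p (N - k) \<le> t (N - k)" "p ?a \<le> t ?a"
    by (rule count_le)+
  have "\<not> t k \<le> p (k - 1)" using steps(2) le(2) by linarith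
  then have "lone_star \<tau> N n P T ?a" using assms(2) unfolding L_iff by blast
  then have star: "?a \<in> P" "N - k \<in> C"
    using aT unfolding lone_star_def a(1) by blast+
  have kP: "k \<notin> P" using P_mirror[OF star(1)] unfolding a(2) .
  have "\<not> t (N - k) \<le> p (N - k)" "\<not> t k \<le> p k"
  proof -
    have "p ?a = p (N - k) + 1" "p k = p (k - 1)" using steps(1,3) star(1) kP by simp_all
    then show "\<not> t (N - k) \<le> p (N - k)" "\<not> t k \<le> p k" using steps(2,4) le by linarith+
  qed
  then have D: "\<tau> = Type_D" and cases: "N - k = n + 1 \<and> mid \<or> exceptional (N - k) \<or> exceptional k"
    using star(2) unfolding cuts_iff a(4) by blast+
  have N: "N = 2 * n + 2" by (rule N_D[OF D])
  from cases have "odd (t (n + 1) + p (n + 1)) \<and> closed (min k ?a - 1)"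
  proof (elim disjE)
    assume *: "N - k = n + 1 \<and> mid"
    then have k': "k = n + 1" "?a = n + 2" using N by linarith+
    have mem: "n + 1 \<notin> P" "n + 1 \<in> T" "n + 2 \<in> P"
      using kP assms(1) star(1) unfolding k'(2) unfolding k'(1) by blast+
    have s: "p (n + 1) = p n" "t (n + 1) = t n + 1" "p (n + 2) = p (n + 1) + 1"
      using p_step[of "n + 1"] t_step[of "n + 1"] p_step[of "n + 2"] mem by simp_all
    have "t n \<le> p n" using * s unfolding mid_def by auto
    then have "t (n + 1) = p (n + 1) + 1" using s count_le[of n] by linarith
    moreover have "N + 1 - (n + 1) \<in> P" using star(1) unfolding k'(1) .
    then have "closed n" using mem(2) unfolding closed_def by simp
    moreover have "min k ?a - 1 = n" unfolding k'(2) unfolding k'(1) by simp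
    ultimately show ?thesis by simp
  next
    assume *: "exceptional (N - k)"
    then have "N - k \<le> n" by (rule exceptional_le)
    then have "min k ?a - 1 = N - k" using N k unfolding min_def by auto
    then show ?thesis using * unfolding exceptional_def by simp
  next
    assume *: "exceptional k"
    then have "k \<le> n" by (rule exceptional_le)
    then have "min k ?a = k" using N unfolding min_def by auto
    moreover have "closed (k - 1)"
      using * star(1) assms(1) unfolding exceptional_def closed_step[OF k(1)] by blast
    ultimately show ?thesis using * unfolding exceptional_def by simp
  qed
  then show ?thesis using D star(1) by blast
qed

text \<open>This isolates the only configuration in which all variables could be linear equations:
  \<open>T\<close> and \<open>P\<close> are mirror images that fill a symmetric interval, as for two
  complementary maximal isotropic coordinate subspaces of odd dimension \<open>m\<close>.\<close>

lemma T_subset_L: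
  assumes "T \<subseteq> L"
  shows "\<tau> = Type_D \<and> odd m \<and> P = (\<lambda>c. N + 1 - c) ` T \<and>
    (\<exists>b. T \<union> P = {b..N + 1 - b})"
proof -
  have facts: "\<tau> = Type_D" "N + 1 - k \<in> P" "odd (t (n + 1) + p (n + 1))" "closed (min k (N + 1 - k) - 1)"
    if "k \<in> T" for k
    using T_subset_L_element[of k] that assms by auto
  have finT: "finite T" and finP: "finite P" using T_sub P_sub finite_subset by blast+
  obtain k0 where k0: "k0 \<in> T" using m_pos card_T by (metis card.empty equals0I not_one_le_zero)
  have D: "\<tau> = Type_D" and odd: "odd (t (n + 1) + p (n + 1))" using facts[OF k0] by auto
  have N: "N = 2 * n + 2" using N_eq D by simp
  have inj: "inj_on (\<lambda>c. N + 1 - c) T"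
  proof (rule inj_onI)
    fix x y assume "x \<in> T" "y \<in> T" "N + 1 - x = N + 1 - y"
    moreover then have "x \<le> N" "y \<le> N" using T_sub by auto
    ultimately show "x = y" by linarith
  qed
  have P_eq: "(\<lambda>c. N + 1 - c) ` T = P"
    using facts(2) card_image[OF inj] card_P card_T by (intro card_subset_eq[OF finP]) auto
  \<comment> \<open>Reflection exchanges the halves, so \<open>p (n + 1)\<close> counts the elements
    of \<open>T\<close> in the upper half and \<open>t (n + 1) + p (n + 1) = m\<close>.\<close>
  have "P \<inter> {1..n + 1} = (\<lambda>c. N + 1 - c) ` (T - {1..n + 1})"
  proof -
    have "N + 1 - c \<in> {1..n + 1} \<longleftrightarrow> c \<notin> {1..n + 1}" if "c \<in> T" for c
    proof -
      have "1 \<le> c" "c \<le> N" using that T_sub by auto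
      then show ?thesis using N unfolding atLeastAtMost_iff by linarith
    qed
    then show ?thesis unfolding P_eq[symmetric] by blast
  qed
  then have "p (n + 1) = card (T - {1..n + 1})"
    using card_image[OF inj_on_subset[OF inj]] by auto
  moreover have "card T = t (n + 1) + card (T - {1..n + 1})"
    using finT by (metis card_Int_Diff)
  ultimately have "odd m" using odd card_T by simp
  have T_P: "N + 1 - c \<in> T" if c: "c \<in> P" for c
  proof -
    obtain k where "k \<in> T" "c = N + 1 - k" using c P_eq by blast
    then show ?thesis using T_sub by auto
  qed
  have mirror: "N + 1 - c \<in> T \<union> P" if "c \<in> T \<union> P" for c
    using that T_P P_eq by auto
  define b where "b = Min (T \<union> P)"
  have bTP: "b \<in> T \<union> P" using k0 finT finP unfolding b_def by (intro Min_in) auto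
  have min: "b \<le> c" if "c \<in> T \<union> P" for c using that finT finP by (simp add: b_def)
  have b1: "1 \<le> b" "b \<le> N" using bTP T_sub P_sub by auto
  have bn: "b \<le> N + 1 - b" using min[OF mirror[OF bTP]] .
  have "closed (b - 1)"
  proof (cases "b \<in> T")
    case True
    then show ?thesis using facts(4)[OF True] bn by (simp add: min_def)
  next
    case False
    then have "N + 1 - b \<in> T" using bTP T_P by auto
    then have "closed (min (N + 1 - b) (N + 1 - (N + 1 - b)) - 1)" by (rule facts(4))
    moreover have "min (N + 1 - b) (N + 1 - (N + 1 - b)) = b" using bn b1 by auto
    ultimately show ?thesis by simp
  qed
  have low: "k \<in> T \<union> P" if "b \<le> k" "k \<le> n + 1" for k
  proof -
    have "k \<in> {b - 1 + 1..n + 1}" using that b1 by simp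
    then have "k \<in> P \<or> N + 1 - k \<in> P" using \<open>closed (b - 1)\<close> unfolding closed_def by blast
    moreover have "N + 1 - (N + 1 - k) = k" using that N by simp
    ultimately show ?thesis using T_P[of "N + 1 - k"] by auto
  qed
  have "T \<union> P = {b..N + 1 - b}"
  proof (intro equalityI subsetI)
    fix c assume c: "c \<in> T \<union> P"
    then have "1 \<le> c" "c \<le> N" using T_sub P_sub by auto
    then show "c \<in> {b..N + 1 - b}" using min[OF c] min[OF mirror[OF c]] by auto
  next
    fix c assume c: "c \<in> {b..N + 1 - b}"
    show "c \<in> T \<union> P"
    proof (cases "c \<le> n + 1")
      case True
      then show ?thesis using low c by auto
    next
      case False
      then have "N + 1 - c \<in> T \<union> P" using c b1 N by (intro low) auto
      then have "N + 1 - (N + 1 - c) \<in> T \<union> P" by (rule mirror)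
      moreover have "N + 1 - (N + 1 - c) = c" using c b1 by auto
      ultimately show ?thesis by simp
    qed
  qed
  then show ?thesis using D \<open>odd m\<close> P_eq by auto
qed

end

section \<open>Points of Schubert cells\<close>

text \<open>A determinant vanishes if its rows satisfy a nontrivial linear relation. It is stated
  for the Leibniz sum because Pluecker coordinates are given in that form.\<close>

lemma permutation_sum_eq_0:
  fixes M :: "nat \<Rightarrow> nat \<Rightarrow> complex" and x :: "nat \<Rightarrow> complex"
  assumes kernel: "\<And>j. j \<in> {1..m} \<Longrightarrow> (\<Sum>k = 1..m. x k * M k j) = 0"
    and k0: "k0 \<in> {1..m}" "x k0 \<noteq> 0"
  shows "(\<Sum>\<pi> | \<pi> permutes {1..m}. of_int (sign \<pi>) * (\<Prod>j = 1..m. M (\<pi> j) j)) = 0"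
proof -
  \<comment> \<open>The Leibniz term of the matrix whose row \<open>k0\<close> is replaced by row
    \<open>k\<close>. For \<open>k \<noteq> k0\<close> two rows coincide and transposing them
    cancels the sum; the relation makes the \<open>x\<close>-weighted sum over \<open>k\<close>
    vanish.\<close>
  define f where "f k \<pi> = (of_int (sign \<pi>) :: complex) * (\<Prod>j = 1..m. M (if \<pi> j = k0 then k else \<pi> j) j)" for k \<pi>
  have "(\<Sum>k = 1..m. x k * f k \<pi>) = 0" if "\<pi> permutes {1..m}" for \<pi>
  proof -
    define j0 where "j0 = inv \<pi> k0"
    have j0: "j0 \<in> {1..m}" "\<pi> j0 = k0"
      unfolding j0_def using permutes_in_image[OF permutes_inv[OF that]] k0(1) permutes_inverses(1)[OF that]
      by blast+
    have other: "\<pi> j \<noteq> k0" if "j \<noteq> j0" for j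
      using \<open>\<pi> permutes {1..m}\<close> j0(2) that by (metis permutes_inverses(2))
    have "f k \<pi> = of_int (sign \<pi>) * (M k j0 * (\<Prod>j\<in>{1..m} - {j0}. M (\<pi> j) j))" for k
    proof -
      have "(\<Prod>j = 1..m. M (if \<pi> j = k0 then k else \<pi> j) j) =
          M k j0 * (\<Prod>j\<in>{1..m} - {j0}. M (if \<pi> j = k0 then k else \<pi> j) j)"
        using j0 by (subst prod.remove[OF _ j0(1)]) auto
      also have "(\<Prod>j\<in>{1..m} - {j0}. M (if \<pi> j = k0 then k else \<pi> j) j) = (\<Prod>j\<in>{1..m} - {j0}. M (\<pi> j) j)"
        using other by (intro prod.cong) auto
      finally show ?thesis by (simp add: f_def)
    qed
    then have "(\<Sum>k = 1..m. x k * f k \<pi>) =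
        of_int (sign \<pi>) * (\<Prod>j\<in>{1..m} - {j0}. M (\<pi> j) j) * (\<Sum>k = 1..m. x k * M k j0)"
      by (simp add: sum_distrib_left sum_distrib_right mult_ac)
    then show ?thesis using kernel[OF j0(1)] by simp
  qed
  note rows = this
  have "(\<Sum>k = 1..m. x k * (\<Sum>\<pi> | \<pi> permutes {1..m}. f k \<pi>)) =
      (\<Sum>k = 1..m. \<Sum>\<pi> | \<pi> permutes {1..m}. x k * f k \<pi>)"
    by (simp only: sum_distrib_left)
  also have "\<dots> = (\<Sum>\<pi> | \<pi> permutes {1..m}. \<Sum>k = 1..m. x k * f k \<pi>)"
    by (rule sum.swap)
  also have "\<dots> = 0"
  proof (rule sum.neutral, rule ballI)
    fix \<pi> assume "\<pi> \<in> {\<pi>. \<pi> permutes {1..m}}"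
    then show "(\<Sum>k = 1..m. x k * f k \<pi>) = 0" using rows[of \<pi>] by simp
  qed
  finally have total: "(\<Sum>k = 1..m. x k * (\<Sum>\<pi> | \<pi> permutes {1..m}. f k \<pi>)) = 0" .
  have "(\<Sum>\<pi> | \<pi> permutes {1..m}. f k \<pi>) = 0" if k: "k \<in> {1..m}" "k \<noteq> k0" for k
  proof -
    let ?\<tau> = "Transposition.transpose k k0"
    have tau: "?\<tau> permutes {1..m}" by (rule permutes_swap_id[OF k(1) k0(1)])
    have "(\<Sum>\<pi> | \<pi> permutes {1..m}. f k \<pi>) = (\<Sum>\<pi> | \<pi> permutes {1..m}. f k (?\<tau> \<circ> \<pi>))"
      by (rule setum_permutations_compose_left[OF tau])
    also have "\<dots> = (\<Sum>\<pi> | \<pi> permutes {1..m}. - f k \<pi>)"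
    proof (rule sum.cong[OF refl])
      fix \<pi> assume "\<pi> \<in> {\<pi>. \<pi> permutes {1..m}}"
      then have \<pi>: "permutation \<pi>" using permutation_permutes by blast
      have "sign (?\<tau> \<circ> \<pi>) = - sign \<pi>"
        using sign_compose[OF permutation_swap_id \<pi>] k(2) by (simp add: sign_swap_id)
      moreover have "(if (?\<tau> \<circ> \<pi>) j = k0 then k else (?\<tau> \<circ> \<pi>) j) = (if \<pi> j = k0 then k else \<pi> j)" for j
        by (auto simp: Transposition.transpose_def)
      ultimately show "f k (?\<tau> \<circ> \<pi>) = - f k \<pi>" by (simp add: f_def)
    qed
    finally show ?thesis by (simp add: sum_negf)
  qed
  then have "(\<Sum>k = 1..m. x k * (\<Sum>\<pi> | \<pi> permutes {1..m}. f k \<pi>)) = x k0 * (\<Sum>\<pi> | \<pi> permutes {1..m}. f k0 \<pi>)"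
    by (subst sum.remove[OF _ k0(1)]) simp_all
  then have "(\<Sum>\<pi> | \<pi> permutes {1..m}. f k0 \<pi>) = 0" using total k0(2) by simp
  moreover have "f k0 \<pi> = of_int (sign \<pi>) * (\<Prod>j = 1..m. M (\<pi> j) j)" for \<pi>
    unfolding f_def by (intro arg_cong2[where f = "(*)"] refl prod.cong) auto
  ultimately show ?thesis by simp
qed

text \<open>The \<open>m\<close> by \<open>m\<close> matrix becomes a block of a matrix indexed by
  \<open>'n\<close>, completed by an identity block; this is why \<open>m \<le> CARD('n)\<close> is
  assumed. Transposing changes the sign of exactly the \<open>m\<close> rows of the block, so
  \<open>det A = - det A\<close>, and a kernel vector is supported on the block.\<close>

lemma odd_skew_singular:
  fixes s :: "nat \<Rightarrow> nat \<Rightarrow> complex"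
  assumes "odd m" "m \<le> CARD('n::finite)" and skew: "\<And>i j. i \<in> {1..m} \<Longrightarrow> j \<in> {1..m} \<Longrightarrow> s j i = - s i j"
  shows "\<exists>x. (\<exists>k\<in>{1..m}. x k \<noteq> 0) \<and> (\<forall>i\<in>{1..m}. (\<Sum>j = 1..m. s i j * x j) = 0)"
proof -
  have "\<exists>f. f ` {1..m} \<subseteq> (UNIV :: 'n set) \<and> inj_on f {1..m}"
    by (rule card_le_inj) (use assms(2) in simp_all)
  then obtain h :: "nat \<Rightarrow> 'n" where h: "inj_on h {1..m}" by blast
  define I where "I = h ` {1..m}"
  define g where "g = the_inv_into {1..m} h"
  have g: "g (h k) = k" if "k \<in> {1..m}" for k
    using the_inv_into_f_f[OF h that] by (simp add: g_def)
  have gI: "g i \<in> {1..m}" "h (g i) = i" if "i \<in> I" for i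
    using that g by (auto simp: I_def)
  define A :: "complex ^ 'n ^ 'n" where
    "A = (\<chi> i j. if i \<in> I \<and> j \<in> I then s (g i) (g j) else if i = j then 1 else 0)"
  define c :: "'n \<Rightarrow> complex" where "c i = (if i \<in> I then - 1 else 1)" for i
  have tr: "Finite_Cartesian_Product.transpose A = (\<chi> i. c i *s (A $ i))"
  proof -
    have "A $ j $ i = c i * A $ i $ j" for i j
    proof (cases "i \<in> I \<and> j \<in> I")
      case True
      then show ?thesis using skew[OF gI(1)[of i] gI(1)[of j]] by (simp add: A_def c_def)
    next
      case False
      then show ?thesis by (cases "i = j") (auto simp: A_def c_def)
    qed
    then have "Finite_Cartesian_Product.transpose A $ i $ j = (\<chi> i. c i *s (A $ i)) $ i $ j" for i j
      unfolding Finite_Cartesian_Product.transpose_def vec_lambda_beta vector_smult_component by blast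
    then show ?thesis unfolding vec_eq_iff by blast
  qed
  have "det A = prod c UNIV * det A"
    using det_transpose[of A] det_rows_mul[of c "\<lambda>i. A $ i"] by (simp add: tr)
  moreover have "prod c UNIV = - 1"
  proof -
    have "prod c UNIV = (\<Prod>i\<in>I. - 1)"
      unfolding c_def by (simp add: prod.If_cases)
    also have "\<dots> = - 1" using assms(1) card_image[OF h] by (simp add: I_def)
    finally show ?thesis .
  qed
  ultimately have "det A = 0" by simp
  then have "\<not> invertible A" by (simp add: invertible_det_nz)
  then obtain v where v: "A *v v = 0" "v \<noteq> 0"
    using matrix_left_invertible_ker[of A] by (auto simp: invertible_left_inverse)
  have row: "(\<Sum>j\<in>UNIV. A $ i $ j * v $ j) = 0" for i
    using v(1) by (simp add: matrix_vector_mult_def vec_eq_iff)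
  have outside: "v $ i = 0" if "i \<notin> I" for i
    using row[of i] that by (simp add: A_def if_distrib[of "\<lambda>x. x * _"] cong: if_cong)
  define x where "x k = v $ h k" for k
  obtain i where i: "v $ i \<noteq> 0" using v(2) by (auto simp: vec_eq_iff)
  then have "i \<in> I" using outside by blast
  then have "\<exists>k\<in>{1..m}. x k \<noteq> 0" using i gI by (intro bexI[of _ "g i"]) (simp_all add: x_def)
  moreover have "(\<Sum>j = 1..m. s i j * x j) = 0" if "i \<in> {1..m}" for i
  proof -
    have "h i \<in> I" using that by (simp add: I_def)
    have "(\<Sum>j\<in>UNIV. A $ h i $ j * v $ j) = (\<Sum>j\<in>I. A $ h i $ j * v $ j)"
      using outside by (intro sum.mono_neutral_right) auto
    also have "\<dots> = (\<Sum>j\<in>I. s (g (h i)) (g j) * v $ j)"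
      using \<open>h i \<in> I\<close> by (intro sum.cong) (auto simp: A_def)
    also have "\<dots> = (\<Sum>j = 1..m. s i j * x j)"
      unfolding I_def sum.reindex[OF h] using g that by (intro sum.cong) (auto simp: x_def)
    finally show ?thesis using row by simp
  qed
  ultimately show ?thesis by blast
qed

lemma entry_in: "finite A \<Longrightarrow> j \<in> {1..card A} \<Longrightarrow> entry N A j \<in> A"
  using nth_mem[of "j - 1" "sorted_list_of_set A"] by (auto simp: entry_def)

lemma entry_inj: "finite A \<Longrightarrow> inj_on (entry N A) {1..card A}"
  by (rule inj_onI) (auto simp: entry_def nth_eq_iff_index_eq)

lemma entry_image:
  assumes "finite A"
  shows "entry N A ` {1..card A} = A"
  using assms entry_in[OF assms] card_image[OF entry_inj[OF assms]]
  by (intro card_subset_eq) auto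

context coordinates
begin

section \<open>Coordinate subspaces, the flag and Schubert cells\<close>

lemma span_basis_iff:
  assumes "A \<subseteq> V"
  shows "v \<in> vec.span (e ` A) \<longleftrightarrow> (\<forall>c\<in>V - A. coord e v c = 0)"
proof
  assume "v \<in> vec.span (e ` A)"
  then show "\<forall>c\<in>V - A. coord e v c = 0"
  proof (induction rule: vec.span_induct_alt)
    case (step a x y)
    then obtain i where "i \<in> A" "x = e i" by blast
    then show ?case using step assms coord_basis by auto
  qed simp
next
  assume zero: "\<forall>c\<in>V - A. coord e v c = 0"
  have "v = (\<Sum>c\<in>V. coord e v c *s e c)" using vector_coord[of v] by (simp add: vector_def)
  also have "\<dots> = (\<Sum>c\<in>A. coord e v c *s e c)"
    using assms zero by (intro sum.mono_neutral_right) auto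
  also have "\<dots> \<in> vec.span (e ` A)"
    by (intro vec.span_sum vec.span_scale vec.span_base) auto
  finally show "v \<in> vec.span (e ` A)" .
qed

lemma dim_span_basis: "A \<subseteq> V \<Longrightarrow> vec.dim (vec.span (e ` A)) = card A"
  using vec.dim_eq_card_independent[OF vec.independent_mono[OF independent_e image_mono]]
    card_image[OF inj_on_subset[OF inj_e]] by simp

definition flag :: "nat \<Rightarrow> (complex ^ 'n) set" where
  "flag c = vec.span (e ` {1..c})"

lemma flag_iff: "c \<le> CARD('n) \<Longrightarrow> v \<in> flag c \<longleftrightarrow> (\<forall>d\<in>V. c < d \<longrightarrow> coord e v d = 0)"
  unfolding flag_def by (subst span_basis_iff) (auto simp: V_eq)

lemma frame_combination:
  assumes "is_frame m b \<Sigma>" "v \<in> \<Sigma>"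
  shows "\<exists>x. v = (\<Sum>k = 1..m. x k *s b k)"
proof -
  have "v \<in> vec.span (b ` {1..m})" using assms by (simp add: is_frame_def)
  then obtain u where "v = (\<Sum>w\<in>b ` {1..m}. u w *s w)"
    using vec.span_finite[of "b ` {1..m}"] by auto
  then show ?thesis
    using assms(1) by (auto simp: is_frame_def sum.reindex intro!: exI[of _ "u \<circ> b"])
qed

text \<open>A nonzero minor with rows \<open>A\<close> makes the projection of
  \<open>\<Sigma>\<close> to the coordinates in \<open>A\<close> injective: a vector in the kernel
  is a linear relation between the frame vectors in these coordinates.\<close>

lemma pluecker_nonzero_injective:
  assumes "is_frame m b \<Sigma>" "pluecker e m b A \<noteq> 0" "A \<subseteq> V" "card A = m"
    and v: "v \<in> \<Sigma>" "\<And>c. c \<in> A \<Longrightarrow> coord e v c = 0"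
  shows "v = 0"
proof (rule ccontr)
  assume "v \<noteq> 0"
  obtain x where x: "v = (\<Sum>k = 1..m. x k *s b k)"
    using frame_combination[OF assms(1) v(1)] by blast
  have "\<exists>k0\<in>{1..m}. x k0 \<noteq> 0"
  proof (rule ccontr)
    assume "\<not> (\<exists>k0\<in>{1..m}. x k0 \<noteq> 0)"
    then have "v = 0" unfolding x by (intro sum.neutral) simp
    then show False using \<open>v \<noteq> 0\<close> by simp
  qed
  then obtain k0 where k0: "k0 \<in> {1..m}" "x k0 \<noteq> 0" by blast
  have finA: "finite A" using assms(3) finite_V by (rule finite_subset)
  have "(\<Sum>k = 1..m. x k * coord e (b k) (entry (CARD('n)) A j)) = 0" if "j \<in> {1..m}" for j
  proof -
    have "entry (CARD('n)) A j \<in> A" using entry_in[OF finA] that assms(4) by blast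
    then have "coord e v (entry (CARD('n)) A j) = 0" by (rule v(2))
    then show ?thesis by (simp add: x)
  qed
  then have "pluecker e m b A = 0"
    unfolding pluecker_def by (rule permutation_sum_eq_0[where x = x, OF _ k0])
  then show False using assms(2) by simp
qed

text \<open>The last nonzero coordinate of \<open>v\<close> is a step of the flag at which the
  intersection with \<open>\<Sigma>\<close> grows, and in the cell these steps are the elements of
  \<open>P\<close>.\<close>

lemma cell_leading_coordinate:
  assumes \<Sigma>: "\<Sigma> \<in> schubert_cell \<omega> e m P" and v: "v \<in> \<Sigma>" "v \<noteq> 0"
  shows "\<exists>c\<in>P. coord e v c \<noteq> 0 \<and> (\<forall>d\<in>V. c < d \<longrightarrow> coord e v d = 0)"
proof -
  define D where "D = {c \<in> V. coord e v c \<noteq> 0}"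
  have D: "finite D" "D \<noteq> {}" using nonzero_coord[OF v(2)] by (auto simp: D_def)
  define c where "c = Max D"
  have c: "c \<in> V" "coord e v c \<noteq> 0" using Max_in[OF D] by (auto simp: c_def D_def)
  have above: "coord e v d = 0" if "d \<in> V" "c < d" for d
  proof (rule ccontr)
    assume "coord e v d \<noteq> 0"
    then have "d \<le> c" using D(1) that(1) unfolding c_def by (intro Max_ge) (auto simp: D_def)
    then show False using that(2) by simp
  qed
  have c1: "1 \<le> c" "c \<le> CARD('n)" using c(1) by (auto simp: V_eq)
  have "v \<in> flag c" using above flag_iff[OF c1(2)] by blast
  moreover have "v \<notin> flag (c - 1)"
  proof -
    have "c - 1 \<le> CARD('n)" "c - 1 < c" using c1 by auto
    then show ?thesis using flag_iff[of "c - 1" v] c by blast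
  qed
  moreover have "flag (c - 1) \<subseteq> flag c"
    unfolding flag_def by (intro vec.span_mono image_mono) auto
  ultimately have "\<Sigma> \<inter> flag (c - 1) \<subset> \<Sigma> \<inter> flag c" using v(1) by blast
  then have "c \<in> P"
    using \<Sigma> c1 unfolding schubert_cell_def flag_def by auto
  then show ?thesis using c(2) above by blast
qed

lemma cell_subspace: "\<Sigma> \<in> schubert_cell \<omega> e m P \<Longrightarrow> vec.subspace \<Sigma> \<and> vec.dim \<Sigma> = m"
  by (simp add: schubert_cell_def IG_def grassmannian_def)

lemma cell_isotropic: "\<Sigma> \<in> schubert_cell \<omega> e m P \<Longrightarrow> u \<in> \<Sigma> \<Longrightarrow> v \<in> \<Sigma> \<Longrightarrow> \<omega> u v = 0"
  by (simp add: schubert_cell_def IG_def)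

lemma subspace_flag: "vec.subspace (flag c)"
  by (simp add: flag_def)

lemma cell_dim_ge:
  assumes \<Sigma>: "\<Sigma> \<in> schubert_cell \<omega> e m P" and "c \<le> CARD('n)"
  shows "count_upto P c \<le> vec.dim (\<Sigma> \<inter> flag c)"
  using assms(2)
proof (induction c)
  case (Suc c)
  then have IH: "count_upto P c \<le> vec.dim (\<Sigma> \<inter> flag c)" by simp
  have sub: "vec.subspace (\<Sigma> \<inter> flag d)" for d
    using cell_subspace[OF \<Sigma>] subspace_flag by (intro vec.subspace_inter) auto
  have "flag c \<subseteq> flag (Suc c)"
    unfolding flag_def by (intro vec.span_mono image_mono) auto
  then have mono: "vec.dim (\<Sigma> \<inter> flag c) \<le> vec.dim (\<Sigma> \<inter> flag (Suc c))"
    by (intro vec.dim_subset) auto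
  show ?case
  proof (cases "Suc c \<in> P")
    case True
    then have "\<Sigma> \<inter> flag c \<subset> \<Sigma> \<inter> flag (Suc c)"
      using \<Sigma> unfolding schubert_cell_def flag_def by auto
    then have "vec.span (\<Sigma> \<inter> flag c) \<subset> vec.span (\<Sigma> \<inter> flag (Suc c))"
      using vec.span_eq_iff sub by metis
    then have "vec.dim (\<Sigma> \<inter> flag c) < vec.dim (\<Sigma> \<inter> flag (Suc c))" by (rule vec.dim_psubset)
    then show ?thesis using IH count_upto_Suc[of P c] True by simp
  next
    case False
    then show ?thesis using IH mono count_upto_Suc[of P c] by simp
  qed
qed simp

text \<open>The sum is direct, because a vector supported on \<open>B - A\<close> has no coordinates
  in \<open>A\<close>. Together the two claims bound the dimension of \<open>S\<close> by the size
  of \<open>A\<close>; in case of equality the sum is the whole span of \<open>B\<close>.\<close>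

lemma projection_dim:
  assumes sub: "vec.subspace S" and inj: "\<And>v. v \<in> S \<Longrightarrow> (\<forall>c\<in>A. coord e v c = 0) \<Longrightarrow> v = 0"
    and "A \<subseteq> B" "B \<subseteq> V" "S \<subseteq> vec.span (e ` B)"
  shows "vec.dim S + card (B - A) = vec.dim {x + y | x y. x \<in> S \<and> y \<in> vec.span (e ` (B - A))}"
    and "{x + y | x y. x \<in> S \<and> y \<in> vec.span (e ` (B - A))} \<subseteq> vec.span (e ` B)"
proof -
  let ?U = "vec.span (e ` (B - A))"
  have BA: "B - A \<subseteq> V" using assms(4) by auto
  have int: "S \<inter> ?U = {0}"
  proof -
    have "v = 0" if "v \<in> S" "v \<in> ?U" for v
    proof (rule inj[OF that(1)])
      show "\<forall>c\<in>A. coord e v c = 0"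
        using that(2) span_basis_iff[OF BA] assms(3,4) by blast
    qed
    moreover have "0 \<in> S" "0 \<in> ?U" using sub by (auto simp: vec.subspace_0 vec.span_zero)
    ultimately show ?thesis by blast
  qed
  have "vec.dim (S \<inter> ?U) = 0" unfolding int by simp
  then show "vec.dim S + card (B - A) = vec.dim {x + y | x y. x \<in> S \<and> y \<in> ?U}"
    using vec.dim_sums_Int[OF sub vec.subspace_span, of "e ` (B - A)"] dim_span_basis[OF BA] by linarith
  have "?U \<subseteq> vec.span (e ` B)" by (intro vec.span_mono image_mono) auto
  then show "{x + y | x y. x \<in> S \<and> y \<in> ?U} \<subseteq> vec.span (e ` B)"
    using assms(5) by (auto intro: vec.span_add)
qed

text \<open>The part of \<open>\<Sigma>\<close> in the flag space \<open>c\<close> has dimension at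
  least the count of \<open>P\<close>, and it injects into the coordinates in \<open>T\<close> up to
  \<open>c\<close>.\<close>

lemma cell_count_le:
  assumes \<Sigma>: "\<Sigma> \<in> schubert_cell \<omega> e m P" and "T \<subseteq> V" and c: "c \<le> CARD('n)"
    and inj: "\<And>v. v \<in> \<Sigma> \<Longrightarrow> (\<forall>c\<in>T. coord e v c = 0) \<Longrightarrow> v = 0"
  shows "count_upto P c \<le> count_upto T c"
proof -
  let ?A = "T \<inter> {1..c}" and ?B = "{1..c}"
  have B: "?B \<subseteq> V" using c by (auto simp: V_eq)
  have sub: "vec.subspace (\<Sigma> \<inter> flag c)"
    using cell_subspace[OF \<Sigma>] subspace_flag by (intro vec.subspace_inter) auto
  have inj': "v = 0" if v: "v \<in> \<Sigma> \<inter> flag c" "\<forall>d\<in>?A. coord e v d = 0" for v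
  proof (rule inj)
    show "v \<in> \<Sigma>" using v by simp
    show "\<forall>d\<in>T. coord e v d = 0"
    proof
      fix d assume "d \<in> T"
      then show "coord e v d = 0"
        using v assms(2) flag_iff[OF c, of v] by (cases "d \<le> c") (auto simp: V_eq)
    qed
  qed
  have "\<Sigma> \<inter> flag c \<subseteq> vec.span (e ` ?B)" by (auto simp: flag_def)
  note dim = projection_dim[OF sub inj' Int_lower2 B this]
  have "vec.dim (\<Sigma> \<inter> flag c) + card (?B - ?A) \<le> card ?B"
    using dim(1) vec.dim_subset[OF dim(2)] dim_span_basis[OF B] by simp
  moreover have "card ?B = card ?A + card (?B - ?A)"
  proof -
    have "?B - ?A = ?B - T" "?A = ?B \<inter> T" by auto
    then show ?thesis using card_Int_Diff[of ?B T] by simp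
  qed
  ultimately show ?thesis using cell_dim_ge[OF \<Sigma> c] by linarith
qed

section \<open>The form in coordinates, and torus-fixed points\<close>

lemma bilinear_expand:
  assumes "bilinear_form \<omega>"
  shows "\<omega> u v = (\<Sum>c\<in>V. \<Sum>d\<in>V. coord e u c * coord e v d * \<omega> (e c) (e d))"
proof -
  have lin: "Vector_Spaces.linear (*s) (*) (\<lambda>v. \<omega> u v)" "Vector_Spaces.linear (*s) (*) (\<lambda>u. \<omega> u v)" for u v
    using assms by (auto simp: bilinear_form_def)
  have right: "\<omega> u v = (\<Sum>d\<in>V. coord e v d * \<omega> u (e d))" for u v
  proof -
    interpret r: Vector_Spaces.linear "(*s)" "(*)" "\<lambda>v. \<omega> u v" by (rule lin)
    have "\<omega> u v = \<omega> u (\<Sum>d\<in>V. coord e v d *s e d)"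
      using vector_coord[of v] by (simp add: vector_def)
    then show ?thesis by (simp add: r.sum r.scale)
  qed
  have left: "\<omega> u v = (\<Sum>c\<in>V. coord e u c * \<omega> (e c) v)" for u v
  proof -
    interpret l: Vector_Spaces.linear "(*s)" "(*)" "\<lambda>u. \<omega> u v" by (rule lin)
    have "\<omega> u v = \<omega> (\<Sum>c\<in>V. coord e u c *s e c) v"
      using vector_coord[of u] by (simp add: vector_def)
    then show ?thesis by (simp add: l.sum l.scale)
  qed
  have "\<omega> u v = (\<Sum>c\<in>V. coord e u c * (\<Sum>d\<in>V. coord e v d * \<omega> (e c) (e d)))"
    by (subst left, subst right) (rule refl)
  then show ?thesis by (simp add: sum_distrib_left mult.assoc)
qed

lemma basis_form:
  fixes \<omega> :: "complex ^ 'n \<Rightarrow> complex ^ 'n \<Rightarrow> complex"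
  assumes "\<forall>u v. \<omega> v u = \<omega> u v \<or> \<omega> v u = - \<omega> u v"
    and "\<forall>i\<in>V. \<forall>j\<in>{i..CARD('n)}. \<omega> (e i) (e j) = (if i + j = CARD('n) + 1 then 1 else 0)"
    and "i \<in> V" "j \<in> V" "i + j \<noteq> CARD('n) + 1"
  shows "\<omega> (e i) (e j) = 0"
proof -
  have "\<omega> (e a) (e b) = 0" if "a \<in> V" "b \<in> V" "a \<le> b" "a + b \<noteq> CARD('n) + 1" for a b
  proof -
    have "b \<in> {a..CARD('n)}" using that by (simp add: V_eq)
    then show ?thesis using assms(2) that by auto
  qed
  then have "\<omega> (e i) (e j) = 0 \<or> \<omega> (e j) (e i) = 0"
    using assms(3-5) by (cases "i \<le> j") (auto simp: add.commute)
  moreover have "\<omega> (e i) (e j) = \<omega> (e j) (e i) \<or> \<omega> (e i) (e j) = - \<omega> (e j) (e i)"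
    using assms(1) by blast
  ultimately show ?thesis by (elim disjE) simp_all
qed

lemma fixed_point_in_cell:
  assumes bil: "bilinear_form \<omega>"
    and zero: "\<And>i j. i \<in> V \<Longrightarrow> j \<in> V \<Longrightarrow> i + j \<noteq> CARD('n) + 1 \<Longrightarrow> \<omega> (e i) (e j) = 0"
    and T: "T \<in> schubert_symbols (CARD('n)) m"
  shows "vec.span (e ` T) \<in> schubert_cell \<omega> e m T"
proof -
  have TV: "T \<subseteq> V" and card_T: "card T = m" and iso: "\<And>c d. c \<in> T \<Longrightarrow> d \<in> T \<Longrightarrow> c + d \<noteq> CARD('n) + 1"
    using T by (auto simp: schubert_symbols_def V_eq)
  let ?S = "vec.span (e ` T)"
  have "\<omega> u v = 0" if uv: "u \<in> ?S" "v \<in> ?S" for u v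
  proof -
    have "coord e u c * coord e v d * \<omega> (e c) (e d) = 0" if cd: "c \<in> V" "d \<in> V" for c d
    proof (cases "c \<in> T \<and> d \<in> T")
      case True
      then show ?thesis using zero[OF cd] iso by simp
    next
      case False
      then have "coord e u c = 0 \<or> coord e v d = 0"
        using uv cd unfolding span_basis_iff[OF TV] by blast
      then show ?thesis by auto
    qed
    then show ?thesis
      by (subst bilinear_expand[OF bil]) (intro sum.neutral ballI)
  qed
  then have "?S \<in> IG \<omega> m"
    using dim_span_basis[OF TV] card_T by (simp add: IG_def grassmannian_def)
  moreover have "{c \<in> {1..CARD('n)}. ?S \<inter> vec.span (e ` {1..c - 1}) \<subset> ?S \<inter> vec.span (e ` {1..c})} = T"
  proof -
    have jump: "?S \<inter> flag (c - 1) \<subset> ?S \<inter> flag c \<longleftrightarrow> c \<in> T" if c: "c \<in> V" for c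
    proof -
      have c1: "1 \<le> c" "c \<le> CARD('n)" "c - 1 \<le> CARD('n)" "c - 1 < c" using c by (auto simp: V_eq)
      have sub: "flag (c - 1) \<subseteq> flag c"
        unfolding flag_def by (intro vec.span_mono image_mono) auto
      show ?thesis
      proof
        assume "c \<in> T"
        then have "e c \<in> ?S" by (intro vec.span_base) auto
        moreover have "e c \<in> flag c" unfolding flag_def using c1 by (intro vec.span_base) auto
        moreover have "e c \<notin> flag (c - 1)"
        proof
          assume "e c \<in> flag (c - 1)"
          then have "coord e (e c) c = 0" unfolding flag_iff[OF c1(3)] using c c1(4) by blast
          then show False using coord_basis[OF c c] by simp
        qed
        ultimately show "?S \<inter> flag (c - 1) \<subset> ?S \<inter> flag c" using sub by blast
      next
        assume strict: "?S \<inter> flag (c - 1) \<subset> ?S \<inter> flag c"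
        then obtain v where v: "v \<in> ?S" "v \<in> flag c" "v \<notin> flag (c - 1)" by blast
        show "c \<in> T"
        proof (rule ccontr)
          assume "c \<notin> T"
          then have "coord e v c = 0" using v(1) span_basis_iff[OF TV] c by blast
          moreover have "coord e v d = 0" if "d \<in> V" "c < d" for d
            using v(2) that unfolding flag_iff[OF c1(2)] by blast
          moreover have "d = c \<or> c < d" if "c - 1 < d" for d using that by linarith
          ultimately have "\<forall>d\<in>V. c - 1 < d \<longrightarrow> coord e v d = 0" by blast
          then show False using v(3) unfolding flag_iff[OF c1(3)] by blast
        qed
      qed
    qed
    have "{c \<in> V. ?S \<inter> flag (c - 1) \<subset> ?S \<inter> flag c} = T" using jump TV by blast
    then show ?thesis unfolding flag_def V_eq .
  qed
  ultimately show ?thesis unfolding schubert_cell_def by blast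
qed

lemma fixed_point_frame:
  assumes "T \<subseteq> V" "card T = m"
  shows "is_frame m (\<lambda>j. e (entry (CARD('n)) T j)) (vec.span (e ` T))"
    and "pluecker e m (\<lambda>j. e (entry (CARD('n)) T j)) T = 1"
proof -
  let ?t = "entry (CARD('n)) T"
  have fin: "finite T" using assms(1) finite_V by (rule finite_subset)
  have img: "?t ` {1..m} = T" using entry_image[OF fin] assms(2) by blast
  have inj: "inj_on ?t {1..m}" using entry_inj[OF fin] assms(2) by blast
  have t: "?t j \<in> V" if "j \<in> {1..m}" for j using img that assms(1) by blast
  have "(\<lambda>j. e (?t j)) ` {1..m} = e ` T" using img by (simp add: image_image[symmetric])
  moreover have "inj_on (\<lambda>j. e (?t j)) {1..m}"
    using comp_inj_on[OF inj, of e] inj_on_subset[OF inj_e assms(1)] img by (simp add: comp_def)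
  moreover have "vec.independent (e ` T)"
    using vec.independent_mono[OF independent_e image_mono[OF assms(1)]] .
  ultimately show "is_frame m (\<lambda>j. e (?t j)) (vec.span (e ` T))"
    unfolding is_frame_def by simp
  have "(\<Prod>j = 1..m. coord e (e (?t (\<pi> j))) (?t j)) = 0" if \<pi>: "\<pi> permutes {1..m}" "\<pi> \<noteq> id" for \<pi>
  proof -
    obtain j where j: "\<pi> j \<noteq> j" using \<pi>(2) by (metis eq_id_iff)
    then have jm: "j \<in> {1..m}" using \<pi>(1) by (metis permutes_not_in)
    then have "\<pi> j \<in> {1..m}" using \<pi>(1) permutes_in_image by metis
    then have "?t j \<noteq> ?t (\<pi> j)" using inj jm j inj_onD by metis
    then have "coord e (e (?t (\<pi> j))) (?t j) = 0"
      using coord_basis[OF t[OF \<open>\<pi> j \<in> {1..m}\<close>] t[OF jm]] by simp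
    then show ?thesis using jm by (intro prod_zero) auto
  qed
  then have "pluecker e m (\<lambda>j. e (?t j)) T =
      (\<Sum>\<pi> | \<pi> permutes {1..m}. if \<pi> = id then (\<Prod>j = 1..m. coord e (e (?t j)) (?t j)) else 0)"
    unfolding pluecker_def by (intro sum.cong) auto
  also have "\<dots> = (\<Prod>j = 1..m. coord e (e (?t j)) (?t j))"
    by (simp add: finite_permutations permutes_id)
  also have "\<dots> = 1"
    using coord_basis[OF t t] by (intro prod.neutral) auto
  finally show "pluecker e m (\<lambda>j. e (?t j)) T = 1" .
qed

lemma schubert_le_cell_point:
  assumes "bilinear_form \<omega>"
    and "\<And>i j. i \<in> V \<Longrightarrow> j \<in> V \<Longrightarrow> i + j \<noteq> CARD('n) + 1 \<Longrightarrow> \<omega> (e i) (e j) = 0"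
    and T: "T \<in> schubert_symbols (CARD('n)) m" and le: "schubert_le \<omega> e m T P"
  shows "\<exists>\<Sigma> b. \<Sigma> \<in> schubert_cell \<omega> e m P \<and> is_frame m b \<Sigma> \<and> pluecker e m b T \<noteq> 0"
proof -
  let ?S = "vec.span (e ` T)" and ?G = "grassmannian_zariski e m"
  have cell: "?S \<in> schubert_cell \<omega> e m T"
    by (rule fixed_point_in_cell[OF assms(1-3)])
  have TV: "T \<subseteq> V" "card T = m" using T by (auto simp: schubert_symbols_def V_eq)
  define U where "U = {\<Sigma> \<in> grassmannian m. \<exists>b. is_frame m b \<Sigma> \<and> cpoly_eval (cpoly_var T) (pluecker e m b) \<noteq> 0}"
  have "cpoly_var T \<in> cpoly_ring {I. I \<subseteq> {1..CARD('n)} \<and> card I = m}"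
    using TV by (intro cpoly_ring_var) (simp add: V_eq)
  then have "openin ?G U"
    unfolding grassmannian_zariski_def U_def
    by (intro topology_generated_by_Basis CollectI exI conjI) (auto intro: homogeneous_var)
  then have open_U: "openin (subtopology ?G (IG \<omega> m)) (U \<inter> IG \<omega> m)"
    unfolding openin_subtopology by blast
  have "?S \<in> IG \<omega> m" using cell unfolding schubert_cell_def by blast
  moreover have "?S \<in> U"
    unfolding U_def cpoly_eval_var
  proof (intro CollectI conjI exI)
    show "?S \<in> grassmannian m" using \<open>?S \<in> IG \<omega> m\<close> by (simp add: IG_def)
    show "is_frame m (\<lambda>j. e (entry CARD('n) T j)) ?S" by (rule fixed_point_frame[OF TV])
    show "pluecker e m (\<lambda>j. e (entry CARD('n) T j)) T \<noteq> 0"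
      unfolding fixed_point_frame(2)[OF TV] by simp
  qed
  ultimately have SU: "?S \<in> U \<inter> IG \<omega> m" by blast
  then have "?S \<in> topspace (subtopology ?G (IG \<omega> m))"
    using openin_subset[OF open_U] by blast
  then have "?S \<in> schubert_variety \<omega> e m T"
    using cell unfolding schubert_variety_def in_closure_of by blast
  then have "?S \<in> schubert_variety \<omega> e m P"
    using le unfolding schubert_le_def by blast
  then obtain \<Sigma> where "\<Sigma> \<in> schubert_cell \<omega> e m P" "\<Sigma> \<in> U \<inter> IG \<omega> m"
    using open_U SU unfolding schubert_variety_def in_closure_of by blast
  then show ?thesis unfolding U_def cpoly_eval_var by blast
qed

text \<open>
  On the isotropic space \<open>\<Sigma>\<close> below, \<open>\<Sum>\<^sub>t u\<^sub>t v\<^sub>N\<^sub>+\<^sub>1\<^sub>-\<^sub>t\<close> would be a nondegenerate skew form, although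
  \<open>\<Sigma>\<close> has odd dimension. This reflects the two families of maximal isotropic subspaces in type D.
\<close>

lemma odd_maximal_isotropic_contradiction:
  assumes bil: "bilinear_form \<omega>" and sym: "symmetric_form \<omega>"
    and form: "\<forall>i\<in>V. \<forall>j\<in>{i..CARD('n)}. \<omega> (e i) (e j) = (if i + j = CARD('n) + 1 then 1 else 0)"
    and T: "T \<in> schubert_symbols (CARD('n)) m" and "odd m"
    and P: "P = (\<lambda>c. CARD('n) + 1 - c) ` T" and interval: "T \<union> P = {b..CARD('n) + 1 - b}"
    and \<Sigma>: "\<Sigma> \<in> schubert_cell \<omega> e m P" and frame: "is_frame m \<beta> \<Sigma>"
    and inj: "\<And>v. v \<in> \<Sigma> \<Longrightarrow> (\<forall>c\<in>T. coord e v c = 0) \<Longrightarrow> v = 0"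
  shows False
proof -
  let ?N = "CARD('n)"
  have TV: "T \<subseteq> V" and card_T: "card T = m" and iso: "\<And>c d. c \<in> T \<Longrightarrow> d \<in> T \<Longrightarrow> c + d \<noteq> ?N + 1"
    using T by (auto simp: schubert_symbols_def V_eq)
  have finT: "finite T" using TV finite_V by (rule finite_subset)
  have le_N: "1 \<le> c \<and> c \<le> ?N" if "c \<in> T" for c using that TV by (auto simp: V_eq)
  have PV: "P \<subseteq> V"
  proof
    fix d assume "d \<in> P"
    then obtain c where "c \<in> T" "d = ?N + 1 - c" unfolding P by blast
    then show "d \<in> V" using le_N[of c] unfolding V_eq atLeastAtMost_iff by linarith
  qed
  have disj: "T \<inter> P = {}"
  proof -
    have False if "c \<in> T" "d \<in> T" "c = ?N + 1 - d" for c d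
      using iso[OF that(1,2)] le_N[OF that(2)] that(3) by linarith
    then show ?thesis unfolding P by blast
  qed
  have inj_mirror: "inj_on (\<lambda>c. ?N + 1 - c) T"
  proof (rule inj_onI)
    fix c d assume "c \<in> T" "d \<in> T" "?N + 1 - c = ?N + 1 - d"
    then show "c = d" using le_N[of c] le_N[of d] by linarith
  qed
  \<comment> \<open>Leading coordinates lie in \<open>P\<close>, hence in the interval, so vectors
    of \<open>\<Sigma>\<close> have no coordinates beyond it.\<close>
  have above: "coord e v d = 0" if v: "v \<in> \<Sigma>" and d: "d \<in> V" "?N + 1 - b < d" for v d
  proof (cases "v = 0")
    case False
    obtain c where "c \<in> P" "\<forall>d\<in>V. c < d \<longrightarrow> coord e v d = 0"
      using cell_leading_coordinate[OF \<Sigma> v False] by blast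
    moreover then have "c \<le> ?N + 1 - b" using interval by auto
    ultimately show ?thesis using d by auto
  qed simp
  \<comment> \<open>\<open>B\<close> is one half of the form: on \<open>\<Sigma>\<close> the form is
    \<open>B\<close> plus its transpose, so isotropy makes \<open>B\<close> skew-symmetric. As
    \<open>m\<close> is odd, \<open>B\<close> has a nonzero vector \<open>u\<close> in its
    kernel.\<close>
  define B where "B u v = (\<Sum>c\<in>T. coord e u c * coord e v (?N + 1 - c))" for u v
  have form_value: "\<omega> (e c) (e d) = (if d = ?N + 1 - c then 1 else 0)" if cd: "c \<in> V" "d \<in> V" for c d
  proof -
    have "\<omega> (e a) (e b) = (if a + b = ?N + 1 then 1 else 0)" if "a \<in> V" "b \<in> V" "a \<le> b" for a b
    proof -
      have "b \<in> {a..?N}" using that by (simp add: V_eq)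
      then show ?thesis using form that(1) by blast
    qed
    moreover have "\<omega> (e c) (e d) = \<omega> (e d) (e c)" using sym unfolding symmetric_form_def by blast
    ultimately have "\<omega> (e c) (e d) = (if c + d = ?N + 1 then 1 else 0)"
      using cd by (cases "c \<le> d") (simp_all add: add.commute)
    moreover have "c + d = ?N + 1 \<longleftrightarrow> d = ?N + 1 - c" using cd by (auto simp: V_eq)
    ultimately show ?thesis by simp
  qed
  have \<omega>_B: "\<omega> u v = B u v + B v u" if uv: "u \<in> \<Sigma>" "v \<in> \<Sigma>" for u v
  proof -
    have "\<omega> u v = (\<Sum>c\<in>V. \<Sum>d\<in>V. if d = ?N + 1 - c then coord e u c * coord e v d else 0)"
      by (subst bilinear_expand[OF bil]) (intro sum.cong refl, simp add: form_value)
    also have "\<dots> = (\<Sum>c\<in>V. coord e u c * coord e v (?N + 1 - c))"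
      by (intro sum.cong refl) (auto simp: V_eq)
    also have "\<dots> = (\<Sum>c\<in>T \<union> P. coord e u c * coord e v (?N + 1 - c))"
    proof (intro sum.mono_neutral_right ballI)
      show "T \<union> P \<subseteq> V" using TV PV by blast
      fix c assume c: "c \<in> V - (T \<union> P)"
      then have "c < b \<or> ?N + 1 - b < c" unfolding interval by auto
      then show "coord e u c * coord e v (?N + 1 - c) = 0"
      proof
        assume "c < b"
        then have "?N + 1 - c \<in> V" "?N + 1 - b < ?N + 1 - c" using c by (auto simp: V_eq)
        then show ?thesis using above[OF uv(2)] by simp
      next
        assume "?N + 1 - b < c"
        then show ?thesis using above[OF uv(1)] c by simp
      qed
    qed simp
    also have "\<dots> = B u v + (\<Sum>c\<in>P. coord e u c * coord e v (?N + 1 - c))"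
      unfolding B_def using finT P disj by (intro sum.union_disjoint) auto
    also have "(\<Sum>c\<in>P. coord e u c * coord e v (?N + 1 - c)) =
        (\<Sum>c\<in>T. coord e u (?N + 1 - c) * coord e v (?N + 1 - (?N + 1 - c)))"
      unfolding P by (simp only: sum.reindex[OF inj_mirror] comp_def)
    also have "\<dots> = B v u"
      unfolding B_def
    proof (intro sum.cong refl)
      fix c assume "c \<in> T"
      then have "?N + 1 - (?N + 1 - c) = c" using le_N[of c] by simp
      then show "coord e u (?N + 1 - c) * coord e v (?N + 1 - (?N + 1 - c)) =
          coord e v c * coord e u (?N + 1 - c)" by (simp only: mult.commute)
    qed
    finally show ?thesis .
  qed
  have frame_in: "\<beta> k \<in> \<Sigma>" if "k \<in> {1..m}" for k
    using frame that unfolding is_frame_def by (auto intro: vec.span_base)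
  have skew: "B (\<beta> j) (\<beta> i) = - B (\<beta> i) (\<beta> j)" if "i \<in> {1..m}" "j \<in> {1..m}" for i j
  proof -
    have "\<omega> (\<beta> i) (\<beta> j) = 0" using cell_isotropic[OF \<Sigma>] frame_in that by blast
    then show ?thesis using \<omega>_B[OF frame_in[OF that(1)] frame_in[OF that(2)]] by (simp add: add_eq_0_iff)
  qed
  have "m \<le> ?N" using card_mono[OF finite_V TV] card_T by (simp add: V_eq)
  then have "\<exists>x. (\<exists>k\<in>{1..m}. x k \<noteq> 0) \<and> (\<forall>i\<in>{1..m}. (\<Sum>j = 1..m. B (\<beta> i) (\<beta> j) * x j) = 0)"
    by (rule odd_skew_singular[OF \<open>odd m\<close>]) (rule skew)
  then obtain x where x: "\<exists>k\<in>{1..m}. x k \<noteq> 0" "\<And>i. i \<in> {1..m} \<Longrightarrow> (\<Sum>j = 1..m. B (\<beta> i) (\<beta> j) * x j) = 0"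
    by blast
  define u where "u = (\<Sum>j = 1..m. x j *s \<beta> j)"
  have sub: "vec.subspace \<Sigma>" "vec.dim \<Sigma> = m" using cell_subspace[OF \<Sigma>] by auto
  have u_in: "u \<in> \<Sigma>" unfolding u_def
    using sub(1) frame_in by (intro vec.subspace_sum vec.subspace_scale) auto
  have "u \<noteq> 0"
  proof
    assume "u = 0"
    have inj_\<beta>: "inj_on \<beta> {1..m}" using frame by (simp add: is_frame_def)
    define w where "w v = x (the_inv_into {1..m} \<beta> v)" for v
    have w: "w (\<beta> j) = x j" if "j \<in> {1..m}" for j
      using the_inv_into_f_f[OF inj_\<beta> that] by (simp add: w_def)
    have "(\<Sum>v\<in>\<beta> ` {1..m}. w v *s v) = u"
      unfolding u_def sum.reindex[OF inj_\<beta>] using w by (intro sum.cong) auto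
    then have sum0: "(\<Sum>v\<in>\<beta> ` {1..m}. w v *s v) = 0" using \<open>u = 0\<close> by simp
    have "vec.independent (\<beta> ` {1..m})" using frame by (simp add: is_frame_def)
    then have "w v = 0" if "v \<in> \<beta> ` {1..m}" for v
      using vec.independentD[OF _ _ order_refl sum0 that] by simp
    then show False using x(1) w by auto
  qed
  have B_frame: "B (\<beta> i) u = 0" if "i \<in> {1..m}" for i
  proof -
    have "B (\<beta> i) u = (\<Sum>j = 1..m. B (\<beta> i) (\<beta> j) * x j)"
      unfolding u_def B_def by (simp add: sum_distrib_left sum_distrib_right mult_ac) (rule sum.swap)
    then show ?thesis using x(2)[OF that] by simp
  qed
  have B_u: "B v u = 0" if v: "v \<in> \<Sigma>" for v
  proof -
    obtain a where "v = (\<Sum>k = 1..m. a k *s \<beta> k)" using frame_combination[OF frame v] by blast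
    then have "B v u = (\<Sum>k = 1..m. a k * B (\<beta> k) u)"
      unfolding B_def by (simp add: sum_distrib_left sum_distrib_right mult_ac) (rule sum.swap)
    then show ?thesis using B_frame by simp
  qed
  \<comment> \<open>The projection of \<open>\<Sigma>\<close> to the coordinates in \<open>T\<close>
    is injective and \<open>dim \<Sigma> = card T\<close>, so it is also surjective: every unit
    vector is the image of some \<open>w\<close> in \<open>\<Sigma>\<close>, and
    \<open>B w u\<close> reads off a coordinate of \<open>u\<close>.\<close>
  have "\<Sigma> \<subseteq> vec.span (e ` V)" by (simp add: span_e)
  note dim = projection_dim[OF sub(1) inj TV order_refl this]
  have "card (V - T) = ?N - m" using card_Diff_subset[OF finT TV] card_T by (simp add: V_eq)
  then have "vec.dim {x + y | x y. x \<in> \<Sigma> \<and> y \<in> vec.span (e ` (V - T))} = ?N"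
    using dim(1) sub(2) \<open>m \<le> ?N\<close> by simp
  moreover have "vec.subspace {x + y | x y. x \<in> \<Sigma> \<and> y \<in> vec.span (e ` (V - T))}"
    by (rule vec.subspace_sums[OF sub(1) vec.subspace_span])
  moreover have "vec.dim (vec.span (e ` V)) = ?N" using dim_span_basis[OF order_refl] by (simp add: V_eq)
  ultimately have all: "{x + y | x y. x \<in> \<Sigma> \<and> y \<in> vec.span (e ` (V - T))} = vec.span (e ` V)"
    using vec.subspace_dim_equal[OF _ vec.subspace_span dim(2)] by simp
  have u_P: "coord e u (?N + 1 - c) = 0" if c: "c \<in> T" for c
  proof -
    have "e c \<in> vec.span (e ` V)" by (simp add: span_e)
    then obtain w y where wy: "e c = w + y" "w \<in> \<Sigma>" "y \<in> vec.span (e ` (V - T))"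
      unfolding all[symmetric] by blast
    have w: "coord e w d = (if d = c then 1 else 0)" if d: "d \<in> T" for d
    proof -
      have "coord e y d = 0" using wy(3) span_basis_iff[of "V - T" y] d TV by blast
      moreover have "coord e (e c) d = coord e w d + coord e y d" by (simp add: wy(1))
      moreover have "c \<in> V" "d \<in> V" using c d TV by auto
      ultimately show ?thesis using coord_basis[of c d] by simp
    qed
    have "B w u = (\<Sum>d\<in>T. if d = c then coord e u (?N + 1 - d) else 0)"
      unfolding B_def using w by (intro sum.cong) auto
    also have "\<dots> = coord e u (?N + 1 - c)" using finT c by simp
    finally show ?thesis using B_u[OF wy(2)] by simp
  qed
  \<comment> \<open>All coordinates of \<open>u\<close> in \<open>P\<close> vanish, but the leading
    coordinate of a nonzero vector of the cell lies in \<open>P\<close>.\<close>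
  obtain c where "c \<in> P" "coord e u c \<noteq> 0"
    using cell_leading_coordinate[OF \<Sigma> u_in \<open>u \<noteq> 0\<close>] by blast
  then show False using u_P unfolding P by blast
qed

end

section \<open>The equations of the projected Richardson variety\<close>

context symbol_pair
begin

section \<open>Gaps between consecutive elements of \<open>Q\<close>\<close>

definition next_Q :: "nat \<Rightarrow> nat" where
  "next_Q c = (LEAST d. d \<in> Q \<and> c < d)"

text \<open>A gap is represented by its left end. Requiring \<open>consecutive_in\<close> ensures
  that \<open>Q\<close> has an element above \<open>c\<close>, without which \<open>next_Q c\<close>
  would be meaningless.\<close>

definition gaps :: "nat set" where
  "gaps = {c. consecutive_in Q c (next_Q c) \<and> next_Q c - c \<ge> 2}"

text \<open>Folding names the pair of variables \<open>x\<^sub>i\<close>,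
  \<open>x\<^sub>N\<^sub>+\<^sub>1\<^sub>-\<^sub>i\<close> by its smaller index. The pairs occurring
  in the quadric of a gap then form an interval.\<close>

definition mirror_fold :: "nat \<Rightarrow> nat" where
  "mirror_fold i = min i (N + 1 - i)"

text \<open>The variables of the quadric other than those of its first product, whose folded index
  is \<open>c + 1\<close>.\<close>

definition gap_rest :: "nat \<Rightarrow> nat set" where
  "gap_rest c = {i \<in> {1..N}. c + 2 \<le> mirror_fold i \<and> mirror_fold i \<le> next_Q c}"

abbreviation f :: "nat \<Rightarrow> nat cpoly" where
  "f \<equiv> quadric \<tau> N n"

definition gap_form :: "nat \<Rightarrow> nat cpoly" where
  "gap_form c = f (next_Q c) - f (c + 1)"

lemma next_Q_eq:
  assumes "consecutive_in Q c d"
  shows "next_Q c = d"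
  unfolding next_Q_def
proof (rule Least_equality)
  show "d \<in> Q \<and> c < d" using assms by (simp add: consecutive_in_def)
  fix q assume "q \<in> Q \<and> c < q"
  then show "d \<le> q" using assms unfolding consecutive_in_def by (metis not_le)
qed

lemma gaps_iff: "consecutive_in Q c d \<and> d - c \<ge> 2 \<longleftrightarrow> c \<in> gaps \<and> d = next_Q c"
  unfolding gaps_def using next_Q_eq by blast

lemma Q_bound: "d \<in> Q \<Longrightarrow> 2 * d \<le> N + 1 \<and> d \<le> n + 1 \<and> (\<tau> = Type_C \<longrightarrow> d \<le> n)"
proof -
  assume "d \<in> Q"
  then have "d \<le> n \<or> d = n + 1 \<and> \<tau> \<noteq> Type_C" unfolding Q_iff by blast
  moreover have "2 * n + 1 \<le> N \<or> \<tau> = Type_C \<and> N = 2 * n" using N_eq by (cases \<tau>) simp_all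
  ultimately show ?thesis by auto
qed

lemma gap:
  assumes "c \<in> gaps"
  shows "c \<in> Q" "next_Q c \<in> Q" "c + 2 \<le> next_Q c" "2 * next_Q c \<le> N + 1" "next_Q c \<le> n + 1"
    "\<And>q. q \<in> Q \<Longrightarrow> c < q \<Longrightarrow> next_Q c \<le> q"
proof -
  have cons: "consecutive_in Q c (next_Q c)" "next_Q c - c \<ge> 2" using assms by (auto simp: gaps_def)
  then show "c \<in> Q" and Q: "next_Q c \<in> Q" and "c + 2 \<le> next_Q c" by (auto simp: consecutive_in_def)
  then show "2 * next_Q c \<le> N + 1" "next_Q c \<le> n + 1" using Q_bound[OF Q] by blast+
  show "next_Q c \<le> q" if "q \<in> Q" "c < q" for q
    using cons(1) that unfolding consecutive_in_def by (metis not_le)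
qed

text \<open>If \<open>k\<close> or its mirror were in \<open>L\<close>, then \<open>k - 1\<close>
  and \<open>k\<close> would both belong to \<open>Q\<close>, which is impossible within a gap of
  length at least 2.\<close>

lemma gap_not_L:
  assumes c: "c \<in> gaps" and k: "c < k" "k \<le> next_Q c"
  shows "k \<notin> L" "N + 1 - k \<notin> L"
proof -
  have k2: "k \<le> N + 1 - k" "N + 1 - (N + 1 - k) = k" using gap(4)[OF c] k by linarith+
  have contra: "\<not> (k \<in> Q \<and> k - 1 \<in> Q)"
  proof
    assume Q: "k \<in> Q \<and> k - 1 \<in> Q"
    then have "k = next_Q c" using gap(6)[OF c, of k] k by simp
    then have "c < k - 1" "k - 1 < next_Q c" using gap(3)[OF c] by linarith+
    then show False using gap(6)[OF c, of "k - 1"] Q by linarith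
  qed
  show "k \<notin> L" using L_Q[of k k] k2(1) contra by blast
  show "N + 1 - k \<notin> L" using L_Q[of "N + 1 - k" k] k2 contra by metis
qed

lemma gap_unique:
  assumes "c \<in> gaps" "c' \<in> gaps" "c < k" "k \<le> next_Q c" "c' < k" "k \<le> next_Q c'"
  shows "c = c'"
proof (rule ccontr)
  assume "c \<noteq> c'"
  then consider "c < c'" | "c' < c" by linarith
  then show False
  proof cases
    case 1
    then show False using gap(6)[OF assms(1) gap(1)[OF assms(2)]] assms by linarith
  next
    case 2
    then show False using gap(6)[OF assms(2) gap(1)[OF assms(1)]] assms by linarith
  qed
qed

text \<open>The difference of \<open>f d\<close> and \<open>f c\<close> written without
  cancellation, including the half square of the middle variable in type B.\<close>

definition tail :: "nat \<Rightarrow> nat \<Rightarrow> nat cpoly" where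
  "tail c d = (if \<tau> = Type_B \<and> d = n + 1
     then (\<Sum>i = c + 1..n. cpoly_var i * cpoly_var (N + 1 - i)) + cpoly_const (1 / 2) * cpoly_var (n + 1) ^ 2
     else (\<Sum>i = c + 1..d. cpoly_var i * cpoly_var (N + 1 - i)))"

lemma f_tail:
  assumes "c < d" "d \<le> n + 1"
  shows "f d = f c + tail c d"
proof -
  have split: "(\<Sum>i = 1..b. g i) = (\<Sum>i = 1..c. g i) + (\<Sum>i = c + 1..b. g i)" if "c \<le> b"
    for b and g :: "nat \<Rightarrow> nat cpoly"
    using sum.ub_add_nat[of 1 c g "b - c"] that by simp
  have "c \<noteq> n + 1" using assms by simp
  then have c: "f c = (\<Sum>i = 1..c. cpoly_var i * cpoly_var (N + 1 - i))" by (simp add: quadric_def)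
  show ?thesis
  proof (cases "\<tau> = Type_B \<and> d = n + 1")
    case True
    then show ?thesis
      using split[of n "\<lambda>i. cpoly_var i * cpoly_var (N + 1 - i)"] assms(1)
      unfolding c quadric_def tail_def if_P[OF True] by simp
  next
    case False
    then have "f d = (\<Sum>i = 1..d. cpoly_var i * cpoly_var (N + 1 - i))"
      unfolding quadric_def by (rule if_not_P)
    then show ?thesis
      using split[of d "\<lambda>i. cpoly_var i * cpoly_var (N + 1 - i)"] assms(1)
      unfolding c tail_def if_not_P[OF False] by simp
  qed
qed

lemma gap_form_tail:
  assumes "c \<in> gaps"
  shows "gap_form c = tail (c + 1) (next_Q c)"
  using f_tail[of "c + 1" "next_Q c"] gap(3,5)[OF assms] by (simp add: gap_form_def)

lemma gap_quadric:
  assumes "c \<in> gaps"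
  shows "cpoly_var (c + 1) * cpoly_var (N - c) + gap_form c = f (next_Q c) - f c"
proof -
  have "\<not> (\<tau> = Type_B \<and> c + 1 = n + 1)" "c + 1 \<le> n + 1" using gap(3,5)[OF assms] by auto
  then have "f (c + 1) = f c + cpoly_var (c + 1) * cpoly_var (N - c)"
    using f_tail[of c "c + 1"] by (auto simp: tail_def)
  then show ?thesis by (simp add: gap_form_def algebra_simps)
qed

lemma gap_rest_mem:
  assumes c: "c \<in> gaps" and i: "c + 2 \<le> i" "i \<le> next_Q c"
  shows "i \<in> gap_rest c" "N + 1 - i \<in> gap_rest c"
proof -
  have "2 * i \<le> N + 1" using gap(4)[OF c] i by linarith
  then have "i \<in> {1..N}" "N + 1 - i \<in> {1..N}" "mirror_fold i = i" "mirror_fold (N + 1 - i) = i"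
    using i by (auto simp: mirror_fold_def)
  then show "i \<in> gap_rest c" "N + 1 - i \<in> gap_rest c" using i by (simp_all add: gap_rest_def)
qed

lemma gap_rest_fold:
  assumes "i \<in> gap_rest c"
  shows "c + 2 \<le> mirror_fold i" "mirror_fold i \<le> next_Q c" "i \<in> {1..N}"
    "i = mirror_fold i \<or> i = N + 1 - mirror_fold i"
  using assms by (auto simp: gap_rest_def mirror_fold_def min_def)

lemma gap_form_ring_homogeneous:
  assumes c: "c \<in> gaps"
  shows "gap_form c \<in> cpoly_ring (gap_rest c) \<and> homogeneous 2 (gap_form c)"
proof -
  let ?d = "next_Q c"
  have pair: "cpoly_var i * cpoly_var (N + 1 - i) \<in> cpoly_ring (gap_rest c)
      \<and> homogeneous 2 (cpoly_var i * cpoly_var (N + 1 - i))" if "i \<in> {c + 1 + 1..?d}" for i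
  proof
    have "c + 2 \<le> i" "i \<le> ?d" using that by auto
    then show "cpoly_var i * cpoly_var (N + 1 - i) \<in> cpoly_ring (gap_rest c)"
      by (intro cpoly_ring_mult cpoly_ring_var gap_rest_mem[OF c])
    show "homogeneous 2 (cpoly_var i * cpoly_var (N + 1 - i) :: nat cpoly)"
      using homogeneous_mult[OF homogeneous_var[of i] homogeneous_var[of "N + 1 - i"]] by (simp add: numeral_2_eq_2)
  qed
  show ?thesis
  proof (cases "\<tau> = Type_B \<and> ?d = n + 1")
    case True
    have "c + 2 \<le> n + 1" "n + 1 \<le> ?d" using gap(3)[OF c] True by auto
    then have "cpoly_const (1 / 2) * cpoly_var (n + 1) ^ 2 \<in> cpoly_ring (gap_rest c)"
      by (intro cpoly_ring_mult cpoly_ring_power cpoly_ring_var cpoly_ring_const gap_rest_mem[OF c])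
    moreover have "homogeneous 2 (cpoly_const (1 / 2) * cpoly_var (n + 1) ^ 2 :: nat cpoly)"
      using homogeneous_mult[OF homogeneous_const homogeneous_power[OF homogeneous_var, of 2]]
      by (simp add: numeral_2_eq_2)
    ultimately show ?thesis
      unfolding gap_form_tail[OF c] tail_def if_P[OF True]
      using pair True by (intro conjI cpoly_ring_add cpoly_ring_sum homogeneous_add homogeneous_sum) auto
  next
    case False
    show ?thesis
      unfolding gap_form_tail[OF c] tail_def if_not_P[OF False]
      using pair by (intro conjI cpoly_ring_sum homogeneous_sum) auto
  qed
qed

text \<open>With all coordinates equal to 1 the form counts its products, and the square in type B
  adds one half.\<close>

lemma gap_form_nonzero:
  assumes c: "c \<in> gaps"
  shows "cpoly_eval (gap_form c) (\<lambda>_. 1) \<noteq> 0"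
proof (cases "\<tau> = Type_B \<and> next_Q c = n + 1")
  case True
  have "cpoly_eval (gap_form c) (\<lambda>_. 1) = of_nat (card {c + 1 + 1..n}) + 1 / 2"
    unfolding gap_form_tail[OF c] tail_def if_P[OF True] by simp
  moreover have "(of_nat k + 1 / 2 :: complex) \<noteq> 0" for k :: nat
  proof
    assume "(of_nat k + 1 / 2 :: complex) = 0"
    then have "Re (of_nat k + 1 / 2) = 0" by (simp only: zero_complex.simps)
    then show False by simp
  qed
  ultimately show ?thesis by metis
next
  case False
  have "cpoly_eval (gap_form c) (\<lambda>_. 1) = of_nat (card {c + 1 + 1..next_Q c})"
    unfolding gap_form_tail[OF c] tail_def if_not_P[OF False] by simp
  moreover have "card {c + 1 + 1..next_Q c} \<noteq> 0" using gap(3)[OF c] by simp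
  ultimately show ?thesis by (metis of_nat_eq_0_iff)
qed

text \<open>The first product of each gap plays the role of \<open>y j\<close> times
  \<open>z j\<close>. All disjointness conditions hold because folding maps the variables of the gap
  \<open>c\<close> into the interval from \<open>c + 1\<close> to \<open>next_Q c\<close>, and these
  intervals are disjoint for different gaps.\<close>

lemma split_quadrics_gaps:
  "split_quadrics {1..N} L gaps (\<lambda>c. c + 1) (\<lambda>c. N - c) gap_rest gap_form"
proof
  have mirror: "N + 1 - (c + 1) = N - c" "c + 1 < N - c" if "c \<in> gaps" for c
    using gap(3,4)[OF that] by linarith+
  show "finite {1..N}" by simp
  show "L \<subseteq> {1..N}" by (auto simp: L_iff)
  have "gaps \<subseteq> {..n + 1}" using gap(3,5) by fastforce
  then show "finite gaps" by (rule finite_subset) simp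
  show "(\<lambda>c. c + 1) ` gaps \<subseteq> {1..N} - L"
  proof clarify
    fix c assume c: "c \<in> gaps"
    then show "c + 1 \<in> {1..N} - L" using gap_not_L(1)[OF c, of "c + 1"] gap(3,4)[OF c] by auto
  qed
  show "(\<lambda>c. N - c) ` gaps \<subseteq> {1..N} - L"
  proof clarify
    fix c assume c: "c \<in> gaps"
    then show "N - c \<in> {1..N} - L"
      using gap_not_L(2)[OF c, of "c + 1"] gap(3,4)[OF c] unfolding mirror(1)[OF c] by auto
  qed
  show "inj_on (\<lambda>c. c + 1) gaps" by (simp add: inj_on_def)
  show "inj_on (\<lambda>c. N - c) gaps"
  proof (rule inj_onI)
    fix c c' assume "c \<in> gaps" "c' \<in> gaps" "N - c = N - c'"
    then show "c = c'" using mirror(2)[of c] mirror(2)[of c'] by linarith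
  qed
  have yz: "mirror_fold (c + 1) = c + 1" "mirror_fold (N - c) = c + 1" if "c \<in> gaps" for c
    using mirror[OF that] by (auto simp: mirror_fold_def)
  show "(\<lambda>c. c + 1) ` gaps \<inter> (\<lambda>c. N - c) ` gaps = {}"
  proof -
    have False if "c \<in> gaps" "c' \<in> gaps" "c + 1 = N - c'" for c c'
    proof -
      have "c + 1 = c' + 1" using yz(1)[OF that(1)] yz(2)[OF that(2)] that(3) by metis
      then show False using mirror(2)[OF that(2)] that(3) by simp
    qed
    then show ?thesis by blast
  qed
  fix c assume c: "c \<in> gaps"
  show "gap_rest c \<subseteq> {1..N} - L - (\<lambda>c. c + 1) ` gaps - (\<lambda>c. N - c) ` gaps"
  proof
    fix i assume i: "i \<in> gap_rest c"
    note fold = gap_rest_fold[OF i]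
    have "i \<notin> L" using gap_not_L[OF c, of "mirror_fold i"] fold by auto
    moreover have "mirror_fold i \<noteq> c' + 1" if "c' \<in> gaps" for c'
    proof
      assume eq: "mirror_fold i = c' + 1"
      have "c = c'"
        by (rule gap_unique[OF c that, of "mirror_fold i"]) (use fold eq gap(3)[OF that] in auto)
      then show False using fold eq by simp
    qed
    then have "i \<notin> (\<lambda>c. c + 1) ` gaps" "i \<notin> (\<lambda>c. N - c) ` gaps" using yz by auto
    ultimately show "i \<in> {1..N} - L - (\<lambda>c. c + 1) ` gaps - (\<lambda>c. N - c) ` gaps" using fold(3) by blast
  qed
  show "gap_form c \<in> cpoly_ring (gap_rest c)" "homogeneous 2 (gap_form c)"
    using gap_form_ring_homogeneous[OF c] by auto
  show "\<exists>a. cpoly_eval (gap_form c) a \<noteq> 0" using gap_form_nonzero[OF c] by blast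
  fix c' assume c': "c' \<in> gaps" and "c \<noteq> c'"
  show "gap_rest c \<inter> gap_rest c' = {}"
  proof -
    have "c = c'" if "i \<in> gap_rest c" "i \<in> gap_rest c'" for i
      by (rule gap_unique[OF c c', of "mirror_fold i"])
         (use gap_rest_fold[OF that(1)] gap_rest_fold[OF that(2)] in auto)
    then show ?thesis using \<open>c \<noteq> c'\<close> by blast
  qed
qed

text \<open>The individual \<open>f d\<close> are recovered from their differences by climbing
  through \<open>Q\<close> from \<open>f 0 = 0\<close>: across a gap by its quadric, across a step
  of length 1 by a linear equation.\<close>

lemma f_eval_zero:
  assumes L: "\<And>c. c \<in> L \<Longrightarrow> a c = 0"
    and gaps: "\<And>c. c \<in> gaps \<Longrightarrow> cpoly_eval (f (next_Q c)) a = cpoly_eval (f c) a"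
    and "d \<in> Q"
  shows "cpoly_eval (f d) a = 0"
  using assms(3)
proof (induction d rule: less_induct)
  case (less d)
  show ?case
  proof (cases "d = 0")
    case True
    then show ?thesis by (simp add: quadric_def)
  next
    case False
    define c where "c = Max {q \<in> Q. q < d}"
    have fin: "finite {q \<in> Q. q < d}" by simp
    have ne: "{q \<in> Q. q < d} \<noteq> {}" using zero_Q False by auto
    have c: "c \<in> Q" "c < d" using Max_in[OF fin ne] by (auto simp: c_def)
    have max: "q \<le> c" if "q \<in> Q" "q < d" for q using Max_ge[OF fin, of q] that by (simp add: c_def)
    have cons: "consecutive_in Q c d"
      unfolding consecutive_in_def using c less.prems max by (meson not_le)
    have zero: "cpoly_eval (f c) a = 0" by (rule less.IH[OF c(2,1)])
    show ?thesis
    proof (cases "d - c \<ge> 2")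
      case True
      then have "c \<in> gaps" "d = next_Q c" using cons gaps_iff by blast+
      then show ?thesis using gaps zero by simp
    next
      case False
      \<comment> \<open>The difference is now a single product with a factor in \<open>L\<close>, or
        in type B, at \<open>d = n + 1\<close>, half the square of the middle variable, which is its
        own mirror.\<close>
      then have d: "d = Suc c" using c(2) by simp
      have "d \<le> n + 1" using Q_bound[OF less.prems] by blast
      then have "cpoly_eval (f d) a = cpoly_eval (tail c d) a" using f_tail[OF c(2)] zero by simp
      moreover have "Suc c \<in> L \<or> N - c \<in> L" using adjacent_Q_L c(1) less.prems d by blast
      then have prod: "a (Suc c) * a (N - c) = 0" using L by auto
      have "cpoly_eval (tail c d) a = 0"
      proof (cases "\<tau> = Type_B \<and> d = n + 1")
        case True
        then have "c = n" "N - c = Suc c" using d N_eq by simp_all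
        then have "a (n + 1) = 0" using prod by simp
        then show ?thesis unfolding tail_def if_P[OF True] using \<open>c = n\<close> by simp
      next
        case False
        then show ?thesis unfolding tail_def if_not_P[OF False] using d prod by simp
      qed
      ultimately show ?thesis by simp
    qed
  qed
qed

section \<open>Comparison of the two systems of equations\<close>

lemma cuts_equations_iff:
  "(\<forall>g \<in> f ` Q \<union> cpoly_var ` L. cpoly_eval g a = 0) \<longleftrightarrow>
   (\<forall>g \<in> split_quadrics.gens L gaps (\<lambda>c. c + 1) (\<lambda>c. N - c) gap_form. cpoly_eval g a = 0)"
proof -
  interpret split_quadrics "{1..N}" L gaps "\<lambda>c. c + 1" "\<lambda>c. N - c" gap_rest gap_form
    by (rule split_quadrics_gaps)
  have q: "cpoly_eval (q c) a = cpoly_eval (f (next_Q c)) a - cpoly_eval (f c) a" if "c \<in> gaps" for c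
    unfolding q_def gap_quadric[OF that] by simp
  show ?thesis
  proof
    assume *: "\<forall>g \<in> f ` Q \<union> cpoly_var ` L. cpoly_eval g a = 0"
    have "cpoly_eval (q c) a = 0" if "c \<in> gaps" for c
      using q[OF that] * gap(1,2)[OF that] by simp
    then show "\<forall>g\<in>gens. cpoly_eval g a = 0" using * unfolding gens_def by blast
  next
    assume *: "\<forall>g\<in>gens. cpoly_eval g a = 0"
    have L: "a c = 0" if "c \<in> L" for c
    proof -
      have "cpoly_eval (cpoly_var c) a = 0" using * that unfolding gens_def by blast
      then show ?thesis by simp
    qed
    have "cpoly_eval (f (next_Q c)) a = cpoly_eval (f c) a" if "c \<in> gaps" for c
    proof -
      have "cpoly_eval (q c) a = 0" using * that unfolding gens_def by blast
      then show ?thesis using q[OF that] by simp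
    qed
    then have "cpoly_eval (f d) a = 0" if "d \<in> Q" for d
      using f_eval_zero[of a] L that by blast
    then show "\<forall>g \<in> f ` Q \<union> cpoly_var ` L. cpoly_eval g a = 0" using L by auto
  qed
qed

lemma gens_gaps:
  "split_quadrics.gens L gaps (\<lambda>c. c + 1) (\<lambda>c. N - c) gap_form =
    {f d - f c | c d. consecutive_in Q c d \<and> d - c \<ge> 2} \<union> {cpoly_var c | c. c \<in> L}"
proof -
  interpret split_quadrics "{1..N}" L gaps "\<lambda>c. c + 1" "\<lambda>c. N - c" gap_rest gap_form
    by (rule split_quadrics_gaps)
  have "q ` gaps = (\<lambda>c. f (next_Q c) - f c) ` gaps"
    unfolding q_def using gap_quadric by (intro image_cong refl)
  also have "\<dots> = {f d - f c | c d. consecutive_in Q c d \<and> d - c \<ge> 2}"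
    unfolding gaps_iff by blast
  finally show ?thesis unfolding gens_def by blast
qed

end

theorem proposition4p15:
  fixes \<omega> :: "complex ^ 'n \<Rightarrow> complex ^ 'n \<Rightarrow> complex"
    and e :: "nat \<Rightarrow> complex ^ 'n"
    and \<tau> :: lie_type
    and m n :: nat
    and P T :: "nat set"
  assumes "CARD('n) \<ge> 2"
    and "bilinear_form \<omega>" and "nondegenerate \<omega>"
    and "has_lie_type \<omega> \<tau> n"
    and "is_basis e"
    and "\<forall>i\<in>{1..CARD('n)}. \<forall>j\<in>{i..CARD('n)}.
           \<omega> (e i) (e j) = (if i + j = CARD('n) + 1 then 1 else 0)"
    and "1 \<le> m" and "2 * m \<le> CARD('n)"
    and "P \<in> schubert_symbols (CARD('n)) m" and "T \<in> schubert_symbols (CARD('n)) m"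
    and "schubert_le \<omega> e m T P"
  shows "complete_intersection_cut_out_by e (Z_variety e \<tau> n P T)
     ({quadric \<tau> (CARD('n)) n d - quadric \<tau> (CARD('n)) n c | c d.
         consecutive_in (Q_set \<tau> (CARD('n)) n P T) c d \<and> d - c \<ge> 2} \<union>
      {cpoly_var c | c. c \<in> L_set \<tau> (CARD('n)) n P T})"
proof -
  define V where "V = {1..CARD('n)}"
  interpret coordinates e V
    by unfold_locales (use assms(5) V_def in auto)
  have type: "symmetric_form \<omega> \<or> skew_form \<omega>" "\<tau> = Type_D \<Longrightarrow> symmetric_form \<omega>"
    and N: "CARD('n) = (case \<tau> of Type_B \<Rightarrow> 2 * n + 1 | Type_C \<Rightarrow> 2 * n | Type_D \<Rightarrow> 2 * n + 2)"
    using assms(4) by (cases \<tau>; simp add: has_lie_type_def)+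
  have form: "\<forall>i\<in>V. \<forall>j\<in>{i..CARD('n)}. \<omega> (e i) (e j) = (if i + j = CARD('n) + 1 then 1 else 0)"
    using assms(6) unfolding V_def .
  have "\<forall>u v. \<omega> v u = \<omega> u v \<or> \<omega> v u = - \<omega> u v"
    using type(1) unfolding symmetric_form_def skew_form_def by blast
  then have zero: "\<omega> (e i) (e j) = 0" if "i \<in> V" "j \<in> V" "i + j \<noteq> CARD('n) + 1" for i j
    using basis_form[OF _ form that] by blast
  \<comment> \<open>This one point of the cell of \<open>P\<close> serves twice: it yields
    \<open>T \<le> P\<close>, and in type D it excludes the configuration with empty
    \<open>Z\<close>.\<close>
  obtain \<Sigma> b where \<Sigma>: "\<Sigma> \<in> schubert_cell \<omega> e m P" "is_frame m b \<Sigma>" "pluecker e m b T \<noteq> 0"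
    using schubert_le_cell_point[OF assms(2) zero assms(10,11)] by blast
  have TV: "T \<subseteq> V" "card T = m" and PV: "P \<subseteq> V" "card P = m"
    using assms(9,10) by (auto simp: schubert_symbols_def V_def)
  have inj: "v = 0" if "v \<in> \<Sigma>" "\<forall>c\<in>T. coord e v c = 0" for v
    using pluecker_nonzero_injective[OF \<Sigma>(2,3) TV that(1)] that(2) by blast
  have count: "count_upto P c \<le> count_upto T c" for c
  proof (cases "c \<le> CARD('n)")
    case True
    then show ?thesis using cell_count_le[OF \<Sigma>(1) TV(1) True] inj by blast
  next
    case False
    then have "P \<inter> {1..c} = P" "T \<inter> {1..c} = T" using TV(1) PV(1) by (auto simp: V_def)
    then show ?thesis using TV(2) PV(2) by simp
  qed
  interpret symbol_pair \<tau> "CARD('n)" n m P T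
    by unfold_locales (use assms(7,9,10) N count in auto)
  \<comment> \<open>If every variable were an equation, then \<open>T \<subseteq> L\<close>, which
    leaves only the odd mirror configuration of type D; the injectivity of \<open>\<Sigma>\<close>
    on the coordinates in \<open>T\<close> contradicts it.\<close>
  have proper: "L \<noteq> V"
  proof
    assume "L = V"
    then have "T \<subseteq> L" using TV(1) by blast
    then obtain l where D: "\<tau> = Type_D" "odd m" "P = (\<lambda>c. CARD('n) + 1 - c) ` T"
        "T \<union> P = {l..CARD('n) + 1 - l}"
      using T_subset_L by blast
    show False
      by (rule odd_maximal_isotropic_contradiction[OF assms(2) type(2)[OF D(1)] form assms(10) D(2-4) \<Sigma>(1,2)])
         (rule inj)
  qed
  interpret S: projective_split_quadrics e V L gaps "\<lambda>c. c + 1" "\<lambda>c. CARD('n) - c" gap_rest gap_form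
    by (intro projective_split_quadrics.intro coordinates_axioms projective_split_quadrics_axioms.intro
        proper split_quadrics_gaps[folded V_def])
  have "Z_variety e \<tau> n P T = S.Z"
    unfolding Z_variety_def S.Z_def proj_zeros_def vanishes_at_def using cuts_equations_iff by blast
  then show ?thesis
    using S.complete_intersection unfolding gens_gaps by simp
qed

end
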